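(* Let $\pi:\mathbb{E}\to M$ be a Killing submersion with bundle curvature $\tau\in C^\infty(M)$, and let $f:\mathbb{E}\to\mathbb{E}$ be a Killing isometry. Then: (a) There exists a unique isometry $h:M\to M$ such that $\pi\circ f=h\circ\pi$. (b) If $f$ preserves the orientation in $\mathbb{E}$, then $\tau\circ h=\tau$. (c) If $f$ reverses the orientation in $\mathbb{E}$, then $\tau\circ h=-\tau$.
   Context: All manifolds and maps are smooth. A vector $v\in T\mathbb{E}$ is vertical if $v\in\ker(d\pi)$ and horizontal if $v\in\ker(d\pi)^\perp$; a submersion is Riemannian if its differential preserves the length of horizontal vectors. A Killing submersion is a Riemannian submersion $\pi:\mathbb{E}\to M$ from a connected orientable Riemannian $3$-manifold $\mathbb{E}$ onto a connected orientable Riemannian surface $M$ admitting a complete vertical unit Killing vector field $\xi$ on $\mathbb{E}$, the fibers of $\pi$ being the integral curves of $\xi$. Fix an orientation of $\mathbb{E}$, let $\wedge$ be the associated cross product on tangent spaces and $\overline\nabla$ the Levi-Civita connection of $\mathbb{E}$. The bundle curvature is the unique function $\tau$ on $\mathbb{E}$ with $\overline\nabla_X\xi=\tau X\wedge\xi$ for all vector fields $X$ on $\mathbb{E}$; it is smooth, constant along the fibers (hence regarded also as a function $\tau\in C^\infty(M)$), and changes sign when the orientation of $\mathbb{E}$ is reversed. A Killing isometry of $\mathbb{E}$ is an isometry $f:\mathbb{E}\to\mathbb{E}$ such that $f_*\xi=\xi$ or $f_*\xi=-\xi$. *)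

theory Defs
  imports "HOL-Analysis.Analysis"
begin

section \<open>Smooth manifolds and smooth maps\<close>

text \<open>
  A manifold is a whole type \<open>'e\<close> with a (not necessarily maximal) smooth atlas compatible with
  the topology of the type; the Hausdorff and second countability axioms are imposed by the sort
  \<open>{t2_space, second_countable_topology}\<close>. A chart is a pair of an open domain \<open>U\<close> and a total
  function whose values outside \<open>U\<close> are irrelevant; its inverse is \<open>inv_into U \<phi>\<close>.
\<close>

type_synonym ('e, 'b) chart = "'e set \<times> ('e \<Rightarrow> 'b)"

text \<open>\<open>Ck_on k f S\<close> is meant for open \<open>S\<close> only, where it says that \<open>f\<close> is of class \<open>C\<^sup>k\<close>.\<close>

primrec Ck_on :: "nat \<Rightarrow> ('a::euclidean_space \<Rightarrow> 'b::euclidean_space) \<Rightarrow> 'a set \<Rightarrow> bool" where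
  "Ck_on 0 f S \<longleftrightarrow> continuous_on S f"
| "Ck_on (Suc k) f S \<longleftrightarrow> (\<forall>x\<in>S. f differentiable (at x)) \<and>
     (\<forall>v. Ck_on k (\<lambda>x. frechet_derivative f (at x) v) S)"

definition smooth_on :: "'a::euclidean_space set \<Rightarrow> ('a \<Rightarrow> 'b::euclidean_space) \<Rightarrow> bool" where
  "smooth_on S f \<longleftrightarrow> (\<forall>k. Ck_on k f S)"

definition smooth_atlas :: "('e::topological_space, 'b::euclidean_space) chart set \<Rightarrow> bool" where
  "smooth_atlas A \<longleftrightarrow>
     (\<Union>(U, \<phi>)\<in>A. U) = UNIV \<and>
     (\<forall>(U, \<phi>)\<in>A. open U \<and> open (\<phi> ` U) \<and> homeomorphism U (\<phi> ` U) \<phi> (inv_into U \<phi>)) \<and>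
     (\<forall>(U, \<phi>)\<in>A. \<forall>(V, \<psi>)\<in>A. smooth_on (\<phi> ` (U \<inter> V)) (\<psi> \<circ> inv_into U \<phi>))"

definition std_atlas :: "('b::euclidean_space, 'b) chart set" where
  "std_atlas = {(UNIV, id)}"

definition smooth_map ::
  "('e::topological_space, 'b::euclidean_space) chart set \<Rightarrow>
   ('m::topological_space, 'c::euclidean_space) chart set \<Rightarrow> ('e \<Rightarrow> 'm) \<Rightarrow> bool" where
  "smooth_map A B F \<longleftrightarrow> continuous_on UNIV F \<and>
     (\<forall>(U, \<phi>)\<in>A. \<forall>(V, \<psi>)\<in>B. smooth_on (\<phi> ` (U \<inter> F -` V)) (\<psi> \<circ> F \<circ> inv_into U \<phi>))"

abbreviation smooth_fun ::
  "('e::topological_space, 'b::euclidean_space) chart set \<Rightarrow> ('e \<Rightarrow> real) \<Rightarrow> bool" where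
  "smooth_fun A \<equiv> smooth_map A std_atlas"


section \<open>Tangent vectors and vector fields\<close>

text \<open>
  Tangent vectors at \<open>p\<close> are the derivations at \<open>p\<close> of the algebra of global smooth functions.
  They are made total by the value \<open>0\<close> on non-smooth functions, so that equality of tangent vectors
  is equality in HOL. The vector space operations are pointwise.
\<close>

type_synonym 'e tangent = "('e \<Rightarrow> real) \<Rightarrow> real"
type_synonym 'e field = "'e \<Rightarrow> 'e tangent"

definition tangent_space ::
  "('e::topological_space, 'b::euclidean_space) chart set \<Rightarrow> 'e \<Rightarrow> 'e tangent set" where
  "tangent_space A p = {v.
     (\<forall>f. \<not> smooth_fun A f \<longrightarrow> v f = 0) \<and>
     (\<forall>f g a b. smooth_fun A f \<longrightarrow> smooth_fun A g \<longrightarrow>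
        v (\<lambda>x. a * f x + b * g x) = a * v f + b * v g) \<and>
     (\<forall>f g. smooth_fun A f \<longrightarrow> smooth_fun A g \<longrightarrow>
        v (\<lambda>x. f x * g x) = f p * v g + g p * v f)}"

text \<open>The differential of a smooth map into the manifold with atlas \<open>B\<close>.\<close>

definition differential ::
  "('m::topological_space, 'c::euclidean_space) chart set \<Rightarrow> ('e \<Rightarrow> 'm) \<Rightarrow>
   'e tangent \<Rightarrow> 'm tangent" where
  "differential B F v = (\<lambda>f. if smooth_fun B f then v (f \<circ> F) else 0)"

definition smooth_field ::
  "('e::topological_space, 'b::euclidean_space) chart set \<Rightarrow> 'e field \<Rightarrow> bool" where
  "smooth_field A X \<longleftrightarrow> (\<forall>p. X p \<in> tangent_space A p) \<and>
     (\<forall>f. smooth_fun A f \<longrightarrow> smooth_fun A (\<lambda>p. X p f))"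

definition lie_bracket ::
  "('e::topological_space, 'b::euclidean_space) chart set \<Rightarrow> 'e field \<Rightarrow> 'e field \<Rightarrow> 'e field" where
  "lie_bracket A X Y = (\<lambda>p f. if smooth_fun A f
     then X p (\<lambda>q. Y q f) - Y p (\<lambda>q. X q f) else 0)"

text \<open>Integral curves defined on the whole real line.\<close>

definition integral_curve ::
  "('e::topological_space, 'b::euclidean_space) chart set \<Rightarrow> 'e field \<Rightarrow> (real \<Rightarrow> 'e) \<Rightarrow> bool" where
  "integral_curve A X \<gamma> \<longleftrightarrow> smooth_map std_atlas A \<gamma> \<and>
     (\<forall>f t. smooth_fun A f \<longrightarrow> ((\<lambda>s. f (\<gamma> s)) has_real_derivative X (\<gamma> t) f) (at t))"

definition complete_field ::
  "('e::topological_space, 'b::euclidean_space) chart set \<Rightarrow> 'e field \<Rightarrow> bool" where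
  "complete_field A X \<longleftrightarrow> smooth_field A X \<and> (\<forall>p. \<exists>\<gamma>. integral_curve A X \<gamma> \<and> \<gamma> 0 = p)"


section \<open>Riemannian metrics and the Levi-Civita connection\<close>

type_synonym 'e metric = "'e \<Rightarrow> 'e tangent \<Rightarrow> 'e tangent \<Rightarrow> real"

definition riemannian_metric ::
  "('e::topological_space, 'b::euclidean_space) chart set \<Rightarrow> 'e metric \<Rightarrow> bool" where
  "riemannian_metric A g \<longleftrightarrow>
     (\<forall>p. \<forall>u\<in>tangent_space A p. \<forall>v\<in>tangent_space A p. \<forall>w\<in>tangent_space A p. \<forall>a b.
        g p (\<lambda>f. a * u f + b * v f) w = a * g p u w + b * g p v w) \<and>
     (\<forall>p. \<forall>u\<in>tangent_space A p. \<forall>v\<in>tangent_space A p. g p u v = g p v u) \<and>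
     (\<forall>p. \<forall>u\<in>tangent_space A p. u \<noteq> (\<lambda>f. 0) \<longrightarrow> 0 < g p u u) \<and>
     (\<forall>X Y. smooth_field A X \<longrightarrow> smooth_field A Y \<longrightarrow> smooth_fun A (\<lambda>p. g p (X p) (Y p)))"

definition riemannian_isometry ::
  "('e::topological_space, 'b::euclidean_space) chart set \<Rightarrow> 'e metric \<Rightarrow>
   ('m::topological_space, 'c::euclidean_space) chart set \<Rightarrow> 'm metric \<Rightarrow> ('e \<Rightarrow> 'm) \<Rightarrow> bool" where
  "riemannian_isometry A g B h F \<longleftrightarrow> bij F \<and> smooth_map A B F \<and> smooth_map B A (inv F) \<and>
     (\<forall>p. \<forall>u\<in>tangent_space A p. \<forall>v\<in>tangent_space A p.
        h (F p) (differential B F u) (differential B F v) = g p u v)"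

text \<open>\<open>D X Y\<close> stands for the covariant derivative of \<open>Y\<close> along \<open>X\<close>.\<close>

definition affine_connection ::
  "('e::topological_space, 'b::euclidean_space) chart set \<Rightarrow>
   ('e field \<Rightarrow> 'e field \<Rightarrow> 'e field) \<Rightarrow> bool" where
  "affine_connection A D \<longleftrightarrow>
     (\<forall>X Y. smooth_field A X \<longrightarrow> smooth_field A Y \<longrightarrow> smooth_field A (D X Y)) \<and>
     (\<forall>X X' Y a b. smooth_field A X \<longrightarrow> smooth_field A X' \<longrightarrow> smooth_field A Y \<longrightarrow>
        smooth_fun A a \<longrightarrow> smooth_fun A b \<longrightarrow>
        D (\<lambda>p f. a p * X p f + b p * X' p f) Y = (\<lambda>p f. a p * D X Y p f + b p * D X' Y p f)) \<and>
     (\<forall>X Y Y'. smooth_field A X \<longrightarrow> smooth_field A Y \<longrightarrow> smooth_field A Y' \<longrightarrow>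
        D X (\<lambda>p f. Y p f + Y' p f) = (\<lambda>p f. D X Y p f + D X Y' p f)) \<and>
     (\<forall>X Y a. smooth_field A X \<longrightarrow> smooth_field A Y \<longrightarrow> smooth_fun A a \<longrightarrow>
        D X (\<lambda>p f. a p * Y p f) = (\<lambda>p f. X p a * Y p f + a p * D X Y p f))"

definition levi_civita ::
  "('e::topological_space, 'b::euclidean_space) chart set \<Rightarrow> 'e metric \<Rightarrow>
   ('e field \<Rightarrow> 'e field \<Rightarrow> 'e field) \<Rightarrow> bool" where
  "levi_civita A g D \<longleftrightarrow> affine_connection A D \<and>
     (\<forall>X Y Z p. smooth_field A X \<longrightarrow> smooth_field A Y \<longrightarrow> smooth_field A Z \<longrightarrow>
        X p (\<lambda>q. g q (Y q) (Z q)) = g p (D X Y p) (Z p) + g p (Y p) (D X Z p)) \<and>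
     (\<forall>X Y. smooth_field A X \<longrightarrow> smooth_field A Y \<longrightarrow>
        (\<lambda>p f. D X Y p f - D Y X p f) = lie_bracket A X Y)"

text \<open>The Lie derivative of the metric along \<open>X\<close> vanishes.\<close>

definition killing_field ::
  "('e::topological_space, 'b::euclidean_space) chart set \<Rightarrow> 'e metric \<Rightarrow> 'e field \<Rightarrow> bool" where
  "killing_field A g X \<longleftrightarrow> smooth_field A X \<and>
     (\<forall>Y Z p. smooth_field A Y \<longrightarrow> smooth_field A Z \<longrightarrow>
        X p (\<lambda>q. g q (Y q) (Z q)) =
          g p (lie_bracket A X Y p) (Z p) + g p (Y p) (lie_bracket A X Z p))"


section \<open>Orientation and cross product\<close>

text \<open>
  An orientation of the manifold with atlas \<open>A\<close> is given by a smoothly compatible atlas whose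
  coordinate changes have positive Jacobian determinant.
\<close>

definition orientation ::
  "('e::topological_space, real^'n) chart set \<Rightarrow> ('e, real^'n) chart set \<Rightarrow> bool" where
  "orientation A Or \<longleftrightarrow> smooth_atlas Or \<and> smooth_atlas (A \<union> Or) \<and>
     (\<forall>(U, \<phi>)\<in>Or. \<forall>(V, \<psi>)\<in>Or. \<forall>p\<in>U \<inter> V.
        0 < det (jacobian (\<psi> \<circ> inv_into U \<phi>) (at (\<phi> p))))"

definition orientable :: "('e::topological_space, real^'n) chart set \<Rightarrow> bool" where
  "orientable A \<longleftrightarrow> (\<exists>Or. orientation A Or)"

definition orientation_preserving ::
  "('e::topological_space, real^'n) chart set \<Rightarrow> ('e \<Rightarrow> 'e) \<Rightarrow> bool" where
  "orientation_preserving Or F \<longleftrightarrow>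
     (\<forall>(U, \<phi>)\<in>Or. \<forall>(V, \<psi>)\<in>Or. \<forall>p\<in>U \<inter> F -` V.
        0 < det (jacobian (\<psi> \<circ> F \<circ> inv_into U \<phi>) (at (\<phi> p))))"

definition orientation_reversing ::
  "('e::topological_space, real^'n) chart set \<Rightarrow> ('e \<Rightarrow> 'e) \<Rightarrow> bool" where
  "orientation_reversing Or F \<longleftrightarrow>
     (\<forall>(U, \<phi>)\<in>Or. \<forall>(V, \<psi>)\<in>Or. \<forall>p\<in>U \<inter> F -` V.
        det (jacobian (\<psi> \<circ> F \<circ> inv_into U \<phi>) (at (\<phi> p))) < 0)"

text \<open>The tangent vector at \<open>p\<close> with components \<open>a\<close> in the chart \<open>(U, \<phi>)\<close>.\<close>

definition chart_vector ::
  "('e::topological_space, 'b::euclidean_space) chart set \<Rightarrow> ('e, 'b) chart \<Rightarrow> 'e \<Rightarrow> 'b \<Rightarrow>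
   'e tangent" where
  "chart_vector A = (\<lambda>(U, \<phi>) p a f.
     if smooth_fun A f then frechet_derivative (f \<circ> inv_into U \<phi>) (at (\<phi> p)) a else 0)"

definition positive_basis ::
  "('e::topological_space, real^'n) chart set \<Rightarrow> 'e \<Rightarrow> ('n \<Rightarrow> 'e tangent) \<Rightarrow> bool" where
  "positive_basis Or p e \<longleftrightarrow> (\<exists>(U, \<phi>)\<in>Or. p \<in> U \<and>
     (\<exists>M :: real^'n^'n. 0 < det M \<and> (\<forall>i. e i = chart_vector Or (U, \<phi>) p (M $ i))))"

definition positive_orthonormal_basis ::
  "'e metric \<Rightarrow> ('e::topological_space, real^'n) chart set \<Rightarrow> 'e \<Rightarrow> ('n \<Rightarrow> 'e tangent) \<Rightarrow> bool" where
  "positive_orthonormal_basis g Or p e \<longleftrightarrow> positive_basis Or p e \<and>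
     (\<forall>i j. g p (e i) (e j) = (if i = j then 1 else 0))"

text \<open>
  The cross product of \<open>u\<close> and \<open>v\<close>, tangent at \<open>p\<close>: in every positively oriented orthonormal basis
  its components are those of the usual cross product of the components of \<open>u\<close> and \<open>v\<close>.
\<close>

definition cross_product ::
  "'e metric \<Rightarrow> ('e::topological_space, real^3) chart set \<Rightarrow> 'e \<Rightarrow> 'e tangent \<Rightarrow> 'e tangent \<Rightarrow>
   'e tangent" where
  "cross_product g Or p u v = (THE w. w \<in> tangent_space Or p \<and>
     (\<forall>e. positive_orthonormal_basis g Or p e \<longrightarrow>
        (\<chi> i. g p w (e i)) = cross3 (\<chi> i. g p u (e i)) (\<chi> i. g p v (e i))))"


section \<open>Killing submersions\<close>

definition vertical ::
  "('e::topological_space, 'b::euclidean_space) chart set \<Rightarrow>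
   ('m::topological_space, 'c::euclidean_space) chart set \<Rightarrow> ('e \<Rightarrow> 'm) \<Rightarrow> 'e \<Rightarrow> 'e tangent set" where
  "vertical A B \<pi> p = {v \<in> tangent_space A p. differential B \<pi> v = (\<lambda>f. 0)}"

definition horizontal ::
  "('e::topological_space, 'b::euclidean_space) chart set \<Rightarrow> 'e metric \<Rightarrow>
   ('m::topological_space, 'c::euclidean_space) chart set \<Rightarrow> ('e \<Rightarrow> 'm) \<Rightarrow> 'e \<Rightarrow> 'e tangent set" where
  "horizontal A g B \<pi> p = {v \<in> tangent_space A p. \<forall>w\<in>vertical A B \<pi> p. g p v w = 0}"

definition riemannian_submersion ::
  "('e::topological_space, 'b::euclidean_space) chart set \<Rightarrow> 'e metric \<Rightarrow>
   ('m::topological_space, 'c::euclidean_space) chart set \<Rightarrow> 'm metric \<Rightarrow> ('e \<Rightarrow> 'm) \<Rightarrow> bool" where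
  "riemannian_submersion A g B h \<pi> \<longleftrightarrow> smooth_map A B \<pi> \<and>
     (\<forall>p. differential B \<pi> ` tangent_space A p = tangent_space B (\<pi> p)) \<and>
     (\<forall>p. \<forall>v\<in>horizontal A g B \<pi> p. h (\<pi> p) (differential B \<pi> v) (differential B \<pi> v) = g p v v)"

text \<open>
  The field \<open>\<xi>\<close> is part of the data. Since \<open>\<xi>\<close> is complete, its maximal integral curves are the
  ones defined on the whole real line, as required by \<open>integral_curve\<close>.
\<close>

definition killing_submersion ::
  "('e::{t2_space, second_countable_topology}, real^3) chart set \<Rightarrow> 'e metric \<Rightarrow>
   ('m::{t2_space, second_countable_topology}, real^2) chart set \<Rightarrow> 'm metric \<Rightarrow>
   ('e \<Rightarrow> 'm) \<Rightarrow> 'e field \<Rightarrow> bool" where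
  "killing_submersion A g B h \<pi> \<xi> \<longleftrightarrow>
     smooth_atlas A \<and> connected (UNIV :: 'e set) \<and> orientable A \<and> riemannian_metric A g \<and>
     smooth_atlas B \<and> connected (UNIV :: 'm set) \<and> orientable B \<and> riemannian_metric B h \<and>
     riemannian_submersion A g B h \<pi> \<and> surj \<pi> \<and>
     complete_field A \<xi> \<and> killing_field A g \<xi> \<and>
     (\<forall>p. \<xi> p \<in> vertical A B \<pi> p \<and> g p (\<xi> p) (\<xi> p) = 1) \<and>
     range (\<lambda>x. \<pi> -` {x}) = {range \<gamma> |\<gamma>. integral_curve A \<xi> \<gamma>}"

definition bundle_curvature ::
  "('e::topological_space, real^3) chart set \<Rightarrow> 'e metric \<Rightarrow> ('e, real^3) chart set \<Rightarrow>
   ('e field \<Rightarrow> 'e field \<Rightarrow> 'e field) \<Rightarrow> 'e field \<Rightarrow> ('e \<Rightarrow> real) \<Rightarrow> bool" where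
  "bundle_curvature A g Or D \<xi> \<tau> \<longleftrightarrow>
     (\<forall>X p. smooth_field A X \<longrightarrow> D X \<xi> p = (\<lambda>f. \<tau> p * cross_product g Or p (X p) (\<xi> p) f))"

definition killing_isometry ::
  "('e::topological_space, 'b::euclidean_space) chart set \<Rightarrow> 'e metric \<Rightarrow> 'e field \<Rightarrow>
   ('e \<Rightarrow> 'e) \<Rightarrow> bool" where
  "killing_isometry A g \<xi> F \<longleftrightarrow> riemannian_isometry A g A g F \<and>
     ((\<forall>p. differential A F (\<xi> p) = \<xi> (F p)) \<or>
      (\<forall>p. differential A F (\<xi> p) = (\<lambda>f. - \<xi> (F p) f)))"

end

theory Submission
  imports Defs "HOL-Real_Asymp.Real_Asymp"
begin

text \<open>
  Write $f_* \<xi> = \<epsilon> \<xi>$ with $\<epsilon> = \<pm>1$. For part (a), \<open>f\<close> carries integral curves of \<open>\<xi>\<close> to integral curves,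
  run backwards if $\<epsilon> = -1$ (\<open>integral_curve_image\<close>), so \<open>f\<close> and its inverse map fibers into fibers
  (\<open>killing_isometry_maps_fibers\<close>) and \<open>\<pi> \<circ> f\<close> factors as \<open>h \<circ> \<pi>\<close> with \<open>h\<close> bijective. A submersion has
  smooth local sections (\<open>submersion_local_section\<close>), and composing \<open>\<pi> \<circ> f\<close> with one of them shows that
  \<open>h\<close> is smooth (\<open>smooth_map_descend\<close>). The differential of \<open>f\<close> preserves the metric and the kernel of the
  differential of \<open>\<pi>\<close>, hence horizontality; as \<open>\<pi>\<close> maps horizontal spaces isometrically onto the tangent
  spaces of the base, \<open>h\<close> is an isometry (\<open>ex_induced_isometry\<close>). Uniqueness is surjectivity of \<open>\<pi>\<close>.

  For parts (b) and (c), consider the one-form $\<eta> = g(\<xi>, \<cdot>)$. Metric compatibility and symmetry of the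
  Levi-Civita connection give
    $d\<eta>(X,Y) = g(\<nabla>_X \<xi>, Y) - g(\<nabla>_Y \<xi>, X) = 2 \<tau> g(X \<and> \<xi>, Y)$
  (\<open>dual_form_derivative_bundle_curvature\<close>). The left-hand side involves only the metric, \<open>\<xi>\<close> and the Lie
  bracket, so replacing $X, Y$ by $f_* X, f_* Y$ multiplies it by \<open>\<epsilon>\<close>
  (\<open>dual_form_derivative_pushforward\<close>). The triple product $g(X \<and> \<xi>, Y)$ is multiplied by $\<epsilon> \<sigma>$, where
  \<open>\<sigma>\<close> is \<open>1\<close> if \<open>f\<close> preserves the orientation and \<open>-1\<close> if it reverses it (\<open>cross_product_isometry\<close>).
  Comparing at vectors with nonzero triple product yields $\<tau> \<circ> f = \<sigma> \<tau>$
  (\<open>bundle_curvature_isometry\<close>).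

  Since tangent vectors are derivations of the algebra of global smooth functions, all computations in
  coordinates rest on the fact that they are exactly the chart vectors (\<open>tangent_chart_vector\<close>), which is
  proved with bump functions and Hadamard's lemma. The local sections come from the inverse function
  theorem, whose inverse must be shown to be of class $C^\<infinity>$ (\<open>smooth_inverse_function\<close>).
\<close>

section \<open>Calculus of smooth functions on open sets\<close>

lemma Ck_on_subset: "Ck_on k f S \<Longrightarrow> T \<subseteq> S \<Longrightarrow> Ck_on k f T"
  by (induction k arbitrary: f) (auto intro: continuous_on_subset)

text \<open>
  Being of class $C^k$ is a local property because the derivatives are taken at points of the whole
  space, not within the set.
\<close>

lemma Ck_on_local:
  assumes "\<And>x. x \<in> S \<Longrightarrow> \<exists>T. open T \<and> x \<in> T \<and> Ck_on k f T"
  shows "Ck_on k f S"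
  using assms
proof (induction k arbitrary: f)
  case 0
  then show ?case
    by (simp, intro continuous_at_imp_continuous_on ballI)
      (metis continuous_on_eq_continuous_at)
next
  case (Suc k)
  then show ?case by (simp) (meson)
qed

lemma Ck_on_cong:
  assumes "open S" "\<And>x. x \<in> S \<Longrightarrow> f x = g x"
  shows "Ck_on k f S \<longleftrightarrow> Ck_on k g S"
proof -
  have *: "Ck_on k g S" if "Ck_on k f S" "\<And>x. x \<in> S \<Longrightarrow> f x = g x" for f g :: "'a \<Rightarrow> 'b"
    using that
  proof (induction k arbitrary: f g)
    case 0
    then show ?case using continuous_on_cong by (metis Ck_on.simps(1))
  next
    case (Suc k)
    have d: "g differentiable at x" if "x \<in> S" for x
      using Suc.prems that \<open>open S\<close>
      by (metis Ck_on.simps(2) differentiable_def has_derivative_transform_within_open)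
    have e: "frechet_derivative f (at x) = frechet_derivative g (at x)" if "x \<in> S" for x
      using frechet_derivative_transform_within_open[of f x S g] Suc.prems that \<open>open S\<close> by simp
    have "Ck_on k (\<lambda>x. frechet_derivative g (at x) v) S" for v
      by (rule Suc.IH[of "\<lambda>x. frechet_derivative f (at x) v"]) (use Suc.prems e in auto)
    with d show ?case by simp
  qed
  show ?thesis using *[of f g] *[of g f] assms(2) by auto
qed

text \<open>
  The introduction rule for inductions on the order of differentiability: it accepts any family of
  derivatives instead of \<open>frechet_derivative\<close>, so that the usual differentiation rules apply.
\<close>

lemma Ck_on_SucI:
  assumes "open S" "\<And>x. x \<in> S \<Longrightarrow> (f has_derivative f' x) (at x)"
    "\<And>v. Ck_on k (\<lambda>x. f' x v) S"
  shows "Ck_on (Suc k) f S"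
proof -
  have "Ck_on k (\<lambda>x. frechet_derivative f (at x) v) S" for v
    using assms(3)[of v] Ck_on_cong[OF assms(1), of "\<lambda>x. f' x v" "\<lambda>x. frechet_derivative f (at x) v" k]
      frechet_derivative_at[OF assms(2)] by simp
  then show ?thesis using assms(2) by (auto simp: differentiable_def)
qed

lemma Ck_on_SucD:
  assumes "Ck_on (Suc k) f S"
  shows "x \<in> S \<Longrightarrow> (f has_derivative frechet_derivative f (at x)) (at x)"
    and "Ck_on k (\<lambda>x. frechet_derivative f (at x) v) S"
  using assms frechet_derivative_works by auto

lemma Ck_on_Suc_imp: "Ck_on (Suc k) f S \<Longrightarrow> Ck_on k f S"
proof (induction k arbitrary: f)
  case 0
  then show ?case
    by (auto intro!: continuous_at_imp_continuous_on differentiable_imp_continuous_within)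
next
  case (Suc k)
  then show ?case by (metis Ck_on.simps(2))
qed

lemma Ck_on_imp_continuous: "Ck_on k f S \<Longrightarrow> continuous_on S f"
  by (induction k) (auto dest: Ck_on_Suc_imp simp del: Ck_on.simps(2))

lemma Ck_on_const: "open S \<Longrightarrow> Ck_on k (\<lambda>x. c) S"
proof (induction k arbitrary: c)
  case (Suc k)
  then show ?case by (intro Ck_on_SucI[where f' = "\<lambda>x v. 0"]) auto
qed simp

lemma Ck_on_linear:
  assumes "open S" "bounded_linear L"
  shows "Ck_on k L S"
proof (cases k)
  case 0
  then show ?thesis using assms(2) by (simp add: linear_continuous_on)
next
  case (Suc k)
  show ?thesis unfolding Suc
    by (rule Ck_on_SucI[where f' = "\<lambda>x. L"])
      (use assms in \<open>auto intro: bounded_linear_imp_has_derivative Ck_on_const\<close>)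
qed

lemma Ck_on_linear_comp:
  assumes "open S" "bounded_linear L" "Ck_on k f S"
  shows "Ck_on k (\<lambda>x. L (f x)) S"
  using assms(3)
proof (induction k arbitrary: f)
  case 0
  then show ?case
    by (simp add: bounded_linear.continuous_on[OF assms(2)])
next
  case (Suc k)
  show ?case
    by (rule Ck_on_SucI[where f' = "\<lambda>x v. L (frechet_derivative f (at x) v)"])
      (use assms Suc Ck_on_SucD[OF Suc.prems] in
        \<open>auto intro: bounded_linear.has_derivative[OF assms(2)]\<close>)
qed

lemma Ck_on_add:
  assumes "open S" "Ck_on k f S" "Ck_on k g S"
  shows "Ck_on k (\<lambda>x. f x + g x) S"
  using assms(2,3)
proof (induction k arbitrary: f g)
  case 0
  then show ?case by (simp add: continuous_on_add)
next
  case (Suc k)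
  show ?case
    by (rule Ck_on_SucI[where f' = "\<lambda>x v. frechet_derivative f (at x) v + frechet_derivative g (at x) v"])
      (use assms(1) Suc Ck_on_SucD[OF Suc.prems(1)] Ck_on_SucD[OF Suc.prems(2)] in
        \<open>auto intro: has_derivative_add\<close>)
qed

lemma Ck_on_sum:
  assumes "open S" "\<And>i. i \<in> I \<Longrightarrow> Ck_on k (f i) S"
  shows "Ck_on k (\<lambda>x. \<Sum>i\<in>I. f i x) S"
  using assms(2)
  by (induction I rule: infinite_finite_induct) (auto intro: Ck_on_const Ck_on_add assms(1))

lemma Ck_on_scaleR:
  fixes f :: "'a::euclidean_space \<Rightarrow> real"
  assumes "open S" "Ck_on k f S" "Ck_on k g S"
  shows "Ck_on k (\<lambda>x. f x *\<^sub>R g x) S"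
  using assms(2,3)
proof (induction k arbitrary: f g)
  case 0
  then show ?case by (simp add: continuous_on_scaleR)
next
  case (Suc k)
  have "Ck_on k (\<lambda>x. f x *\<^sub>R frechet_derivative g (at x) v + frechet_derivative f (at x) v *\<^sub>R g x) S" for v
    by (intro Ck_on_add assms(1) Suc.IH Ck_on_SucD(2) Suc.prems Ck_on_Suc_imp)
  then show ?case
    by (intro Ck_on_SucI[where f' = "\<lambda>x v. f x *\<^sub>R frechet_derivative g (at x) v + frechet_derivative f (at x) v *\<^sub>R g x"])
      (use assms(1) Ck_on_SucD[OF Suc.prems(1)] Ck_on_SucD[OF Suc.prems(2)] in
        \<open>auto intro: has_derivative_scaleR\<close>)
qed

lemma Ck_on_mult:
  fixes f g :: "'a::euclidean_space \<Rightarrow> real"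
  assumes "open S" "Ck_on k f S" "Ck_on k g S"
  shows "Ck_on k (\<lambda>x. f x * g x) S"
  using Ck_on_scaleR[OF assms] by simp

lemma Ck_on_prod:
  fixes f :: "'i \<Rightarrow> 'a::euclidean_space \<Rightarrow> real"
  assumes "open S" "\<And>i. i \<in> I \<Longrightarrow> Ck_on k (f i) S"
  shows "Ck_on k (\<lambda>x. \<Prod>i\<in>I. f i x) S"
  using assms(2)
  by (induction I rule: infinite_finite_induct) (auto intro: Ck_on_const Ck_on_mult assms(1))

text \<open>
  Expanded in the standard basis, the derivative of a composition is a sum of products in which one
  factor is the derivative of the inner function and the other is again a composition, so that the
  induction hypothesis applies to both.
\<close>

lemma Ck_on_compose:
  assumes "open S" "open T" "Ck_on k f S" "Ck_on k g T" "f ` S \<subseteq> T"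
  shows "Ck_on k (\<lambda>x. g (f x)) S"
  using assms(3-5)
proof (induction k arbitrary: f g)
  case 0
  then show ?case by (auto intro: continuous_on_compose2)
next
  case (Suc k)
  have d: "((\<lambda>x. g (f x)) has_derivative
      (\<lambda>v. frechet_derivative g (at (f x)) (frechet_derivative f (at x) v))) (at x)" if "x \<in> S" for x
    using has_derivative_compose[OF Ck_on_SucD(1)[OF Suc.prems(1) that]
        Ck_on_SucD(1)[OF Suc.prems(2)]] Suc.prems(3) that by blast
  have eq: "frechet_derivative g (at (f x)) (frechet_derivative f (at x) v)
     = (\<Sum>b\<in>Basis. (frechet_derivative f (at x) v \<bullet> b) *\<^sub>R frechet_derivative g (at (f x)) b)"
    if "x \<in> S" for x v
  proof -
    have "f x \<in> T" using Suc.prems that by blast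
    then have lin: "linear (frechet_derivative g (at (f x)))"
      using Ck_on_SucD(1)[OF Suc.prems(2)] has_derivative_linear by blast
    show ?thesis
      using linear_sum[OF lin, of "\<lambda>b. (frechet_derivative f (at x) v \<bullet> b) *\<^sub>R b" Basis]
        linear_scale[OF lin] by (simp add: euclidean_representation)
  qed
  have "Ck_on k (\<lambda>x. \<Sum>b\<in>Basis. (frechet_derivative f (at x) v \<bullet> b) *\<^sub>R frechet_derivative g (at (f x)) b) S" for v
    by (intro Ck_on_sum Ck_on_scaleR assms(1) Suc.IH[where g = "\<lambda>y. frechet_derivative g (at y) _"]
       Ck_on_linear_comp[OF assms(1) bounded_linear_inner_left] Ck_on_SucD(2) Suc.prems Ck_on_Suc_imp)
  then have "Ck_on k (\<lambda>x. frechet_derivative g (at (f x)) (frechet_derivative f (at x) v)) S" for v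
    by (rule Ck_on_cong[OF assms(1), THEN iffD1, rotated]) (simp add: eq)
  then show ?case by (intro Ck_on_SucI[OF assms(1) d])
qed

lemma Ck_on_inverse:
  fixes f :: "'a::euclidean_space \<Rightarrow> real"
  assumes "open S" "Ck_on k f S" "\<And>x. x \<in> S \<Longrightarrow> f x \<noteq> 0"
  shows "Ck_on k (\<lambda>x. inverse (f x)) S"
  using assms(2)
proof (induction k)
  case 0
  then show ?case using assms(3) by (auto intro: continuous_on_inverse)
next
  case (Suc k)
  have "Ck_on k (\<lambda>x. (-1) * (inverse (f x) * frechet_derivative f (at x) v * inverse (f x))) S" for v
    by (intro Ck_on_mult Ck_on_const assms(1) Suc.IH Ck_on_SucD(2) Suc.prems Ck_on_Suc_imp)
  then show ?case
    by (intro Ck_on_SucI[OF assms(1), where f' = "\<lambda>x v. - (inverse (f x) * frechet_derivative f (at x) v * inverse (f x))"])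
      (use assms(3) Ck_on_SucD[OF Suc.prems] in \<open>auto intro!: has_derivative_inverse\<close>)
qed

lemma Ck_on_componentwise:
  assumes "open S" "\<And>b. b \<in> Basis \<Longrightarrow> Ck_on k (\<lambda>x. f x \<bullet> b) S"
  shows "Ck_on k f S"
proof -
  have "Ck_on k (\<lambda>x. \<Sum>b\<in>Basis. (f x \<bullet> b) *\<^sub>R b) S"
    by (intro Ck_on_sum Ck_on_scaleR Ck_on_const assms)
  then show ?thesis by (simp add: euclidean_representation)
qed

lemma smooth_onI: "(\<And>k. Ck_on k f S) \<Longrightarrow> smooth_on S f"
  and smooth_onD: "smooth_on S f \<Longrightarrow> Ck_on k f S"
  by (auto simp: smooth_on_def)

lemma smooth_on_subset: "smooth_on S f \<Longrightarrow> T \<subseteq> S \<Longrightarrow> smooth_on T f"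
  by (auto simp: smooth_on_def intro: Ck_on_subset)

lemma smooth_on_local:
  assumes "\<And>x. x \<in> S \<Longrightarrow> \<exists>T. open T \<and> x \<in> T \<and> smooth_on T f"
  shows "smooth_on S f"
  unfolding smooth_on_def by (meson assms Ck_on_local smooth_onD)

lemma smooth_on_cong:
  assumes "open S" "\<And>x. x \<in> S \<Longrightarrow> f x = g x"
  shows "smooth_on S f \<longleftrightarrow> smooth_on S g"
  unfolding smooth_on_def using Ck_on_cong[OF assms] by auto

lemma smooth_on_imp_continuous: "smooth_on S f \<Longrightarrow> continuous_on S f"
  by (auto simp: smooth_on_def dest: Ck_on_imp_continuous)

lemma smooth_on_has_derivative:
  "smooth_on S f \<Longrightarrow> x \<in> S \<Longrightarrow> (f has_derivative frechet_derivative f (at x)) (at x)"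
  using Ck_on_SucD(1) smooth_onD by blast

lemma smooth_on_derivative: "smooth_on S f \<Longrightarrow> smooth_on S (\<lambda>x. frechet_derivative f (at x) v)"
  by (rule smooth_onI, rule Ck_on_SucD(2)) (simp add: smooth_onD del: Ck_on.simps)

lemma smooth_on_const: "open S \<Longrightarrow> smooth_on S (\<lambda>x. c)"
  by (simp add: smooth_onI Ck_on_const)

lemma smooth_on_linear: "open S \<Longrightarrow> bounded_linear L \<Longrightarrow> smooth_on S L"
  by (simp add: smooth_onI Ck_on_linear)

lemma smooth_on_add:
  "open S \<Longrightarrow> smooth_on S f \<Longrightarrow> smooth_on S g \<Longrightarrow> smooth_on S (\<lambda>x. f x + g x)"
  by (simp add: smooth_on_def Ck_on_add)

lemma smooth_on_mult:
  fixes f g :: "'a::euclidean_space \<Rightarrow> real"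
  shows "open S \<Longrightarrow> smooth_on S f \<Longrightarrow> smooth_on S g \<Longrightarrow> smooth_on S (\<lambda>x. f x * g x)"
  by (simp add: smooth_on_def Ck_on_mult)

lemma smooth_on_inverse:
  fixes f :: "'a::euclidean_space \<Rightarrow> real"
  shows "open S \<Longrightarrow> smooth_on S f \<Longrightarrow> (\<And>x. x \<in> S \<Longrightarrow> f x \<noteq> 0) \<Longrightarrow> smooth_on S (\<lambda>x. inverse (f x))"
  by (simp add: smooth_on_def Ck_on_inverse)

lemma smooth_on_compose:
  "open S \<Longrightarrow> open T \<Longrightarrow> smooth_on S f \<Longrightarrow> smooth_on T g \<Longrightarrow> f ` S \<subseteq> T \<Longrightarrow> smooth_on S (\<lambda>x. g (f x))"
  by (rule smooth_onI, rule Ck_on_compose[of S T]) (auto intro: smooth_onD)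

section \<open>Bump functions\<close>

text \<open>
  The case \<open>n = 0\<close> is the standard function that is smooth and flat at the origin. The extra powers of
  \<open>1 / t\<close> make the family closed under differentiation up to linear combinations.
\<close>

definition flat_exp :: "nat \<Rightarrow> real \<Rightarrow> real" where
  "flat_exp n t = (if 0 < t then exp (- inverse t) * inverse t ^ n else 0)"

lemma flat_exp_tendsto: "((\<lambda>t. exp (- inverse t) * inverse t ^ n :: real) \<longlongrightarrow> 0) (at_right 0)"
  by real_asymp

lemma flat_exp_has_derivative:
  "(flat_exp n has_real_derivative (flat_exp (n + 2) t - of_nat n * flat_exp (n + 1) t)) (at t)"
proof -
  consider "t < 0" | "t = 0" | "0 < t" by linarith
  then show ?thesis
  proof cases
    case 1
    have "((\<lambda>t. 0) has_real_derivative 0) (at t)" by simp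
    then have "(flat_exp n has_real_derivative 0) (at t)"
      by (rule has_field_derivative_transform_within_open[where S = "{..<0}"])
        (use 1 in \<open>auto simp: flat_exp_def\<close>)
    then show ?thesis using 1 by (simp add: flat_exp_def)
  next
    case 2
    have l: "((\<lambda>h. flat_exp n h / h) \<longlongrightarrow> 0) (at_left 0)"
      by (rule tendsto_eventually) (auto simp: eventually_at_filter flat_exp_def)
    have r: "((\<lambda>h. flat_exp n h / h) \<longlongrightarrow> 0) (at_right 0)"
      by (rule Lim_transform_eventually[OF flat_exp_tendsto[of "Suc n"]])
        (auto simp: eventually_at_filter flat_exp_def divide_inverse)
    have "((\<lambda>h. flat_exp n h / h) \<longlongrightarrow> 0) (at 0)"
      using l r by (simp add: filterlim_split_at)
    then show ?thesis using 2
      by (simp add: DERIV_def flat_exp_def)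
  next
    case 3
    have n: "real n * inverse t ^ (n - Suc 0) * inverse t = real n * inverse t ^ n"
      by (cases n) auto
    have "((\<lambda>t. exp (- inverse t) * inverse t ^ n) has_real_derivative
        exp (- inverse t) * (inverse t * inverse t) * inverse t ^ n +
        exp (- inverse t) * ((real n * inverse t ^ (n - Suc 0)) * - (inverse t * inverse t))) (at t)"
      by (rule derivative_eq_intros refl | use 3 in simp)+
    also have "exp (- inverse t) * ((real n * inverse t ^ (n - Suc 0)) * - (inverse t * inverse t)) =
        - exp (- inverse t) * inverse t * (real n * inverse t ^ (n - Suc 0) * inverse t)"
      by (simp add: algebra_simps)
    finally have "((\<lambda>t. exp (- inverse t) * inverse t ^ n) has_real_derivative
        (flat_exp (n + 2) t - of_nat n * flat_exp (n + 1) t)) (at t)"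
      unfolding n by (simp add: flat_exp_def 3 algebra_simps)
    then show ?thesis
      by (rule has_field_derivative_transform_within_open[where S = "{0<..}"])
        (use 3 in \<open>auto simp: flat_exp_def\<close>)
  qed
qed

lemma flat_exp_smooth: "smooth_on UNIV (flat_exp n)"
proof (rule smooth_onI)
  fix k show "Ck_on k (flat_exp n) UNIV"
  proof (induction k arbitrary: n)
    case 0
    then show ?case
      using flat_exp_has_derivative[THEN DERIV_isCont]
      by (auto intro: continuous_at_imp_continuous_on)
  next
    case (Suc k)
    show ?case
    proof (rule Ck_on_SucI)
      fix v
      show "Ck_on k (\<lambda>t. (flat_exp (n + 2) t + (- of_nat n) * flat_exp (n + 1) t) * v) UNIV"
        by (intro Ck_on_mult Ck_on_add Ck_on_const Suc.IH open_UNIV)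
    qed (use flat_exp_has_derivative[unfolded has_field_derivative_def] in auto)
  qed
qed

text \<open>
  With \<open>e = flat_exp 0\<close> and \<open>d\<close> the distance to \<open>a\<close>, the function is the quotient of $e(r^2 - d^2)$ by
  $e(r^2 - d^2) + e(d^2 - r^2/4)$. The first summand vanishes exactly outside the large ball and the
  second one exactly on the closed small ball, so the denominator has no zeros.
\<close>

lemma ex_bump_on:
  fixes a :: "'a::euclidean_space"
  assumes "0 < r"
  obtains \<rho> :: "'a \<Rightarrow> real" where "smooth_on UNIV \<rho>"
    "\<And>x. x \<in> ball a (r/2) \<Longrightarrow> \<rho> x = 1" "\<And>x. x \<notin> ball a r \<Longrightarrow> \<rho> x = 0"
proof -
  define q where "q x = (x - a) \<bullet> (x - a)" for x
  have q: "q x = (dist a x)\<^sup>2" for x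
    unfolding q_def by (subst dist_commute) (simp add: dist_norm power2_norm_eq_inner)
  have sq: "smooth_on UNIV q"
  proof -
    have "smooth_on UNIV (\<lambda>x. (x - a) \<bullet> b)" for b
    proof -
      have "smooth_on UNIV (\<lambda>x. x \<bullet> b + (- (a \<bullet> b)))"
        by (intro smooth_on_add smooth_on_linear smooth_on_const bounded_linear_inner_left) auto
      then show ?thesis by (simp add: inner_diff_left)
    qed
    then have "smooth_on UNIV (\<lambda>x. \<Sum>b\<in>Basis. ((x - a) \<bullet> b) * ((x - a) \<bullet> b))"
      unfolding smooth_on_def by (auto intro!: Ck_on_sum Ck_on_mult)
    then show ?thesis unfolding q_def[abs_def] by (subst euclidean_inner)
  qed
  define u where "u x = flat_exp 0 (r\<^sup>2 + (-1) * q x)" for x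
  define w where "w x = flat_exp 0 (q x + (- (r/2)\<^sup>2))" for x
  have su: "smooth_on UNIV u" unfolding u_def[abs_def]
    by (rule smooth_on_compose[of UNIV UNIV _ "flat_exp 0"]) 
      (intro smooth_on_add smooth_on_mult smooth_on_const sq flat_exp_smooth open_UNIV subset_UNIV)+
  have sw: "smooth_on UNIV w" unfolding w_def[abs_def]
    by (rule smooth_on_compose[of UNIV UNIV _ "flat_exp 0"]) 
      (intro smooth_on_add smooth_on_mult smooth_on_const sq flat_exp_smooth open_UNIV subset_UNIV)+
  have u0: "u x = 0" if "x \<notin> ball a r" for x
  proof -
    have "r\<^sup>2 \<le> (dist a x)\<^sup>2" using that assms by (intro power_mono) auto
    then show ?thesis by (simp add: u_def q flat_exp_def)
  qed
  have u1: "u x > 0" if "x \<in> ball a r" for x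
  proof -
    have "(dist a x)\<^sup>2 < r\<^sup>2" using that by (intro power_strict_mono) auto
    then show ?thesis by (simp add: u_def q flat_exp_def)
  qed
  have w0: "w x = 0" if "x \<in> ball a (r/2)" for x
  proof -
    have "(dist a x)\<^sup>2 \<le> (r/2)\<^sup>2" using that by (intro power_mono) auto
    then show ?thesis by (simp add: w_def q flat_exp_def)
  qed
  have w1: "w x > 0" if "x \<notin> ball a r" for x
  proof -
    have "(r/2)\<^sup>2 < (dist a x)\<^sup>2" using that assms by (intro power_strict_mono) auto
    then show ?thesis by (simp add: w_def q flat_exp_def)
  qed
  have uw: "u x \<ge> 0" "w x \<ge> 0" for x by (auto simp: u_def w_def flat_exp_def)
  have pos: "u x + w x \<noteq> 0" for x
    using u1[of x] w1[of x] uw[of x] by (cases "x \<in> ball a r") auto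
  show ?thesis
  proof
    show "smooth_on UNIV (\<lambda>x. u x * inverse (u x + w x))"
      by (intro smooth_on_mult smooth_on_inverse smooth_on_add su sw pos) auto
    show "u x * inverse (u x + w x) = 1" if "x \<in> ball a (r/2)" for x
      using w0[OF that] pos[of x] by simp
    show "u x * inverse (u x + w x) = 0" if "x \<notin> ball a r" for x
      using u0[OF that] by simp
  qed
qed

section \<open>Hadamard's lemma\<close>

text \<open>
  Differentiation under the integral sign in the direction \<open>v\<close> replaces \<open>F\<close> by its derivative along \<open>v\<close>
  and produces one more factor \<open>t\<close>. With an arbitrary power of \<open>t\<close> in the statement, the induction on
  the order of differentiability closes.
\<close>

lemma radial_integral_Ck:
  fixes F :: "'a::euclidean_space \<Rightarrow> real"
  assumes "open S" "convex S" "a \<in> S" "Ck_on k F S"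
  shows "Ck_on k (\<lambda>x. integral {0..1} (\<lambda>t. t ^ m * F (a + t *\<^sub>R (x - a)))) S"
  using assms(4)
proof (induction k arbitrary: F m)
  have inS: "a + t *\<^sub>R (x - a) \<in> S" if "x \<in> S" "t \<in> {0..1}" for x t
  proof -
    have "a + t *\<^sub>R (x - a) = (1 - t) *\<^sub>R a + t *\<^sub>R x" by (simp add: algebra_simps)
    then show ?thesis using that convexD[OF assms(2,3), of x "1 - t" t] by simp
  qed
  have cont: "continuous_on (S \<times> {0..1}) (\<lambda>(x, t). t ^ m * G (a + t *\<^sub>R (x - a)))"
    if "continuous_on S G" for G :: "'a \<Rightarrow> real" and m
    unfolding split_beta
    by (intro continuous_intros continuous_on_compose2[OF that]) (auto intro: inS)
  {
    case 0
    show ?case using integral_continuous_on_param[of S 0 1 "\<lambda>x t. t ^ m * F (a + t *\<^sub>R (x - a))"]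
        cont[of F] 0 by (simp add: cbox_interval)
  next
    case (Suc k)
    define D where "D x t = Blinfun (\<lambda>v. t ^ m * frechet_derivative F (at (a + t *\<^sub>R (x - a))) (t *\<^sub>R v))" for x t
    have Dv: "blinfun_apply (D x t) v = t ^ (Suc m) * frechet_derivative F (at (a + t *\<^sub>R (x - a))) v"
      and dF: "((\<lambda>x. t ^ m * F (a + t *\<^sub>R (x - a))) has_derivative blinfun_apply (D x t)) (at x within S)"
      if xt: "x \<in> S" "t \<in> {0..1}" for x t v
    proof -
      note d = Ck_on_SucD(1)[OF Suc.prems inS[OF xt]]
      have *: "((\<lambda>x. t ^ m * F (a + t *\<^sub>R (x - a))) has_derivative
         (\<lambda>v. t ^ m * frechet_derivative F (at (a + t *\<^sub>R (x - a))) (t *\<^sub>R v))) (at x within S)"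
        by (rule has_derivative_mult_right,
            rule has_derivative_compose[where f = "\<lambda>x. a + t *\<^sub>R (x - a)", OF _ d])
          (auto intro!: derivative_eq_intros)
      from has_derivative_bounded_linear[OF *]
      have D: "blinfun_apply (D x t) = (\<lambda>v. t ^ m * frechet_derivative F (at (a + t *\<^sub>R (x - a))) (t *\<^sub>R v))"
        unfolding D_def by (rule bounded_linear_Blinfun_apply)
      show "blinfun_apply (D x t) v = t ^ (Suc m) * frechet_derivative F (at (a + t *\<^sub>R (x - a))) v"
        using linear_scale[OF has_derivative_linear[OF d], of t v] by (simp add: D)
      show "((\<lambda>x. t ^ m * F (a + t *\<^sub>R (x - a))) has_derivative blinfun_apply (D x t)) (at x within S)"
        using * D by simp
    qed
    have cD: "continuous_on (S \<times> cbox 0 1) (\<lambda>(x, t). D x t)"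
    proof (rule continuous_on_blinfun_componentwise)
      fix i :: 'a
      have "continuous_on (S \<times> {0..1}) (\<lambda>(x, t). t ^ Suc m * frechet_derivative F (at (a + t *\<^sub>R (x - a))) i)"
        by (rule cont[OF Ck_on_imp_continuous[OF Ck_on_SucD(2)[OF Suc.prems]]])
      then show "continuous_on (S \<times> cbox 0 1) (\<lambda>x. blinfun_apply (case x of (x, t) \<Rightarrow> D x t) i)"
        unfolding cbox_interval by (rule continuous_on_eq) (auto simp: Dv)
    qed
    have cDx: "continuous_on {0..1} (D x)" if "x \<in> S" for x
      using continuous_on_compose2[OF cD, of "{0..1}" "\<lambda>t. (x, t)"] that
        continuous_on_Pair[OF continuous_on_const[of _ x] continuous_on_id, of "{0..1}"]
      by (auto simp: cbox_interval)
    have der: "((\<lambda>x. integral {0..1} (\<lambda>t. t ^ m * F (a + t *\<^sub>R (x - a)))) has_derivative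
       (\<lambda>v. integral {0..1} (\<lambda>t. t ^ Suc m * frechet_derivative F (at (a + t *\<^sub>R (x - a))) v))) (at x)"
      if "x \<in> S" for x
    proof -
      have int: "(\<lambda>t. t ^ m * F (a + t *\<^sub>R (x - a))) integrable_on cbox 0 1" if "x \<in> S" for x
      proof -
        have "continuous_on {0..1} (\<lambda>t. t ^ m * F (a + t *\<^sub>R (x - a)))"
          using continuous_on_compose2[OF cont[of F m], of "{0..1}" "\<lambda>t. (x, t)"] that
            Ck_on_imp_continuous[OF Suc.prems]
            continuous_on_Pair[OF continuous_on_const[of _ x] continuous_on_id, of "{0..1}"]
          by auto
        then show ?thesis by (simp add: cbox_interval integrable_continuous_real)
      qed
      have "((\<lambda>x. integral (cbox 0 1) (\<lambda>t. t ^ m * F (a + t *\<^sub>R (x - a)))) has_derivative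
         integral (cbox 0 1) (D x)) (at x within S)"
        by (rule leibniz_rule) (use dF int cD that assms in \<open>auto simp: cbox_interval\<close>)
      then have "((\<lambda>x. integral {0..1} (\<lambda>t. t ^ m * F (a + t *\<^sub>R (x - a)))) has_derivative
         integral {0..1} (D x)) (at x)"
        using at_within_open[OF that assms(1)] by (simp add: cbox_interval)
      moreover have "blinfun_apply (integral {0..1} (D x)) =
          (\<lambda>v. integral {0..1} (\<lambda>t. t ^ Suc m * frechet_derivative F (at (a + t *\<^sub>R (x - a))) v))"
      proof
        fix v
        have "blinfun_apply (integral {0..1} (D x)) v = integral {0..1} (\<lambda>t. D x t v)"
          using integral_linear[OF integrable_continuous_real[OF cDx[OF that]] blinfun.bounded_linear_left[of v]]
          by (simp add: o_def)
        also have "\<dots> = integral {0..1} (\<lambda>t. t ^ Suc m * frechet_derivative F (at (a + t *\<^sub>R (x - a))) v)"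
          by (rule integral_cong) (simp add: Dv that)
        finally show "blinfun_apply (integral {0..1} (D x)) v =
          integral {0..1} (\<lambda>t. t ^ Suc m * frechet_derivative F (at (a + t *\<^sub>R (x - a))) v)" .
      qed
      ultimately show ?thesis by (simp del: power_Suc)
    qed
    show ?case
    proof (rule Ck_on_SucI[OF assms(1) der])
      show "Ck_on k (\<lambda>x. integral {0..1} (\<lambda>t. t ^ Suc m *
          frechet_derivative F (at (a + t *\<^sub>R (x - a))) v)) S" for v
        by (rule Suc.IH[OF Ck_on_SucD(2)[OF Suc.prems]])
    qed
  }
qed

text \<open>
  The fundamental theorem of calculus along the segment from \<open>a\<close> to \<open>x\<close>: the factor \<open>G b x\<close> is the mean
  value of the partial derivative of \<open>F\<close> along \<open>b\<close> on that segment.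
\<close>

lemma hadamard:
  fixes F :: "'a::euclidean_space \<Rightarrow> real"
  assumes "open S" "convex S" "a \<in> S" "smooth_on S F"
  obtains G where "\<And>b. smooth_on S (G b)"
    "\<And>x. x \<in> S \<Longrightarrow> F x = F a + (\<Sum>b\<in>Basis. ((x - a) \<bullet> b) * G b x)"
    "\<And>b. G b a = frechet_derivative F (at a) b"
proof
  define G where "G b x = integral {0..1} (\<lambda>t. t ^ 0 * frechet_derivative F (at (a + t *\<^sub>R (x - a))) b)" for b x
  show "smooth_on S (G b)" for b
    unfolding G_def[abs_def]
    by (rule smooth_onI, rule radial_integral_Ck[OF assms(1-3)],
        rule smooth_onD, rule smooth_on_derivative, rule assms(4))
  show "G b a = frechet_derivative F (at a) b" for b
    by (simp add: G_def)
  fix x assume x: "x \<in> S"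
  have inS: "a + t *\<^sub>R (x - a) \<in> S" if "t \<in> {0..1}" for t
  proof -
    have "a + t *\<^sub>R (x - a) = (1 - t) *\<^sub>R a + t *\<^sub>R x" by (simp add: algebra_simps)
    then show ?thesis using that x convexD[OF assms(2,3), of x "1 - t" t] by simp
  qed
  have ci: "(\<lambda>t. frechet_derivative F (at (a + t *\<^sub>R (x - a))) b) integrable_on {0..1}" for b
  proof (rule integrable_continuous_real)
    show "continuous_on {0..1} (\<lambda>t. frechet_derivative F (at (a + t *\<^sub>R (x - a))) b)"
      by (rule continuous_on_compose2[OF smooth_on_imp_continuous[OF smooth_on_derivative[OF assms(4)]]])
        (use inS in \<open>auto intro!: continuous_intros\<close>)
  qed
  have "((\<lambda>t. frechet_derivative F (at (a + t *\<^sub>R (x - a))) (x - a)) has_integral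
      F (a + 1 *\<^sub>R (x - a)) - F (a + 0 *\<^sub>R (x - a))) {0..1}"
  proof (rule fundamental_theorem_of_calculus)
    fix t :: real assume t: "t \<in> {0..1}"
    note d = smooth_on_has_derivative[OF assms(4) inS[OF t]]
    have "((\<lambda>t. F (a + t *\<^sub>R (x - a))) has_derivative
      (\<lambda>s. frechet_derivative F (at (a + t *\<^sub>R (x - a))) (s *\<^sub>R (x - a)))) (at t within {0..1})"
      by (rule has_derivative_compose[where f = "\<lambda>t. a + t *\<^sub>R (x - a)", OF _ d])
        (auto intro!: derivative_eq_intros)
    then show "((\<lambda>t. F (a + t *\<^sub>R (x - a))) has_vector_derivative
       frechet_derivative F (at (a + t *\<^sub>R (x - a))) (x - a)) (at t within {0..1})"
      using linear_scale[OF has_derivative_linear[OF d]] by (simp add: has_vector_derivative_def)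
  qed simp
  from integral_unique[OF this]
  have "F x - F a = integral {0..1} (\<lambda>t. frechet_derivative F (at (a + t *\<^sub>R (x - a))) (x - a))"
    by simp
  also have "\<dots> = integral {0..1} (\<lambda>t. \<Sum>b\<in>Basis. ((x - a) \<bullet> b) * frechet_derivative F (at (a + t *\<^sub>R (x - a))) b)"
  proof (rule integral_cong)
    fix t :: real assume t: "t \<in> {0..1}"
    note d = has_derivative_linear[OF smooth_on_has_derivative[OF assms(4) inS[OF t]]]
    show "frechet_derivative F (at (a + t *\<^sub>R (x - a))) (x - a) =
      (\<Sum>b\<in>Basis. ((x - a) \<bullet> b) * frechet_derivative F (at (a + t *\<^sub>R (x - a))) b)"
      using linear_sum[OF d, of "\<lambda>b. ((x - a) \<bullet> b) *\<^sub>R b" Basis] linear_scale[OF d]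
      by (simp add: euclidean_representation)
  qed
  also have "\<dots> = (\<Sum>b\<in>Basis. ((x - a) \<bullet> b) * G b x)"
    using integral_sum[of Basis "\<lambda>b t. ((x - a) \<bullet> b) * frechet_derivative F (at (a + t *\<^sub>R (x - a))) b" "{0..1}"]
      integrable_on_mult_right[OF ci]
    by (simp add: G_def)
  finally show "F x = F a + (\<Sum>b\<in>Basis. ((x - a) \<bullet> b) * G b x)" by simp
qed

section \<open>Smooth inverse functions\<close>

lemma Ck_on_vec_nth: 
  fixes f :: "'a::euclidean_space \<Rightarrow> real^'n"
  assumes "open S"
  shows "Ck_on k f S \<longleftrightarrow> (\<forall>i. Ck_on k (\<lambda>x. f x $ i) S)"
proof
  assume "Ck_on k f S"
  then show "\<forall>i. Ck_on k (\<lambda>x. f x $ i) S"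
    using Ck_on_linear_comp[OF assms bounded_linear_vec_nth] by blast
next
  assume *: "\<forall>i. Ck_on k (\<lambda>x. f x $ i) S"
  show "Ck_on k f S"
  proof (rule Ck_on_componentwise[OF assms])
    fix b :: "real^'n" assume "b \<in> Basis"
    then obtain i where "b = axis i 1" by (auto simp: Basis_vec_def)
    then show "Ck_on k (\<lambda>x. f x \<bullet> b) S" using * by (simp add: inner_axis)
  qed
qed

lemma Ck_on_det:
  fixes M :: "'a::euclidean_space \<Rightarrow> real^'n^'n"
  assumes "open S" "\<And>i j. Ck_on k (\<lambda>x. M x $ i $ j) S"
  shows "Ck_on k (\<lambda>x. det (M x)) S"
  unfolding det_def
  by (rule Ck_on_sum[OF assms(1)], rule Ck_on_mult[OF assms(1)], rule Ck_on_const[OF assms(1)],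
      rule Ck_on_prod[OF assms])

lemma det_nonzero_if_inj:
  fixes A :: "real^'n^'n"
  shows "inj ((*v) A) \<Longrightarrow> det A \<noteq> 0"
  using matrix_left_invertible_injective[of A] invertible_left_inverse[of A] invertible_det_nz[of A] by simp

text \<open>
  Cramer's rule expresses the solution of a linear system as a rational function of its coefficients.
\<close>

lemma Ck_on_solve:
  fixes M :: "'a::euclidean_space \<Rightarrow> real^'n^'n" and u :: "'a \<Rightarrow> real^'n"
  assumes "open S" "\<And>i j. Ck_on k (\<lambda>x. M x $ i $ j) S" "Ck_on k b S"
    "\<And>x. x \<in> S \<Longrightarrow> det (M x) \<noteq> 0" "\<And>x. x \<in> S \<Longrightarrow> M x *v u x = b x"
  shows "Ck_on k u S"
proof -
  have b: "Ck_on k (\<lambda>x. b x $ i) S" for i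
    using assms(3) Ck_on_vec_nth[OF assms(1)] by blast
  have "Ck_on k (\<lambda>x. det (\<chi> i j. if j = l then b x $ i else M x $ i $ j) * inverse (det (M x))) S" for l
  proof (intro Ck_on_mult Ck_on_det Ck_on_inverse assms)
    show "Ck_on k (\<lambda>x. (\<chi> i j. if j = l then b x $ i else M x $ i $ j) $ i $ j) S" for i j
      by (cases "j = l") (simp_all add: b assms)
  qed auto
  moreover have "det (\<chi> i j. if j = l then b x $ i else M x $ i $ j) * inverse (det (M x)) = u x $ l"
    if "x \<in> S" for x l
    unfolding iffD1[OF cramer[OF assms(4)[OF that]] assms(5)[OF that]] by (simp add: divide_inverse)
  ultimately have "Ck_on k (\<lambda>x. u x $ l) S" for l
    by (rule Ck_on_cong[OF assms(1), THEN iffD1, rotated])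
  then show ?thesis using Ck_on_vec_nth[OF assms(1)] by blast
qed

text \<open>
  The inverse function theorem of class $C^1$ gives a differentiable local inverse \<open>G\<close>. Its derivative
  at \<open>y\<close> solves a linear system whose coefficients are the partial derivatives of \<open>F\<close> at \<open>G y\<close>, so \<open>G\<close> is
  of class $C^{k+1}$ as soon as it is of class $C^k$.
\<close>

theorem smooth_inverse_function:
  fixes F :: "real^'n \<Rightarrow> real^'n"
  assumes "open S" "x0 \<in> S" "smooth_on S F" "inj (frechet_derivative F (at x0))"
  obtains U V G where "open U" "U \<subseteq> S" "x0 \<in> U" "open V" "F x0 \<in> V" "homeomorphism U V F G" "smooth_on V G"
proof -
  define F' where "F' x = Blinfun (frechet_derivative F (at x))" for x
  note d = smooth_on_has_derivative[OF assms(3)]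
  have F': "blinfun_apply (F' x) = frechet_derivative F (at x)" if "x \<in> S" for x
    unfolding F'_def using has_derivative_bounded_linear[OF d[OF that]] by (rule bounded_linear_Blinfun_apply)
  have derF: "(F has_derivative blinfun_apply (F' x)) (at x)" if "x \<in> S" for x
    using d[OF that] F'[OF that] by simp
  have c: "continuous_on S F'"
  proof (rule continuous_on_blinfun_componentwise)
    fix i
    show "continuous_on S (\<lambda>x. blinfun_apply (F' x) i)"
      by (rule continuous_on_eq[OF smooth_on_imp_continuous[OF smooth_on_derivative[OF assms(3), of i]]])
        (simp add: F')
  qed
  have lin: "linear (frechet_derivative F (at x0))"
    using has_derivative_linear[OF d[OF assms(2)]] .
  obtain L where L: "linear L" "L \<circ> frechet_derivative F (at x0) = id"
    using linear_injective_left_inverse[OF lin assms(4)] by auto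
  have inv: "Blinfun L o\<^sub>L F' x0 = id_blinfun"
    using L by (auto simp: blinfun_eqI F' assms(2) bounded_linear_Blinfun_apply linear_linear fun_eq_iff
        intro!: blinfun_eqI)
  obtain U V G G' where UV: "open U" "U \<subseteq> S" "x0 \<in> U" "open V" "F x0 \<in> V" "homeomorphism U V F G"
    and G: "\<And>y. y \<in> V \<Longrightarrow> (G has_derivative (G' y)) (at y)"
    and G': "\<And>y. y \<in> V \<Longrightarrow> G' y = inv (blinfun_apply (F' (G y)))"
    and bij: "\<And>y. y \<in> V \<Longrightarrow> bij (blinfun_apply (F' (G y)))"
  proof (rule inverse_function_theorem[OF assms(1) _ c assms(2) inv])
    show "(F has_derivative blinfun_apply (F' x)) (at x)" if "x \<in> S" for x
      by (rule derF[OF that])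
  qed (rule that)
  have GS: "G y \<in> S" if "y \<in> V" for y
    using that UV by (auto simp: homeomorphism_def)
  have "Ck_on k G V" for k
  proof (induction k)
    case 0
    then show ?case using UV by (simp add: homeomorphism_def)
  next
    case (Suc k)
    show ?case
    proof (rule Ck_on_SucI[OF \<open>open V\<close> G])
      fix v
      define M where "M y = matrix (frechet_derivative F (at (G y)))" for y
      have Mv: "M y *v w = frechet_derivative F (at (G y)) w" if "y \<in> V" for y w
        using has_derivative_linear[OF d[OF GS[OF that]]] by (simp add: M_def)
      show "Ck_on k (\<lambda>y. G' y v) V"
      proof (rule Ck_on_solve[of V k M "\<lambda>y. v"])
        fix i j
        have "Ck_on k (\<lambda>y. frechet_derivative F (at (G y)) (axis j 1)) V"
          by (rule Ck_on_compose[OF \<open>open V\<close> assms(1) Suc smooth_onD[OF smooth_on_derivative[OF assms(3)]]])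
            (use GS in blast)
        from spec[OF iffD1[OF Ck_on_vec_nth[OF \<open>open V\<close>] this], of i]
        show "Ck_on k (\<lambda>y. M y $ i $ j) V" by (simp add: M_def matrix_def)
      next
        fix y assume y: "y \<in> V"
        have "inj ((*v) (M y))" using bij[OF y] Mv[OF y] F'[OF GS[OF y]]
          by (simp add: bij_def inj_on_def)
        then show "det (M y) \<noteq> 0" by (rule det_nonzero_if_inj)
        show "M y *v G' y v = v"
          using bij[OF y] Mv[OF y] F'[OF GS[OF y]] G'[OF y] by (simp add: bij_def surj_f_inv_f)
      qed (auto intro: UV Ck_on_const)
    qed
  qed
  then show ?thesis using UV that smooth_onI by blast
qed

section \<open>Smooth maps between manifolds\<close>

lemma atlas_chart:
  assumes "smooth_atlas A"
  obtains U \<phi> where "(U, \<phi>) \<in> A" "p \<in> U"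
proof -
  have "(\<Union>(U, \<phi>)\<in>A. U) = UNIV" using assms unfolding smooth_atlas_def by (rule conjunct1)
  then have "p \<in> (\<Union>(U, \<phi>)\<in>A. U)" by simp
  then show ?thesis using that by auto
qed

context
  fixes A :: "('e::topological_space, 'b::euclidean_space) chart set" and U \<phi>
  assumes A: "smooth_atlas A" and U: "(U, \<phi>) \<in> A"
begin

lemma chart_open: "open U" and chart_open_image: "open (\<phi> ` U)"
  and chart_homeomorphism: "homeomorphism U (\<phi> ` U) \<phi> (inv_into U \<phi>)"
proof -
  have "\<forall>(U, \<phi>)\<in>A. open U \<and> open (\<phi> ` U) \<and> homeomorphism U (\<phi> ` U) \<phi> (inv_into U \<phi>)"
    using A unfolding smooth_atlas_def by (elim conjE)
  from bspec[OF this U] show "open U" "open (\<phi> ` U)" "homeomorphism U (\<phi> ` U) \<phi> (inv_into U \<phi>)"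
    by simp_all
qed

lemma chart_inj: "inj_on \<phi> U"
  by (rule inj_onI) (metis chart_homeomorphism homeomorphism_apply1)

lemma chart_inverse [simp]: "p \<in> U \<Longrightarrow> inv_into U \<phi> (\<phi> p) = p"
  using chart_inj by simp

lemma chart_open_map: "open W \<Longrightarrow> W \<subseteq> U \<Longrightarrow> open (\<phi> ` W)"
proof -
  assume W: "open W" "W \<subseteq> U"
  have "openin (top_of_set (\<phi> ` U)) (\<phi> ` W)"
    by (rule homeomorphism_imp_open_map[OF chart_homeomorphism]) (use W open_subset in blast)
  then show ?thesis using chart_open_image openin_open_eq by blast
qed

lemma chart_continuous: "continuous_on U \<phi>"
  and chart_inverse_continuous: "continuous_on (\<phi> ` U) (inv_into U \<phi>)"
  using chart_homeomorphism by (auto simp: homeomorphism_def)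

lemma chart_open_preimage: "open S \<Longrightarrow> open (U \<inter> \<phi> -` S)"
  using continuous_on_open_vimage[OF chart_open, of \<phi>] chart_continuous by (simp add: Int_commute)

lemma chart_change_smooth: "(V, \<psi>) \<in> A \<Longrightarrow> smooth_on (\<phi> ` (U \<inter> V)) (\<psi> \<circ> inv_into U \<phi>)"
proof -
  assume V: "(V, \<psi>) \<in> A"
  have "\<forall>(U, \<phi>)\<in>A. \<forall>(V, \<psi>)\<in>A. smooth_on (\<phi> ` (U \<inter> V)) (\<psi> \<circ> inv_into U \<phi>)"
    using A unfolding smooth_atlas_def by (elim conjE)
  from bspec[OF this U] have "\<forall>(V, \<psi>)\<in>A. smooth_on (\<phi> ` (U \<inter> V)) (\<psi> \<circ> inv_into U \<phi>)" by simp
  from bspec[OF this V] show ?thesis by simp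
qed

end

lemma smooth_mapD:
  assumes "smooth_map A B F"
  shows "continuous_on UNIV F"
    and "(U, \<phi>) \<in> A \<Longrightarrow> (V, \<psi>) \<in> B \<Longrightarrow> smooth_on (\<phi> ` (U \<inter> F -` V)) (\<psi> \<circ> F \<circ> inv_into U \<phi>)"
proof -
  show "continuous_on UNIV F" using assms unfolding smooth_map_def by (rule conjunct1)
  assume U: "(U, \<phi>) \<in> A" and V: "(V, \<psi>) \<in> B"
  have "\<forall>(U, \<phi>)\<in>A. \<forall>(V, \<psi>)\<in>B. smooth_on (\<phi> ` (U \<inter> F -` V)) (\<psi> \<circ> F \<circ> inv_into U \<phi>)"
    using assms unfolding smooth_map_def by (rule conjunct2)
  from bspec[OF this U] have "\<forall>(V, \<psi>)\<in>B. smooth_on (\<phi> ` (U \<inter> F -` V)) (\<psi> \<circ> F \<circ> inv_into U \<phi>)" by simp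
  from bspec[OF this V] show "smooth_on (\<phi> ` (U \<inter> F -` V)) (\<psi> \<circ> F \<circ> inv_into U \<phi>)" by simp
qed

lemma smooth_map_open_vimage: "smooth_map A B F \<Longrightarrow> open V \<Longrightarrow> open (F -` V)"
  by (rule open_vimage[OF _ smooth_mapD(1)])

text \<open>
  It suffices to look at one pair of charts around each point: near the point every other chart
  expression differs from this one by changes of charts. Continuity comes for free, because near the
  point the map is its chart expression composed with homeomorphisms.
\<close>

lemma smooth_map_localI:
  assumes A: "smooth_atlas A" and B: "smooth_atlas B"
    and loc: "\<And>p. \<exists>U \<phi> V \<psi> W. (U, \<phi>) \<in> A \<and> (V, \<psi>) \<in> B \<and> open W \<and> p \<in> W \<and> W \<subseteq> U \<and> F ` W \<subseteq> V \<and>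
      smooth_on (\<phi> ` W) (\<psi> \<circ> F \<circ> inv_into U \<phi>)"
  shows "smooth_map A B F"
  unfolding smooth_map_def
proof
  show cont: "continuous_on UNIV F"
  proof -
    have *: "\<exists>W. open W \<and> p \<in> W \<and> continuous_on W F" for p
    proof -
    obtain U \<phi> V \<psi> W where U: "(U, \<phi>) \<in> A" and V: "(V, \<psi>) \<in> B" and W: "open W" "p \<in> W" "W \<subseteq> U" "F ` W \<subseteq> V"
      and sm: "smooth_on (\<phi> ` W) (\<psi> \<circ> F \<circ> inv_into U \<phi>)" using loc[of p] by (elim exE conjE) (rule that)
    have Wq: "inv_into U \<phi> (\<phi> q) = q" "F q \<in> V" if "q \<in> W" for q
      using W that chart_inverse[OF A U] by auto
    have "continuous_on W (\<lambda>q. inv_into V \<psi> ((\<psi> \<circ> F \<circ> inv_into U \<phi>) (\<phi> q)))"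
    proof (rule continuous_on_compose2[OF chart_inverse_continuous[OF B V]])
      show "continuous_on W (\<lambda>q. (\<psi> \<circ> F \<circ> inv_into U \<phi>) (\<phi> q))"
        by (rule continuous_on_compose2[OF smooth_on_imp_continuous[OF sm]])
          (use W continuous_on_subset[OF chart_continuous[OF A U]] in auto)
    qed (auto simp: Wq)
    then have "continuous_on W F"
      by (rule continuous_on_eq) (auto simp: Wq chart_inverse[OF B V])
    then show ?thesis using W by blast
  qed
    have "continuous_on (\<Union>{W. open W \<and> continuous_on W F}) F"
      by (rule continuous_on_open_Union) auto
    moreover have "UNIV \<subseteq> \<Union>{W. open W \<and> continuous_on W F}"
    proof
      fix p
      obtain W where "open W \<and> p \<in> W \<and> continuous_on W F" using *[of p] ..
      then show "p \<in> \<Union>{W. open W \<and> continuous_on W F}" by (intro UnionI[of W]) simp_all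
    qed
    ultimately show ?thesis by (rule continuous_on_subset)
  qed
  have main: "smooth_on (\<phi>' ` (U' \<inter> F -` V')) (\<psi>' \<circ> F \<circ> inv_into U' \<phi>')"
    if U': "(U', \<phi>') \<in> A" and V': "(V', \<psi>') \<in> B" for U' \<phi>' V' \<psi>'
  proof (rule smooth_on_local)
    fix x assume "x \<in> \<phi>' ` (U' \<inter> F -` V')"
    then obtain p where p: "x = \<phi>' p" "p \<in> U'" "F p \<in> V'" by auto
    obtain U \<phi> V \<psi> W where U: "(U, \<phi>) \<in> A" and V: "(V, \<psi>) \<in> B" and W: "open W" "p \<in> W" "W \<subseteq> U" "F ` W \<subseteq> V"
      and sm: "smooth_on (\<phi> ` W) (\<psi> \<circ> F \<circ> inv_into U \<phi>)" using loc[of p] by (elim exE conjE) (rule that)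
    define N where "N = W \<inter> (U' \<inter> F -` V')"
    have oF: "open (F -` V')" by (rule open_vimage[OF chart_open[OF B V'] cont])
    have N: "open N" "N \<subseteq> U" "N \<subseteq> U'" "p \<in> N" "F ` N \<subseteq> V \<inter> V'" "N \<subseteq> W"
      using W p oF chart_open[OF A U'] by (auto simp: N_def)
    define T where "T = \<phi>' ` N"
    have T: "open T" unfolding T_def using chart_open_map[OF A U'] N by blast
    have 1: "smooth_on T (\<phi> \<circ> inv_into U' \<phi>')"
      by (rule smooth_on_subset[OF chart_change_smooth[OF A U' U]]) (use N T_def in auto)
    have 2: "smooth_on T (\<lambda>y. (\<psi> \<circ> F \<circ> inv_into U \<phi>) ((\<phi> \<circ> inv_into U' \<phi>') y))"
      by (rule smooth_on_compose[OF T chart_open_map[OF A U, of N] 1 smooth_on_subset[OF sm]])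
        (use N in \<open>auto simp: T_def chart_inverse[OF A U'] subset_iff\<close>)
    have 3: "smooth_on T (\<lambda>y. (\<psi>' \<circ> inv_into V \<psi>) ((\<psi> \<circ> F \<circ> inv_into U \<phi>) ((\<phi> \<circ> inv_into U' \<phi>') y)))"
    proof (rule smooth_on_compose[OF T chart_open_map[OF B V, of "V \<inter> V'"] 2 chart_change_smooth[OF B V V']])
      show "open (V \<inter> V')" using chart_open[OF B V'] chart_open[OF B V] by auto
      show "(\<lambda>y. (\<psi> \<circ> F \<circ> inv_into U \<phi>) ((\<phi> \<circ> inv_into U' \<phi>') y)) ` T \<subseteq> \<psi> ` (V \<inter> V')"
        using N by (auto simp: T_def chart_inverse[OF A U'] chart_inverse[OF A U] subset_iff)
    qed auto
    have "smooth_on T (\<psi>' \<circ> F \<circ> inv_into U' \<phi>')"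
      by (rule smooth_on_cong[OF T, THEN iffD1, OF _ 3])
        (use N in \<open>auto simp: T_def chart_inverse[OF A U'] chart_inverse[OF A U] chart_inverse[OF B V] subset_iff image_subset_iff\<close>)
    then show "\<exists>T. open T \<and> x \<in> T \<and> smooth_on T (\<psi>' \<circ> F \<circ> inv_into U' \<phi>')"
      using T N p by (auto simp: T_def)
  qed
  show "\<forall>(U, \<phi>)\<in>A. \<forall>(V, \<psi>)\<in>B. smooth_on (\<phi> ` (U \<inter> F -` V)) (\<psi> \<circ> F \<circ> inv_into U \<phi>)"
    by (clarify, rule main)
qed

lemma smooth_map_compose:
  assumes A: "smooth_atlas A" and B: "smooth_atlas B" and C: "smooth_atlas C"
    and F: "smooth_map A B F" and G: "smooth_map B C G"
  shows "smooth_map A C (G \<circ> F)"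
proof (rule smooth_map_localI[OF A C])
  fix p
  obtain U \<phi> where U: "(U, \<phi>) \<in> A" "p \<in> U" using atlas_chart[OF A] .
  obtain V \<psi> where V: "(V, \<psi>) \<in> B" "F p \<in> V" using atlas_chart[OF B] .
  obtain X \<omega> where X: "(X, \<omega>) \<in> C" "G (F p) \<in> X" using atlas_chart[OF C] .
  define W where "W = U \<inter> F -` (V \<inter> G -` X)"
  have oG: "open (V \<inter> G -` X)"
    using smooth_map_open_vimage[OF G] chart_open[OF B V(1)] chart_open[OF C X(1)] by auto
  have W: "open W" "p \<in> W" "W \<subseteq> U"
    using U V X smooth_map_open_vimage[OF F oG] chart_open[OF A U(1)] by (auto simp: W_def)
  have "smooth_on (\<phi> ` W) (\<lambda>y. (\<omega> \<circ> G \<circ> inv_into V \<psi>) ((\<psi> \<circ> F \<circ> inv_into U \<phi>) y))"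
  proof (rule smooth_on_compose[OF chart_open_map[OF A U(1) W(1,3)] chart_open_map[OF B V(1) oG]])
    show "smooth_on (\<phi> ` W) (\<psi> \<circ> F \<circ> inv_into U \<phi>)"
      by (rule smooth_on_subset[OF smooth_mapD(2)[OF F U(1) V(1)]]) (auto simp: W_def)
    show "smooth_on (\<psi> ` (V \<inter> G -` X)) (\<omega> \<circ> G \<circ> inv_into V \<psi>)"
      by (rule smooth_mapD(2)[OF G V(1) X(1)])
  qed (auto simp: W_def chart_inverse[OF A U(1)])
  then have "smooth_on (\<phi> ` W) (\<omega> \<circ> (G \<circ> F) \<circ> inv_into U \<phi>)"
    by (rule smooth_on_cong[OF chart_open_map[OF A U(1) W(1,3)], THEN iffD1, rotated])
      (auto simp: W_def chart_inverse[OF A U(1)] chart_inverse[OF B V(1)])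
  then show "\<exists>U \<phi> X \<omega> W. (U, \<phi>) \<in> A \<and> (X, \<omega>) \<in> C \<and> open W \<and> p \<in> W \<and> W \<subseteq> U \<and> (G \<circ> F) ` W \<subseteq> X \<and>
      smooth_on (\<phi> ` W) (\<omega> \<circ> (G \<circ> F) \<circ> inv_into U \<phi>)"
    using U X W by (intro exI[of _ U] exI[of _ \<phi>] exI[of _ X] exI[of _ \<omega>] exI[of _ W]) (auto simp: W_def)
qed

lemma smooth_map_id: "smooth_atlas A \<Longrightarrow> smooth_map A A id"
  unfolding smooth_map_def using chart_change_smooth[of A]
  by (auto simp: o_def split: prod.splits)

text \<open>
  Two compatible atlases are both contained in their union, so this comparison transfers smoothness
  from one to the other.
\<close>

lemma smooth_map_atlas_extend:
  assumes A: "smooth_atlas A" and A': "smooth_atlas A'" and B: "smooth_atlas B" and sub: "A \<subseteq> A'"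
  shows "smooth_map A B F \<longleftrightarrow> smooth_map A' B F"
proof
  assume F: "smooth_map A B F"
  show "smooth_map A' B F"
  proof (rule smooth_map_localI[OF A' B])
    fix p
    obtain U \<phi> where U: "(U, \<phi>) \<in> A" "p \<in> U" using atlas_chart[OF A] .
    obtain V \<psi> where V: "(V, \<psi>) \<in> B" "F p \<in> V" using atlas_chart[OF B] .
    show "\<exists>U \<phi> V \<psi> W. (U, \<phi>) \<in> A' \<and> (V, \<psi>) \<in> B \<and> open W \<and> p \<in> W \<and> W \<subseteq> U \<and> F ` W \<subseteq> V \<and>
      smooth_on (\<phi> ` W) (\<psi> \<circ> F \<circ> inv_into U \<phi>)"
      using U V sub smooth_mapD(2)[OF F U(1) V(1)] chart_open[OF A U(1)]
        smooth_map_open_vimage[OF F chart_open[OF B V(1)]]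
      by (intro exI[of _ U] exI[of _ \<phi>] exI[of _ V] exI[of _ \<psi>] exI[of _ "U \<inter> F -` V"]) auto
  qed
next
  show "smooth_map A' B F \<Longrightarrow> smooth_map A B F"
    using sub unfolding smooth_map_def by blast
qed

lemma smooth_atlas_std: "smooth_atlas (std_atlas :: ('b::euclidean_space, 'b) chart set)"
proof -
  have i: "inv_into UNIV (id :: 'b \<Rightarrow> 'b) = id" by (rule inv_id)
  have h: "homeomorphism UNIV (id ` UNIV) id (inv_into UNIV (id :: 'b \<Rightarrow> 'b))"
    unfolding i by (simp add: homeomorphism_def)
  have s0: "smooth_on UNIV (\<lambda>x :: 'b. x)"
    by (rule smooth_on_linear[OF open_UNIV bounded_linear_ident])
  have s: "smooth_on (id ` (UNIV \<inter> UNIV)) (id \<circ> inv_into UNIV (id :: 'b \<Rightarrow> 'b))"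
    unfolding i using s0 by (simp add: id_def comp_def)
  show ?thesis
    using h s by (simp add: smooth_atlas_def std_atlas_def)
qed

section \<open>Smooth functions\<close>

lemma smooth_funD:
  assumes "smooth_fun A f"
  shows "continuous_on UNIV f" and "(U, \<phi>) \<in> A \<Longrightarrow> smooth_on (\<phi> ` U) (f \<circ> inv_into U \<phi>)"
  using smooth_mapD(1)[OF assms] smooth_mapD(2)[OF assms, of U \<phi> UNIV id]
  by (auto simp: std_atlas_def)

lemma smooth_funI:
  assumes A: "smooth_atlas A"
    and "\<And>p. \<exists>U \<phi> W. (U, \<phi>) \<in> A \<and> open W \<and> p \<in> W \<and> W \<subseteq> U \<and> smooth_on (\<phi> ` W) (f \<circ> inv_into U \<phi>)"
  shows "smooth_fun A f"
proof (rule smooth_map_localI[OF A smooth_atlas_std])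
  fix p
  obtain U \<phi> W where "(U, \<phi>) \<in> A" "open W" "p \<in> W" "W \<subseteq> U" "smooth_on (\<phi> ` W) (f \<circ> inv_into U \<phi>)"
    using assms(2)[of p] by (elim exE conjE) (rule that)
  then show "\<exists>U \<phi> V \<psi> W. (U, \<phi>) \<in> A \<and> (V, \<psi>) \<in> std_atlas \<and> open W \<and> p \<in> W \<and> W \<subseteq> U \<and> f ` W \<subseteq> V \<and>
      smooth_on (\<phi> ` W) (\<psi> \<circ> f \<circ> inv_into U \<phi>)"
    by (intro exI[of _ U] exI[of _ \<phi>] exI[of _ UNIV] exI[of _ id] exI[of _ W]) (auto simp: std_atlas_def)
qed

lemma smooth_funI_charts:
  assumes A: "smooth_atlas A"
    and "\<And>U \<phi>. (U, \<phi>) \<in> A \<Longrightarrow> smooth_on (\<phi> ` U) (f \<circ> inv_into U \<phi>)"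
  shows "smooth_fun A f"
proof (rule smooth_funI[OF A])
  fix p
  obtain U \<phi> where U: "(U, \<phi>) \<in> A" "p \<in> U" using atlas_chart[OF A] .
  then show "\<exists>U \<phi> W. (U, \<phi>) \<in> A \<and> open W \<and> p \<in> W \<and> W \<subseteq> U \<and> smooth_on (\<phi> ` W) (f \<circ> inv_into U \<phi>)"
    using assms(2)[OF U(1)] chart_open[OF A U(1)]
    by (intro exI[of _ U] exI[of _ \<phi>] exI[of _ U]) simp
qed

lemma smooth_fun_const: "smooth_atlas A \<Longrightarrow> smooth_fun A (\<lambda>x. c)"
  by (rule smooth_funI_charts) (simp_all add: o_def smooth_on_const chart_open_image)

lemma smooth_fun_add:
  assumes "smooth_atlas A" "smooth_fun A f" "smooth_fun A g"
  shows "smooth_fun A (\<lambda>x. f x + g x)"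
proof (rule smooth_funI_charts[OF assms(1)])
  fix U \<phi> assume U: "(U, \<phi>) \<in> A"
  show "smooth_on (\<phi> ` U) ((\<lambda>x. f x + g x) \<circ> inv_into U \<phi>)"
    using smooth_on_add[OF chart_open_image[OF assms(1) U] smooth_funD(2)[OF assms(2) U]
        smooth_funD(2)[OF assms(3) U]] by (simp add: o_def)
qed

lemma smooth_fun_mult:
  assumes "smooth_atlas A" "smooth_fun A f" "smooth_fun A g"
  shows "smooth_fun A (\<lambda>x. f x * g x)"
proof (rule smooth_funI_charts[OF assms(1)])
  fix U \<phi> assume U: "(U, \<phi>) \<in> A"
  show "smooth_on (\<phi> ` U) ((\<lambda>x. f x * g x) \<circ> inv_into U \<phi>)"
    using smooth_on_mult[OF chart_open_image[OF assms(1) U] smooth_funD(2)[OF assms(2) U]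
        smooth_funD(2)[OF assms(3) U]] by (simp add: o_def)
qed

lemma smooth_fun_lincomb:
  assumes "smooth_atlas A" "smooth_fun A f" "smooth_fun A g"
  shows "smooth_fun A (\<lambda>x. a * f x + b * g x)"
  by (rule smooth_fun_add[OF assms(1)]; rule smooth_fun_mult[OF assms(1) smooth_fun_const[OF assms(1)]])
    (fact assms)+

lemma smooth_fun_sum:
  assumes "smooth_atlas A" "\<And>i. i \<in> I \<Longrightarrow> smooth_fun A (f i)"
  shows "smooth_fun A (\<lambda>x. \<Sum>i\<in>I. f i x)"
  using assms(2)
proof (induction I rule: infinite_finite_induct)
  case (insert i I)
  show ?case unfolding sum.insert[OF insert.hyps]
    by (rule smooth_fun_add[OF assms(1)]) (simp_all add: insert)
qed (simp_all add: smooth_fun_const[OF assms(1)])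

lemma smooth_fun_compose:
  "smooth_atlas A \<Longrightarrow> smooth_atlas B \<Longrightarrow> smooth_map A B F \<Longrightarrow> smooth_fun B f \<Longrightarrow> smooth_fun A (f \<circ> F)"
  by (rule smooth_map_compose[OF _ _ smooth_atlas_std])

lemma smooth_fun_differentiable:
  assumes "smooth_atlas A" "smooth_fun A f" "(U, \<phi>) \<in> A" "p \<in> U"
  shows "((f \<circ> inv_into U \<phi>) has_derivative frechet_derivative (f \<circ> inv_into U \<phi>) (at (\<phi> p))) (at (\<phi> p))"
  by (rule smooth_on_has_derivative[OF smooth_funD(2)[OF assms(2,3)]]) (use assms in auto)

text \<open>
  A point outside \<open>U\<close> has a neighborhood that misses the closed set \<open>K\<close>, and there the extended function
  is zero. A support that is closed only relative to \<open>U\<close> would not do.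
\<close>

lemma smooth_fun_extend_zero:
  assumes A: "smooth_atlas A" and U: "(U, \<phi>) \<in> A" and K: "closed K" "K \<subseteq> U"
    and sm: "smooth_on (\<phi> ` U) (h \<circ> inv_into U \<phi>)" and 0: "\<And>q. q \<in> U \<Longrightarrow> q \<notin> K \<Longrightarrow> h q = 0"
  shows "smooth_fun A (\<lambda>q. if q \<in> U then h q else (0::real))"
proof (rule smooth_funI[OF A])
  fix p
  let ?f = "\<lambda>q. if q \<in> U then h q else (0::real)"
  show "\<exists>U \<phi> W. (U, \<phi>) \<in> A \<and> open W \<and> p \<in> W \<and> W \<subseteq> U \<and> smooth_on (\<phi> ` W) (?f \<circ> inv_into U \<phi>)"
  proof (cases "p \<in> U")
    case True
    have "smooth_on (\<phi> ` U) (?f \<circ> inv_into U \<phi>)"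
      by (rule smooth_on_cong[OF chart_open_image[OF A U], THEN iffD1, OF _ sm]) (auto simp: chart_inverse[OF A U])
    then show ?thesis using U True chart_open[OF A U]
      by (intro exI[of _ U] exI[of _ \<phi>] exI[of _ U]) simp
  next
    case False
    obtain V \<psi> where V: "(V, \<psi>) \<in> A" "p \<in> V" using atlas_chart[OF A] .
    have o: "open (V \<inter> - K)" using chart_open[OF A V(1)] K by auto
    have oi: "open (\<psi> ` (V \<inter> - K))" using chart_open_map[OF A V(1) o] by blast
    have "smooth_on (\<psi> ` (V \<inter> - K)) (?f \<circ> inv_into V \<psi>)"
      by (rule smooth_on_cong[OF oi, THEN iffD1, OF _ smooth_on_const[OF oi, of 0]])
        (auto simp: chart_inverse[OF A V(1)] 0)
    then show ?thesis using V o False K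
      by (intro exI[of _ V] exI[of _ \<psi>] exI[of _ "V \<inter> - K"]) auto
  qed
qed

text \<open>
  Derivations see only global functions, so a function given in a chart has to be replaced by a global
  one with the same germ: it is multiplied by a bump function and extended by zero. The support is the
  image of a compact ball, and it is closed because the manifold is Hausdorff. The support condition
  is what allows other objects living on the chart to be cut off in the same way.
\<close>

lemma ex_global_extension:
  fixes A :: "('e::t2_space, 'b::euclidean_space) chart set" and u :: "'b \<Rightarrow> real"
  assumes A: "smooth_atlas A" and U: "(U, \<phi>) \<in> A" and p: "p \<in> U" and S: "open S" "\<phi> p \<in> S"
    and u: "smooth_on S u"
  obtains f W K where "smooth_fun A f" "open W" "p \<in> W" "W \<subseteq> K" "closed K" "K \<subseteq> U" "\<phi> ` K \<subseteq> S"
    "\<And>q. q \<in> W \<Longrightarrow> f q = u (\<phi> q)" "\<And>q. q \<notin> K \<Longrightarrow> f q = 0"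
proof -
  have "open (S \<inter> \<phi> ` U)" "\<phi> p \<in> S \<inter> \<phi> ` U" using S p chart_open_image[OF A U] by auto
  then obtain r where r: "0 < r" "cball (\<phi> p) r \<subseteq> S \<inter> \<phi> ` U"
    by (meson open_contains_cball_eq)
  obtain \<rho> :: "'b \<Rightarrow> real" where \<rho>: "smooth_on UNIV \<rho>" "\<And>x. x \<in> ball (\<phi> p) (r/2) \<Longrightarrow> \<rho> x = 1"
    "\<And>x. x \<notin> ball (\<phi> p) r \<Longrightarrow> \<rho> x = 0"
    using ex_bump_on[OF r(1)] by blast
  \<comment> \<open>Only the values of \<open>u\<close> on \<open>S\<close> are meaningful, so the cutoff is done in the model space first.\<close>
  define w where "w x = (if x \<in> S then \<rho> x * u x else 0)" for x
  have w: "smooth_on UNIV w"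
  proof (rule smooth_on_local)
    fix x
    show "\<exists>T. open T \<and> x \<in> T \<and> smooth_on T w"
    proof (cases "x \<in> S")
      case True
      have "smooth_on S (\<lambda>x. \<rho> x * u x)"
        by (intro smooth_on_mult S u smooth_on_subset[OF \<rho>(1)]) auto
      then have "smooth_on S w" by (rule smooth_on_cong[OF S(1), THEN iffD1, rotated]) (auto simp: w_def)
      then show ?thesis using True S by blast
    next
      case False
      have o: "open (- cball (\<phi> p) r)" by auto
      have "smooth_on (- cball (\<phi> p) r) w"
        by (rule smooth_on_cong[OF o, THEN iffD1, OF _ smooth_on_const[OF o, of 0]])
          (auto simp: w_def \<rho>(3))
      then show ?thesis using False o r by blast
    qed
  qed
  define K where "K = inv_into U \<phi> ` cball (\<phi> p) r"
  have K: "closed K" "K \<subseteq> U" "\<phi> ` K \<subseteq> S"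
  proof -
    have "compact K" unfolding K_def
      by (rule compact_continuous_image[OF continuous_on_subset[OF chart_inverse_continuous[OF A U]]])
        (use r in auto)
    then show "closed K" by (rule compact_imp_closed)
    show "K \<subseteq> U" using r by (auto simp: K_def intro: inv_into_into)
    show "\<phi> ` K \<subseteq> S" using r by (auto simp: K_def f_inv_into_f subset_iff)
  qed
  have Ki: "q \<in> K \<longleftrightarrow> \<phi> q \<in> cball (\<phi> p) r" if "q \<in> U" for q
  proof
    show "q \<in> K \<Longrightarrow> \<phi> q \<in> cball (\<phi> p) r" using r by (auto simp: K_def f_inv_into_f)
    show "\<phi> q \<in> cball (\<phi> p) r \<Longrightarrow> q \<in> K"
      unfolding K_def using chart_inverse[OF A U that] by (metis imageI)
  qed
  define f where "f q = (if q \<in> U then w (\<phi> q) else 0)" for q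
  define W where "W = U \<inter> \<phi> -` (ball (\<phi> p) (r/2))"
  show ?thesis
  proof
    show "smooth_fun A f" unfolding f_def[abs_def]
    proof (rule smooth_fun_extend_zero[OF A U K(1,2)])
      show "smooth_on (\<phi> ` U) ((\<lambda>q. w (\<phi> q)) \<circ> inv_into U \<phi>)"
        by (rule smooth_on_cong[OF chart_open_image[OF A U], THEN iffD1, OF _ smooth_on_subset[OF w]])
          (auto simp: chart_inverse[OF A U])
      show "w (\<phi> q) = 0" if "q \<in> U" "q \<notin> K" for q
        using Ki[OF that(1)] that \<rho>(3)[of "\<phi> q"] by (auto simp: w_def)
    qed
    show "open W" unfolding W_def by (rule chart_open_preimage[OF A U]) auto
    show "p \<in> W" using p r by (auto simp: W_def)
    show "W \<subseteq> K" using Ki r by (auto simp: W_def)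
    show "f q = u (\<phi> q)" if "q \<in> W" for q
    proof -
      have "\<phi> q \<in> cball (\<phi> p) r" using that r by (auto simp: W_def)
      then have "\<phi> q \<in> S" using r by blast
      then show ?thesis using that \<rho>(2)[of "\<phi> q"] by (auto simp: W_def f_def w_def)
    qed
    show "f q = 0" if "q \<notin> K" for q
      using Ki[of q] that \<rho>(3)[of "\<phi> q"] by (auto simp: f_def w_def)
  qed (fact K)+
qed

section \<open>Tangent spaces\<close>

lemma tangent_nonsmooth: "v \<in> tangent_space A p \<Longrightarrow> \<not> smooth_fun A f \<Longrightarrow> v f = 0"
  and tangent_lincomb: "v \<in> tangent_space A p \<Longrightarrow> smooth_fun A f \<Longrightarrow> smooth_fun A g \<Longrightarrow>
    v (\<lambda>x. a * f x + b * g x) = a * v f + b * v g"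
  and tangent_mult: "v \<in> tangent_space A p \<Longrightarrow> smooth_fun A f \<Longrightarrow> smooth_fun A g \<Longrightarrow>
    v (\<lambda>x. f x * g x) = f p * v g + g p * v f"
  by (simp_all add: tangent_space_def)

lemma tangent_eqI:
  assumes "u \<in> tangent_space A p" "v \<in> tangent_space A q" "\<And>f. smooth_fun A f \<Longrightarrow> u f = v f"
  shows "u = v"
proof
  fix f show "u f = v f"
    using assms(3) tangent_nonsmooth[OF assms(1)] tangent_nonsmooth[OF assms(2)] by metis
qed

lemma zero_tangent: "(\<lambda>f. 0) \<in> tangent_space A p"
  by (simp add: tangent_space_def)

lemma lincomb_tangent:
  assumes "u \<in> tangent_space A p" "v \<in> tangent_space A p"
  shows "(\<lambda>f. a * u f + b * v f) \<in> tangent_space A p"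
  unfolding tangent_space_def mem_Collect_eq
  by (intro conjI allI impI)
    (simp_all add: tangent_nonsmooth[OF assms(1)] tangent_nonsmooth[OF assms(2)]
      tangent_lincomb[OF assms(1)] tangent_lincomb[OF assms(2)]
      tangent_mult[OF assms(1)] tangent_mult[OF assms(2)] algebra_simps)

lemma scale_tangent: "u \<in> tangent_space A p \<Longrightarrow> (\<lambda>f. a * u f) \<in> tangent_space A p"
  using lincomb_tangent[of u A p u a 0] by simp

lemma tangent_add:
  "v \<in> tangent_space A p \<Longrightarrow> smooth_fun A f \<Longrightarrow> smooth_fun A g \<Longrightarrow> v (\<lambda>x. f x + g x) = v f + v g"
  using tangent_lincomb[of v A p f g 1 1] by simp

lemma tangent_scale:
  "v \<in> tangent_space A p \<Longrightarrow> smooth_fun A f \<Longrightarrow> v (\<lambda>x. a * f x) = a * v f"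
  using tangent_lincomb[of v A p f f a 0] by simp

text \<open>
  The Leibniz rule for $1 \<cdot> 1$ gives twice the value at \<open>1\<close>.
\<close>

lemma tangent_const:
  assumes A: "smooth_atlas A" and v: "v \<in> tangent_space A p"
  shows "v (\<lambda>x. c) = 0"
proof -
  have "v (\<lambda>x. 1) = 0"
    using tangent_mult[OF v smooth_fun_const[OF A, of 1] smooth_fun_const[OF A, of 1]] by simp
  then show ?thesis
    using tangent_scale[OF v smooth_fun_const[OF A, of 1], of c] by simp
qed

lemma tangent_sum:
  assumes A: "smooth_atlas A" and v: "v \<in> tangent_space A p" and "\<And>i. i \<in> I \<Longrightarrow> smooth_fun A (f i)"
  shows "v (\<lambda>x. \<Sum>i\<in>I. f i x) = (\<Sum>i\<in>I. v (f i))"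
  using assms(3)
proof (induction I rule: infinite_finite_induct)
  case (insert i I)
  then have "v (\<lambda>x. f i x + (\<Sum>i\<in>I. f i x)) = v (f i) + (\<Sum>i\<in>I. v (f i))"
    using tangent_add[OF v, of "f i" "\<lambda>x. \<Sum>i\<in>I. f i x"] smooth_fun_sum[OF A, of I f] by simp
  then show ?case using insert.hyps by simp
qed (simp_all add: tangent_const[OF A v])

text \<open>
  If a cutoff function \<open>\<rho>\<close> with \<open>\<rho> p = 1\<close> is supported where \<open>f\<close> and \<open>g\<close> agree, then $\<rho> (f - g) = 0$, and
  the Leibniz rule at \<open>p\<close> reduces to the value of the derivation at $f - g$.
\<close>

lemma tangent_local:
  fixes A :: "('e::t2_space, 'b::euclidean_space) chart set"
  assumes A: "smooth_atlas A" and v: "v \<in> tangent_space A p"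
    and f: "smooth_fun A f" and g: "smooth_fun A g"
    and N: "open N" "p \<in> N" and eq: "\<And>q. q \<in> N \<Longrightarrow> f q = g q"
  shows "v f = v g"
proof -
  obtain U \<phi> where U: "(U, \<phi>) \<in> A" "p \<in> U" using atlas_chart[OF A] .
  have S: "open (\<phi> ` (U \<inter> N))" "\<phi> p \<in> \<phi> ` (U \<inter> N)"
    using chart_open_map[OF A U(1), of "U \<inter> N"] chart_open[OF A U(1)] N U by auto
  obtain \<rho> W K where \<rho>: "smooth_fun A \<rho>" "open W" "p \<in> W" "W \<subseteq> K" "closed K" "K \<subseteq> U"
    "\<phi> ` K \<subseteq> \<phi> ` (U \<inter> N)" "\<And>q. q \<in> W \<Longrightarrow> \<rho> q = 1" "\<And>q. q \<notin> K \<Longrightarrow> \<rho> q = 0"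
    by (rule ex_global_extension[OF A U S smooth_on_const[OF S(1), of 1]]) (rule that)
  have KN: "K \<subseteq> N"
  proof
    fix q assume q: "q \<in> K"
    then obtain q' where "q' \<in> U" "q' \<in> N" "\<phi> q = \<phi> q'" using \<rho>(7) by auto
    then show "q \<in> N" using chart_inj[OF A U(1)] q \<rho>(6) by (metis inj_onD subsetD)
  qed
  have d: "smooth_fun A (\<lambda>x. 1 * f x + (-1) * g x)" by (rule smooth_fun_lincomb[OF A f g])
  have "(\<lambda>x. \<rho> x * (1 * f x + (-1) * g x)) = (\<lambda>x. 0)"
    using KN eq \<rho>(9) by (metis (no_types, opaque_lifting) add.right_inverse mult_eq_0_iff mult_1 mult_minus1 subsetD)
  then have "\<rho> p * v (\<lambda>x. 1 * f x + (-1) * g x) + (1 * f p + (-1) * g p) * v \<rho> = 0"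
    using tangent_mult[OF v \<rho>(1) d] tangent_const[OF A v, of 0] by simp
  then have "v (\<lambda>x. 1 * f x + (-1) * g x) = 0"
    using \<rho>(8)[OF \<rho>(3)] eq[OF N(2)] by simp
  then show ?thesis using tangent_lincomb[OF v f g, of 1 "-1"] by simp
qed

lemma chart_vector_apply:
  "smooth_fun A f \<Longrightarrow> chart_vector A (U, \<phi>) p a f = frechet_derivative (f \<circ> inv_into U \<phi>) (at (\<phi> p)) a"
  by (simp add: chart_vector_def)

lemma chart_vector_apply_unique:
  "smooth_fun A f \<Longrightarrow> ((f \<circ> inv_into U \<phi>) has_derivative L) (at (\<phi> p)) \<Longrightarrow> chart_vector A (U, \<phi>) p a f = L a"
  by (simp add: chart_vector_apply frechet_derivative_at[symmetric])

lemma chart_vector_tangent: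
  assumes A: "smooth_atlas A" and U: "(U, \<phi>) \<in> A" "p \<in> U"
  shows "chart_vector A (U, \<phi>) p a \<in> tangent_space A p"
  unfolding tangent_space_def mem_Collect_eq
proof (intro conjI allI impI)
  fix f g :: "'a \<Rightarrow> real" and b c :: real
  show "\<not> smooth_fun A f \<Longrightarrow> chart_vector A (U, \<phi>) p a f = 0"
    by (simp add: chart_vector_def)
  assume f: "smooth_fun A f" and g: "smooth_fun A g"
  note df = smooth_fun_differentiable[OF A f U] and dg = smooth_fun_differentiable[OF A g U]
  show "chart_vector A (U, \<phi>) p a (\<lambda>x. b * f x + c * g x) = b * chart_vector A (U, \<phi>) p a f + c * chart_vector A (U, \<phi>) p a g"
    unfolding chart_vector_apply[OF f] chart_vector_apply[OF g]
    by (rule chart_vector_apply_unique[OF smooth_fun_lincomb[OF A f g]])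
      (use has_derivative_add[OF has_derivative_mult_right[OF df] has_derivative_mult_right[OF dg]] in
        \<open>simp add: o_def\<close>)
  show "chart_vector A (U, \<phi>) p a (\<lambda>x. f x * g x) = f p * chart_vector A (U, \<phi>) p a g + g p * chart_vector A (U, \<phi>) p a f"
    unfolding chart_vector_apply[OF f] chart_vector_apply[OF g]
    by (rule chart_vector_apply_unique[OF smooth_fun_mult[OF A f g]])
      (use has_derivative_mult[OF df dg] chart_inverse[OF A U] in \<open>simp add: o_def mult.commute\<close>)
qed

lemma chart_vector_lincomb:
  assumes A: "smooth_atlas A" and U: "(U, \<phi>) \<in> A" "p \<in> U"
  shows "chart_vector A (U, \<phi>) p (a *\<^sub>R x + b *\<^sub>R y) =
    (\<lambda>f. a * chart_vector A (U, \<phi>) p x f + b * chart_vector A (U, \<phi>) p y f)"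
proof
  fix f
  show "chart_vector A (U, \<phi>) p (a *\<^sub>R x + b *\<^sub>R y) f =
      a * chart_vector A (U, \<phi>) p x f + b * chart_vector A (U, \<phi>) p y f"
  proof (cases "smooth_fun A f")
    case True
    from has_derivative_linear[OF smooth_fun_differentiable[OF A True U]]
    show ?thesis by (simp add: chart_vector_apply[OF True] linear_add linear_scale)
  qed (simp add: chart_vector_def)
qed

text \<open>
  Global substitutes for the coordinates of a chart; they read off the components of chart vectors.
\<close>

lemma ex_coordinate_fun:
  fixes A :: "('e::t2_space, 'b::euclidean_space) chart set"
  assumes A: "smooth_atlas A" and U: "(U, \<phi>) \<in> A" "p \<in> U"
  obtains f W where "smooth_fun A f" "open W" "p \<in> W" "W \<subseteq> U" "\<And>q. q \<in> W \<Longrightarrow> f q = \<phi> q \<bullet> b"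
    "\<And>a. chart_vector A (U, \<phi>) p a f = a \<bullet> b"
proof -
  obtain f W K where f: "smooth_fun A f" "open W" "p \<in> W" "W \<subseteq> K" "closed K" "K \<subseteq> U"
    "\<phi> ` K \<subseteq> UNIV" "\<And>q. q \<in> W \<Longrightarrow> f q = \<phi> q \<bullet> b" "\<And>q. q \<notin> K \<Longrightarrow> f q = 0"
    by (rule ex_global_extension[OF A U open_UNIV UNIV_I smooth_on_linear[OF open_UNIV bounded_linear_inner_left[of b]]])
      (rule that)
  have WU: "W \<subseteq> U" using f by blast
  have "chart_vector A (U, \<phi>) p a f = a \<bullet> b" for a
  proof (rule chart_vector_apply_unique[OF f(1)])
    have "((\<lambda>x. x \<bullet> b) has_derivative (\<lambda>a. a \<bullet> b)) (at (\<phi> p))"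
      by (rule bounded_linear_imp_has_derivative[OF bounded_linear_inner_left])
    then show "((f \<circ> inv_into U \<phi>) has_derivative (\<lambda>a. a \<bullet> b)) (at (\<phi> p))"
    proof (rule has_derivative_transform_within_open[OF _ chart_open_map[OF A U(1) f(2) WU]])
      show "\<phi> p \<in> \<phi> ` W" using f by simp
      fix x assume "x \<in> \<phi> ` W"
      then obtain q where "q \<in> W" "x = \<phi> q" by auto
      then show "x \<bullet> b = (f \<circ> inv_into U \<phi>) x"
        using f(8) chart_inverse[OF A U(1), of q] WU by (auto simp: subset_iff)
    qed
  qed
  then show ?thesis using that[of f W] f WU by blast
qed

lemma chart_vector_inj:
  fixes A :: "('e::t2_space, 'b::euclidean_space) chart set"
  assumes A: "smooth_atlas A" and U: "(U, \<phi>) \<in> A" "p \<in> U"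
    and eq: "chart_vector A (U, \<phi>) p a = chart_vector A (U, \<phi>) p b"
  shows "a = b"
proof (rule euclidean_eqI)
  fix i
  obtain f W where "\<And>a. chart_vector A (U, \<phi>) p a f = a \<bullet> i"
    by (rule ex_coordinate_fun[OF A U, of i]) (rule that)
  then show "a \<bullet> i = b \<bullet> i" using eq by metis
qed

text \<open>
  By Hadamard's lemma, a smooth function is near \<open>p\<close> its value at \<open>p\<close> plus a sum of products of
  $X_b - X_b(p)$ with smooth functions, where $X_b$ is a coordinate function. The Leibniz rule then
  expresses \<open>v f\<close> by the partial derivatives of \<open>f\<close> at \<open>p\<close>, with the values $v(X_b)$ as components.
\<close>

lemma tangent_chart_vector:
  fixes A :: "('e::t2_space, 'b::euclidean_space) chart set"
  assumes A: "smooth_atlas A" and U: "(U, \<phi>) \<in> A" "p \<in> U" and v: "v \<in> tangent_space A p"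
  obtains a where "v = chart_vector A (U, \<phi>) p a"
proof -
  have "\<forall>b. \<exists>f W. smooth_fun A f \<and> open W \<and> p \<in> W \<and> W \<subseteq> U \<and> (\<forall>q\<in>W. f q = \<phi> q \<bullet> b)"
  proof
    fix b
    obtain f W where "smooth_fun A f" "open W" "p \<in> W" "W \<subseteq> U" "\<And>q. q \<in> W \<Longrightarrow> f q = \<phi> q \<bullet> b"
      by (rule ex_coordinate_fun[OF A U, of b]) (rule that)
    then show "\<exists>f W. smooth_fun A f \<and> open W \<and> p \<in> W \<and> W \<subseteq> U \<and> (\<forall>q\<in>W. f q = \<phi> q \<bullet> b)"
      by (intro exI[of _ f] exI[of _ W]) simp
  qed
  then obtain X W where X: "\<And>b. smooth_fun A (X b)" and W: "\<And>b. open (W b)" "\<And>b. p \<in> W b" "\<And>b. W b \<subseteq> U"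
    and XW: "\<And>b q. q \<in> W b \<Longrightarrow> X b q = \<phi> q \<bullet> b" by metis
  define a where "a = (\<Sum>b\<in>Basis. v (X b) *\<^sub>R b)"
  have "v = chart_vector A (U, \<phi>) p a"
  proof (rule tangent_eqI[OF v chart_vector_tangent[OF A U]])
    fix f assume f: "smooth_fun A f"
    obtain r where r: "0 < r" "ball (\<phi> p) r \<subseteq> \<phi> ` U"
      using chart_open_image[OF A U(1)] U(2) by (meson imageI openE)
    define S where "S = ball (\<phi> p) r"
    have S: "open S" "convex S" "\<phi> p \<in> S" using r by (auto simp: S_def)
    have sS: "smooth_on S (f \<circ> inv_into U \<phi>)"
      by (rule smooth_on_subset[OF smooth_funD(2)[OF f U(1)]]) (simp add: S_def r(2))
    obtain G where G: "\<And>b. smooth_on S (G b)"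
      "\<And>x. x \<in> S \<Longrightarrow> (f \<circ> inv_into U \<phi>) x = (f \<circ> inv_into U \<phi>) (\<phi> p) + (\<Sum>b\<in>Basis. ((x - \<phi> p) \<bullet> b) * G b x)"
      "\<And>b. G b (\<phi> p) = frechet_derivative (f \<circ> inv_into U \<phi>) (at (\<phi> p)) b"
      by (rule hadamard[OF S sS]) (rule that)
    have "\<forall>b. \<exists>g N. smooth_fun A g \<and> open N \<and> p \<in> N \<and> N \<subseteq> U \<and> \<phi> ` N \<subseteq> S \<and> (\<forall>q\<in>N. g q = G b (\<phi> q))"
    proof
      fix b
      obtain g N K where "smooth_fun A g" "open N" "p \<in> N" "N \<subseteq> K" "closed K" "K \<subseteq> U"
        "\<phi> ` K \<subseteq> S" "\<And>q. q \<in> N \<Longrightarrow> g q = G b (\<phi> q)" "\<And>q. q \<notin> K \<Longrightarrow> g q = 0"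
        by (rule ex_global_extension[OF A U S(1,3) G(1)]) (rule that)
      then show "\<exists>g N. smooth_fun A g \<and> open N \<and> p \<in> N \<and> N \<subseteq> U \<and> \<phi> ` N \<subseteq> S \<and> (\<forall>q\<in>N. g q = G b (\<phi> q))"
        by (intro exI[of _ g] exI[of _ N]) auto
    qed
    then obtain g N where g: "\<And>b. smooth_fun A (g b)" and N: "\<And>b. open (N b)" "\<And>b. p \<in> N b" "\<And>b. N b \<subseteq> U"
      "\<And>b. \<phi> ` N b \<subseteq> S" and gN: "\<And>b q. q \<in> N b \<Longrightarrow> g b q = G b (\<phi> q)" by metis
    \<comment> \<open>The global version of the summand \<open>((x - \<phi> p) \<bullet> b) * G b x\<close> in Hadamard's formula.\<close>
    define h where "h b x = (1 * X b x + (-1) * (\<phi> p \<bullet> b)) * g b x" for b x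
    have sX: "smooth_fun A (\<lambda>x. 1 * X b x + (-1) * (\<phi> p \<bullet> b))" for b
      by (rule smooth_fun_lincomb[OF A X smooth_fun_const[OF A]])
    have sh: "smooth_fun A (h b)" for b
      unfolding h_def by (rule smooth_fun_mult[OF A sX g])
    have vh: "v (h b) = v (X b) * frechet_derivative (f \<circ> inv_into U \<phi>) (at (\<phi> p)) b" for b
    proof -
      have "v (\<lambda>x. 1 * X b x + (-1) * (\<phi> p \<bullet> b)) = v (X b)"
        using tangent_lincomb[OF v X smooth_fun_const[OF A], of 1 b "-1" "\<phi> p \<bullet> b"]
          tangent_const[OF A v, of "\<phi> p \<bullet> b"] by simp
      then show ?thesis
        unfolding h_def using tangent_mult[OF v sX[of b] g[of b]] XW[OF W(2), of b] gN[OF N(2), of b] G(3)[of b]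
        by simp
    qed
    have "v f = v (\<lambda>x. f p + (\<Sum>b\<in>Basis. h b x))"
    proof (rule tangent_local[OF A v f])
      show "smooth_fun A (\<lambda>x. f p + (\<Sum>b\<in>Basis. h b x))"
        by (rule smooth_fun_add[OF A smooth_fun_const[OF A] smooth_fun_sum[OF A sh]])
      show "open (\<Inter>b\<in>Basis. W b \<inter> N b)" using W N by (intro open_INT) auto
      show "p \<in> (\<Inter>b\<in>Basis. W b \<inter> N b)" using W N by auto
      fix q assume q: "q \<in> (\<Inter>b\<in>Basis. W b \<inter> N b)"
      have qb: "q \<in> W b" "q \<in> N b" if "b \<in> Basis" for b using q that by auto
      obtain b0 :: 'b where b0: "b0 \<in> Basis" using nonempty_Basis by blast
      have qU: "q \<in> U" "\<phi> q \<in> S" using qb[OF b0] N(3,4)[of b0] by auto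
      have "f q = f p + (\<Sum>b\<in>Basis. ((\<phi> q - \<phi> p) \<bullet> b) * G b (\<phi> q))"
        using G(2)[OF qU(2)] chart_inverse[OF A U(1)] qU(1) U(2) by simp
      also have "(\<Sum>b\<in>Basis. ((\<phi> q - \<phi> p) \<bullet> b) * G b (\<phi> q)) = (\<Sum>b\<in>Basis. h b q)"
        by (rule sum.cong) (simp_all add: h_def XW gN qb inner_diff_left)
      finally show "f q = f p + (\<Sum>b\<in>Basis. h b q)" .
    qed
    also have "\<dots> = (\<Sum>b\<in>Basis. v (h b))"
      using tangent_add[OF v smooth_fun_const[OF A, of "f p"] smooth_fun_sum[OF A, of Basis h, OF sh]]
        tangent_sum[OF A v, of Basis h, OF sh] tangent_const[OF A v, of "f p"] by simp
    also have "\<dots> = frechet_derivative (f \<circ> inv_into U \<phi>) (at (\<phi> p)) a"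
    proof -
      note lin = has_derivative_linear[OF smooth_fun_differentiable[OF A f U]]
      show ?thesis by (simp add: a_def vh linear_sum[OF lin] linear_scale[OF lin])
    qed
    finally show "v f = chart_vector A (U, \<phi>) p a f" by (simp add: chart_vector_apply[OF f])
  qed
  then show ?thesis by (rule that)
qed

section \<open>Differentials\<close>

lemma differential_apply: "smooth_fun B f \<Longrightarrow> differential B F v f = v (f \<circ> F)"
  by (simp add: differential_def)

lemma differential_tangent:
  assumes A: "smooth_atlas A" and B: "smooth_atlas B" and F: "smooth_map A B F" and v: "v \<in> tangent_space A p"
  shows "differential B F v \<in> tangent_space B (F p)"
  unfolding tangent_space_def mem_Collect_eq
proof (intro conjI allI impI)
  fix f g :: "'c \<Rightarrow> real" and b c :: real
  show "\<not> smooth_fun B f \<Longrightarrow> differential B F v f = 0" by (simp add: differential_def)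
  assume f: "smooth_fun B f" and g: "smooth_fun B g"
  note fF = smooth_fun_compose[OF A B F f] and gF = smooth_fun_compose[OF A B F g]
  show "differential B F v (\<lambda>x. b * f x + c * g x) = b * differential B F v f + c * differential B F v g"
    using tangent_lincomb[OF v fF gF, of b c]
    by (simp add: differential_apply f g smooth_fun_lincomb[OF B f g] o_def)
  show "differential B F v (\<lambda>x. f x * g x) = f (F p) * differential B F v g + g (F p) * differential B F v f"
    using tangent_mult[OF v fF gF]
    by (simp add: differential_apply f g smooth_fun_mult[OF B f g] o_def)
qed

lemma differential_lincomb:
  "differential B F (\<lambda>f. a * u f + b * v f) = (\<lambda>f. a * differential B F u f + b * differential B F v f)"
  by (auto simp: differential_def)

lemma differential_minus: "differential B F (\<lambda>f. - u f) = (\<lambda>f. - differential B F u f)"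
  by (auto simp: differential_def)

lemma differential_compose:
  "smooth_atlas B \<Longrightarrow> smooth_atlas C \<Longrightarrow> smooth_map B C G \<Longrightarrow>
    differential C G (differential B F v) = differential C (G \<circ> F) v"
  by (rule ext, simp add: differential_def smooth_fun_compose o_assoc)

lemma differential_id: "v \<in> tangent_space A p \<Longrightarrow> differential A id v = v"
  by (auto simp: differential_def fun_eq_iff tangent_nonsmooth)

lemma chart_representation_has_derivative:
  assumes A: "smooth_atlas A" and B: "smooth_atlas B" and F: "smooth_map A B F"
    and U: "(U, \<phi>) \<in> A" "p \<in> U" and V: "(V, \<psi>) \<in> B" "F p \<in> V"
  shows "((\<psi> \<circ> F \<circ> inv_into U \<phi>) has_derivative frechet_derivative (\<psi> \<circ> F \<circ> inv_into U \<phi>) (at (\<phi> p))) (at (\<phi> p))"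
  by (rule smooth_on_has_derivative[OF smooth_mapD(2)[OF F U(1) V(1)]]) (use U V in auto)

text \<open>
  The chain rule: in charts, the differential is the derivative of the chart expression.
\<close>

lemma differential_chart_vector:
  assumes A: "smooth_atlas A" and B: "smooth_atlas B" and F: "smooth_map A B F"
    and U: "(U, \<phi>) \<in> A" "p \<in> U" and V: "(V, \<psi>) \<in> B" "F p \<in> V"
  shows "differential B F (chart_vector A (U, \<phi>) p a) =
    chart_vector B (V, \<psi>) (F p) (frechet_derivative (\<psi> \<circ> F \<circ> inv_into U \<phi>) (at (\<phi> p)) a)"
proof (rule tangent_eqI[OF differential_tangent[OF A B F chart_vector_tangent[OF A U]] chart_vector_tangent[OF B V]])
  fix f assume f: "smooth_fun B f"
  have o: "open (U \<inter> F -` V)"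
    using smooth_map_open_vimage[OF F chart_open[OF B V(1)]] chart_open[OF A U(1)] by auto
  have d1: "((\<psi> \<circ> F \<circ> inv_into U \<phi>) has_derivative frechet_derivative (\<psi> \<circ> F \<circ> inv_into U \<phi>) (at (\<phi> p))) (at (\<phi> p))"
    by (rule chart_representation_has_derivative[OF A B F U V])
  have d2: "((f \<circ> inv_into V \<psi>) has_derivative frechet_derivative (f \<circ> inv_into V \<psi>) (at (\<psi> (F p))))
      (at ((\<psi> \<circ> F \<circ> inv_into U \<phi>) (\<phi> p)))"
    using smooth_fun_differentiable[OF B f V] chart_inverse[OF A U] by simp
  have d: "((\<lambda>y. (f \<circ> inv_into V \<psi>) ((\<psi> \<circ> F \<circ> inv_into U \<phi>) y)) has_derivative
     (\<lambda>a. frechet_derivative (f \<circ> inv_into V \<psi>) (at (\<psi> (F p))) (frechet_derivative (\<psi> \<circ> F \<circ> inv_into U \<phi>) (at (\<phi> p)) a))) (at (\<phi> p))"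
    by (rule has_derivative_compose[OF d1 d2])
  have "(((f \<circ> F) \<circ> inv_into U \<phi>) has_derivative
     (\<lambda>a. frechet_derivative (f \<circ> inv_into V \<psi>) (at (\<psi> (F p))) (frechet_derivative (\<psi> \<circ> F \<circ> inv_into U \<phi>) (at (\<phi> p)) a))) (at (\<phi> p))"
  proof (rule has_derivative_transform_within_open[OF d chart_open_map[OF A U(1) o]])
    show "\<phi> p \<in> \<phi> ` (U \<inter> F -` V)" using U V by auto
    fix x assume "x \<in> \<phi> ` (U \<inter> F -` V)"
    then obtain q where "q \<in> U" "F q \<in> V" "x = \<phi> q" by auto
    then show "(f \<circ> inv_into V \<psi>) ((\<psi> \<circ> F \<circ> inv_into U \<phi>) x) = ((f \<circ> F) \<circ> inv_into U \<phi>) x"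
      by (simp add: chart_inverse[OF A U(1)] chart_inverse[OF B V(1)])
  qed auto
  from chart_vector_apply_unique[OF smooth_fun_compose[OF A B F f] this, of a]
  show "differential B F (chart_vector A (U, \<phi>) p a) f =
    chart_vector B (V, \<psi>) (F p) (frechet_derivative (\<psi> \<circ> F \<circ> inv_into U \<phi>) (at (\<phi> p)) a) f"
    by (simp add: differential_apply[OF f] chart_vector_apply[OF f])
qed

lemma chart_vector_change:
  assumes A: "smooth_atlas A" and U: "(U, \<phi>) \<in> A" "p \<in> U" and V: "(V, \<psi>) \<in> A" "p \<in> V"
  shows "chart_vector A (U, \<phi>) p a =
    chart_vector A (V, \<psi>) p (frechet_derivative (\<psi> \<circ> inv_into U \<phi>) (at (\<phi> p)) a)"
  using differential_chart_vector[OF A A smooth_map_id[OF A] U V(1)] V(2)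
    differential_id[OF chart_vector_tangent[OF A U, of a]] by simp

section \<open>Vector fields\<close>

text \<open>
  The coordinate field with constant components through the given vector, cut off outside the chart.
\<close>

lemma ex_smooth_field_through:
  fixes A :: "('e::t2_space, 'b::euclidean_space) chart set"
  assumes A: "smooth_atlas A" and v: "v \<in> tangent_space A p"
  obtains X where "smooth_field A X" "X p = v"
proof -
  obtain U \<phi> where U: "(U, \<phi>) \<in> A" "p \<in> U" using atlas_chart[OF A] .
  obtain a where a: "v = chart_vector A (U, \<phi>) p a" using tangent_chart_vector[OF A U v] .
  obtain \<rho> W K where \<rho>: "smooth_fun A \<rho>" "open W" "p \<in> W" "W \<subseteq> K" "closed K" "K \<subseteq> U"
    "\<phi> ` K \<subseteq> UNIV" "\<And>q. q \<in> W \<Longrightarrow> \<rho> q = 1" "\<And>q. q \<notin> K \<Longrightarrow> \<rho> q = 0"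
    by (rule ex_global_extension[OF A U open_UNIV UNIV_I smooth_on_const[OF open_UNIV, of 1]]) (rule that)
  define X where "X q = (if q \<in> U then (\<lambda>f. \<rho> q * chart_vector A (U, \<phi>) q a f) else (\<lambda>f. 0))" for q
  have "smooth_field A X"
    unfolding smooth_field_def
  proof (intro conjI allI impI)
    fix q show "X q \<in> tangent_space A q"
    proof (cases "q \<in> U")
      case True
      then show ?thesis
        using scale_tangent[OF chart_vector_tangent[OF A U(1) True, of a], of "\<rho> q"] by (simp add: X_def)
    qed (simp add: X_def zero_tangent)
  next
    fix f assume f: "smooth_fun A f"
    have "smooth_fun A (\<lambda>q. if q \<in> U then \<rho> q * chart_vector A (U, \<phi>) q a f else 0)"
    proof (rule smooth_fun_extend_zero[OF A U(1) \<rho>(5,6)])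
      have "smooth_on (\<phi> ` U) (\<lambda>x. (\<rho> \<circ> inv_into U \<phi>) x * frechet_derivative (f \<circ> inv_into U \<phi>) (at x) a)"
        by (rule smooth_on_mult[OF chart_open_image[OF A U(1)] smooth_funD(2)[OF \<rho>(1) U(1)]
            smooth_on_derivative[OF smooth_funD(2)[OF f U(1)]]])
      then show "smooth_on (\<phi> ` U) ((\<lambda>q. \<rho> q * chart_vector A (U, \<phi>) q a f) \<circ> inv_into U \<phi>)"
        by (rule smooth_on_cong[OF chart_open_image[OF A U(1)], THEN iffD1, rotated])
          (auto simp: chart_vector_apply[OF f] chart_inverse[OF A U(1)])
    qed (simp add: \<rho>(9))
    also have "(\<lambda>q. if q \<in> U then \<rho> q * chart_vector A (U, \<phi>) q a f else 0) = (\<lambda>q. X q f)"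
      by (auto simp: X_def)
    finally show "smooth_fun A (\<lambda>q. X q f)" .
  qed
  moreover have "X p = v" using U(2) \<rho>(8)[OF \<rho>(3)] by (simp add: X_def a)
  ultimately show ?thesis by (rule that)
qed

lemma smooth_fieldD:
  "smooth_field A X \<Longrightarrow> X p \<in> tangent_space A p"
  "smooth_field A X \<Longrightarrow> smooth_fun A f \<Longrightarrow> smooth_fun A (\<lambda>p. X p f)"
  by (simp_all add: smooth_field_def)

definition pushforward ::
  "('m::topological_space, 'c::euclidean_space) chart set \<Rightarrow> ('e \<Rightarrow> 'm) \<Rightarrow> 'e field \<Rightarrow> 'm field" where
  "pushforward B F X = (\<lambda>q. differential B F (X (inv F q)))"

lemma pushforward_apply:
  "bij F \<Longrightarrow> smooth_fun B u \<Longrightarrow> pushforward B F X (F p) u = X p (u \<circ> F)"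
  by (simp add: pushforward_def differential_apply bij_is_inj)

lemma pushforward_at: "bij F \<Longrightarrow> pushforward B F X (F p) = differential B F (X p)"
  by (simp add: pushforward_def bij_is_inj)

lemma smooth_field_pushforward:
  assumes A: "smooth_atlas A" and B: "smooth_atlas B" and F: "smooth_map A B F" "bij F" "smooth_map B A (inv F)"
    and X: "smooth_field A X"
  shows "smooth_field B (pushforward B F X)"
  unfolding smooth_field_def
proof (intro conjI allI impI)
  fix q
  show "pushforward B F X q \<in> tangent_space B q"
    using differential_tangent[OF A B F(1) smooth_fieldD(1)[OF X, of "inv F q"]] F(2)
    by (simp add: pushforward_def bij_is_surj surj_f_inv_f)
next
  fix u assume u: "smooth_fun B u"
  have "smooth_fun B ((\<lambda>p. X p (u \<circ> F)) \<circ> inv F)"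
    by (rule smooth_fun_compose[OF B A F(3) smooth_fieldD(2)[OF X smooth_fun_compose[OF A B F(1) u]]])
  then show "smooth_fun B (\<lambda>q. pushforward B F X q u)"
    by (simp add: pushforward_def differential_apply[OF u] o_def)
qed

text \<open>
  A field and its pushforward are \<open>F\<close>-related: applying the pushforward of \<open>Z\<close> to \<open>u\<close> and composing with
  \<open>F\<close> is the same as applying \<open>Z\<close> to \<open>u \<circ> F\<close>. Iterating this twice gives the claim.
\<close>

lemma lie_bracket_pushforward:
  assumes A: "smooth_atlas A" and B: "smooth_atlas B" and F: "smooth_map A B F" "bij F" "smooth_map B A (inv F)"
    and X: "smooth_field A X" and Y: "smooth_field A Y"
  shows "lie_bracket B (pushforward B F X) (pushforward B F Y) (F p) = differential B F (lie_bracket A X Y p)"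
proof
  fix u
  show "lie_bracket B (pushforward B F X) (pushforward B F Y) (F p) u = differential B F (lie_bracket A X Y p) u"
  proof (cases "smooth_fun B u")
    case True
    note uF = smooth_fun_compose[OF A B F(1) True]
    have *: "(\<lambda>q. pushforward B F Z q u) \<circ> F = (\<lambda>p. Z p (u \<circ> F))" for Z
      using pushforward_apply[OF F(2) True] by (auto simp: o_def)
    show ?thesis
      using True uF smooth_fieldD(2)[OF smooth_field_pushforward[OF A B F X] True]
        smooth_fieldD(2)[OF smooth_field_pushforward[OF A B F Y] True]
      by (simp add: lie_bracket_def differential_apply pushforward_apply[OF F(2)] *)
  qed (simp add: lie_bracket_def differential_def)
qed

section \<open>Submersions\<close>

lemma submersion_chart_surj:
  fixes A :: "('e::t2_space, 'b::euclidean_space) chart set"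
    and B :: "('m::t2_space, 'c::euclidean_space) chart set"
  assumes A: "smooth_atlas A" and B: "smooth_atlas B" and F: "smooth_map A B F"
    and sub: "differential B F ` tangent_space A p = tangent_space B (F p)"
    and U: "(U, \<phi>) \<in> A" "p \<in> U" and V: "(V, \<psi>) \<in> B" "F p \<in> V"
  shows "surj (frechet_derivative (\<psi> \<circ> F \<circ> inv_into U \<phi>) (at (\<phi> p)))" (is "surj ?D")
proof (rule surjI[where f = "\<lambda>b. SOME a. ?D a = b"])
  fix b
  have "chart_vector B (V, \<psi>) (F p) b \<in> differential B F ` tangent_space A p"
    unfolding sub by (rule chart_vector_tangent[OF B V])
  then obtain v where v: "v \<in> tangent_space A p" "chart_vector B (V, \<psi>) (F p) b = differential B F v" by auto
  obtain a where "v = chart_vector A (U, \<phi>) p a" using tangent_chart_vector[OF A U v(1)] .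
  then have "chart_vector B (V, \<psi>) (F p) (?D a) = chart_vector B (V, \<psi>) (F p) b"
    using v(2) differential_chart_vector[OF A B F U V, of a] by simp
  then have "?D a = b" by (rule chart_vector_inj[OF B V])
  then show "?D (SOME a. ?D a = b) = b" by (rule someI)
qed

text \<open>
  Let \<open>L\<close> be a right inverse of the derivative of the chart expression of \<open>F\<close> at \<open>\<phi> p\<close>. The restriction
  of the chart expression to the affine subspace $\<phi>(p) + L(\<real>^n)$ has derivative the identity at the
  origin, so it has a smooth local inverse; composed with the affine parametrization, this inverse is
  the section.
\<close>

lemma submersion_local_section:
  fixes A :: "('e::t2_space, 'b::euclidean_space) chart set"
    and B :: "('m::t2_space, real^'n) chart set"
  assumes A: "smooth_atlas A" and B: "smooth_atlas B" and F: "smooth_map A B F"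
    and surj: "differential B F ` tangent_space A p = tangent_space B (F p)"
    and U: "(U, \<phi>) \<in> A" "p \<in> U" and V: "(V, \<psi>) \<in> B" "F p \<in> V"
  obtains T s where "open T" "T \<subseteq> \<psi> ` V" "\<psi> (F p) \<in> T" "smooth_on T s" "s ` T \<subseteq> \<phi> ` U"
    "\<And>y. y \<in> T \<Longrightarrow> F (inv_into U \<phi> (s y)) = inv_into V \<psi> y" "s (\<psi> (F p)) = \<phi> p"
proof -
  define Q where "Q = \<phi> ` (U \<inter> F -` V)"
  define \<Phi> where "\<Phi> = \<psi> \<circ> F \<circ> inv_into U \<phi>"
  have Q: "open Q" unfolding Q_def
    using chart_open_map[OF A U(1), of "U \<inter> F -` V"] chart_open[OF A U(1)]
      smooth_map_open_vimage[OF F chart_open[OF B V(1)]] by auto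
  have s\<Phi>: "smooth_on Q \<Phi>" unfolding Q_def \<Phi>_def by (rule smooth_mapD(2)[OF F U(1) V(1)])
  have pQ: "\<phi> p \<in> Q" using U V by (auto simp: Q_def)
  have \<Phi>p: "\<Phi> (\<phi> p) = \<psi> (F p)" using chart_inverse[OF A U] by (simp add: \<Phi>_def)
  let ?D = "frechet_derivative \<Phi> (at (\<phi> p))"
  have D: "(\<Phi> has_derivative ?D) (at (\<phi> p))" by (rule smooth_on_has_derivative[OF s\<Phi> pQ])
  have "surj ?D" unfolding \<Phi>_def by (rule submersion_chart_surj[OF A B F surj U V])
  then obtain L where L: "linear L" "?D \<circ> L = id"
    using linear_surjective_right_inverse[OF has_derivative_linear[OF D]] by auto
  have bL: "bounded_linear L" using L(1) linear_conv_bounded_linear by blast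
  define E where "E y = \<phi> p + L y" for y
  have sE: "smooth_on UNIV E" unfolding E_def[abs_def]
    by (rule smooth_on_add[OF open_UNIV smooth_on_const[OF open_UNIV] smooth_on_linear[OF open_UNIV bL]])
  define S where "S = E -` Q"
  have S: "open S" unfolding S_def by (rule open_vimage[OF Q smooth_on_imp_continuous[OF sE]])
  have E0: "E 0 = \<phi> p" using L(1) by (simp add: E_def linear_0)
  have S0: "0 \<in> S" using pQ by (simp add: S_def E0)
  define G where "G y = \<Phi> (E y)" for y
  have sG: "smooth_on S G" unfolding G_def[abs_def]
    by (rule smooth_on_compose[OF S Q smooth_on_subset[OF sE] s\<Phi>]) (auto simp: S_def)
  have dL: "(L has_derivative L) (at 0)" by (rule bounded_linear_imp_has_derivative[OF bL])
  have dE: "(E has_derivative L) (at 0)"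
    using has_derivative_add[OF has_derivative_const[of "\<phi> p"] dL] unfolding E_def[abs_def] by simp
  have "(G has_derivative (\<lambda>v. ?D (L v))) (at 0)"
    unfolding G_def[abs_def] by (rule has_derivative_compose[OF dE]) (simp add: E0 D)
  from frechet_derivative_at[OF this] have "frechet_derivative G (at 0) = (\<lambda>v. v)"
    using L(2) by (simp add: fun_eq_iff)
  then have "inj (frechet_derivative G (at 0))" by (simp add: inj_def)
  from smooth_inverse_function[OF S S0 sG this]
  obtain U' V' H where H: "open U'" "U' \<subseteq> S" "0 \<in> U'" "open V'" "G 0 \<in> V'" "homeomorphism U' V' G H" "smooth_on V' H"
    by blast
  have HU: "H y \<in> U'" "G (H y) = y" if "y \<in> V'" for y
    using H(6) that by (auto simp: homeomorphism_def)
  have EQ: "E (H y) \<in> Q" if "y \<in> V'" for y using HU(1)[OF that] H(2) by (auto simp: S_def)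
  have sec: "F (inv_into U \<phi> (E (H y))) \<in> V" "\<psi> (F (inv_into U \<phi> (E (H y)))) = y" if y: "y \<in> V'" for y
  proof -
    obtain q where "q \<in> U" "F q \<in> V" "E (H y) = \<phi> q" using EQ[OF y] by (auto simp: Q_def)
    then show "F (inv_into U \<phi> (E (H y))) \<in> V" using chart_inverse[OF A U(1)] by simp
    show "\<psi> (F (inv_into U \<phi> (E (H y)))) = y" using HU(2)[OF y] by (simp add: G_def \<Phi>_def)
  qed
  show ?thesis
  proof
    show "V' \<subseteq> \<psi> ` V" using sec by (metis image_eqI subsetI)
    show "\<psi> (F p) \<in> V'" using H(5) by (simp add: G_def E0 \<Phi>p)
    show "smooth_on V' (\<lambda>y. E (H y))" by (rule smooth_on_compose[OF H(4) open_UNIV H(7) sE]) simp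
    show "(\<lambda>y. E (H y)) ` V' \<subseteq> \<phi> ` U" using EQ by (auto simp: Q_def)
    show "F (inv_into U \<phi> (E (H y))) = inv_into V \<psi> y" if "y \<in> V'" for y
      using chart_inverse[OF B V(1) sec(1)[OF that]] sec(2)[OF that] by simp
    have "H (G 0) = 0" using H(3,6) by (simp add: homeomorphism_def)
    then show "E (H (\<psi> (F p))) = \<phi> p" by (simp add: G_def E0 \<Phi>p)
  qed (fact H(4))
qed

text \<open>
  Near any point of \<open>B\<close>, the map \<open>k\<close> is the smooth map \<open>k \<circ> F\<close> composed with a local section of \<open>F\<close>.
\<close>

lemma smooth_map_descend:
  fixes A :: "('e::t2_space, 'b::euclidean_space) chart set"
    and B :: "('m::t2_space, real^'n) chart set"
    and C :: "('x::topological_space, 'c::euclidean_space) chart set"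
  assumes A: "smooth_atlas A" and B: "smooth_atlas B" and C: "smooth_atlas C" and F: "smooth_map A B F" "surj F"
    and sub: "\<And>p. differential B F ` tangent_space A p = tangent_space B (F p)"
    and kF: "smooth_map A C (k \<circ> F)"
  shows "smooth_map B C k"
proof (rule smooth_map_localI[OF B C])
  fix x
  obtain p where p: "F p = x" using F(2) by (metis surjD)
  obtain U \<phi> where U: "(U, \<phi>) \<in> A" "p \<in> U" using atlas_chart[OF A] .
  obtain V \<psi> where V: "(V, \<psi>) \<in> B" "F p \<in> V" using atlas_chart[OF B] .
  obtain X \<omega> where X: "(X, \<omega>) \<in> C" "k x \<in> X" using atlas_chart[OF C] .
  obtain T s where T: "open T" "T \<subseteq> \<psi> ` V" "\<psi> (F p) \<in> T" "smooth_on T s" "s ` T \<subseteq> \<phi> ` U"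
    and sec: "\<And>y. y \<in> T \<Longrightarrow> F (inv_into U \<phi> (s y)) = inv_into V \<psi> y" and sp: "s (\<psi> (F p)) = \<phi> p"
    by (rule submersion_local_section[OF A B F(1) sub U V]) (rule that)
  define Q where "Q = \<phi> ` (U \<inter> (k \<circ> F) -` X)"
  have Q: "open Q" unfolding Q_def
    using chart_open_map[OF A U(1), of "U \<inter> (k \<circ> F) -` X"] chart_open[OF A U(1)]
      smooth_map_open_vimage[OF kF chart_open[OF C X(1)]] by auto
  \<comment> \<open>On \<open>T2\<close> the section stays where the chart expression of \<open>k \<circ> F\<close> is defined.\<close>
  define T2 where "T2 = T \<inter> s -` Q"
  have T2: "open T2" unfolding T2_def
    using continuous_on_open_vimage[OF T(1), of s] smooth_on_imp_continuous[OF T(4)] Q by (simp add: Int_commute)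
  have T2Q: "s y \<in> Q" "y \<in> T" if "y \<in> T2" for y using that by (auto simp: T2_def)
  have kX: "k (inv_into V \<psi> y) \<in> X" if y: "y \<in> T2" for y
  proof -
    obtain q where "q \<in> U" "k (F q) \<in> X" "s y = \<phi> q" using T2Q(1)[OF y] by (auto simp: Q_def)
    then show ?thesis using sec[OF T2Q(2)[OF y]] chart_inverse[OF A U(1)] by metis
  qed
  define W where "W = V \<inter> \<psi> -` T2"
  have W: "open W" unfolding W_def by (rule chart_open_preimage[OF B V(1) T2])
  have "\<phi> p \<in> Q" using U p X by (auto simp: Q_def)
  then have xW: "x \<in> W" using V T(3) p by (auto simp: W_def T2_def sp)
  have WT: "\<psi> ` W = T2" using T(2) by (auto simp: W_def T2_def)
  have sQ: "smooth_on Q (\<omega> \<circ> (k \<circ> F) \<circ> inv_into U \<phi>)"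
    unfolding Q_def by (rule smooth_mapD(2)[OF kF U(1) X(1)])
  have "smooth_on T2 (\<lambda>y. (\<omega> \<circ> (k \<circ> F) \<circ> inv_into U \<phi>) (s y))"
    by (rule smooth_on_compose[OF T2 Q smooth_on_subset[OF T(4)] sQ]) (auto simp: T2_def)
  then have "smooth_on T2 (\<omega> \<circ> k \<circ> inv_into V \<psi>)"
    by (rule smooth_on_cong[OF T2, THEN iffD1, rotated]) (simp add: sec T2Q)
  moreover have "k ` W \<subseteq> X"
  proof
    fix z assume "z \<in> k ` W"
    then obtain r where "r \<in> W" "z = k r" by auto
    then show "z \<in> X" using kX[of "\<psi> r"] chart_inverse[OF B V(1), of r] by (auto simp: W_def)
  qed
  ultimately show "\<exists>V \<psi> X \<omega> W. (V, \<psi>) \<in> B \<and> (X, \<omega>) \<in> C \<and> open W \<and> x \<in> W \<and> W \<subseteq> V \<and> k ` W \<subseteq> X \<and>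
      smooth_on (\<psi> ` W) (\<omega> \<circ> k \<circ> inv_into V \<psi>)"
    using V X W xW WT by (intro exI[of _ V] exI[of _ \<psi>] exI[of _ X] exI[of _ \<omega>] exI[of _ W]) (auto simp: W_def)
qed

text \<open>
  The map $x \<mapsto> (L x, k \<bullet> x)$ is surjective between spaces of equal dimension, hence injective, and it
  takes equal values at \<open>a\<close> and at the orthogonal projection of \<open>a\<close> to the line of \<open>k\<close>.
\<close>

lemma kernel_line:
  fixes L :: "'a::euclidean_space \<Rightarrow> 'b::euclidean_space"
  assumes L: "linear L" "surj L" and dim: "DIM('a) = DIM('b) + 1"
    and k: "L k = 0" "k \<noteq> 0" and a: "L a = 0"
  obtains c where "a = c *\<^sub>R k"
proof -
  define T where "T x = (L x, k \<bullet> x)" for x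
  have linT: "linear T"
    by (rule linearI) (simp_all add: T_def linear_add[OF L(1)] linear_scale[OF L(1)] inner_add_right)
  have "surj T"
  proof (rule surjI[where f = "\<lambda>z. SOME x. T x = z"])
    fix z :: "'b \<times> real"
    obtain x0 where x0: "L x0 = fst z" using L(2) by (metis surjD)
    define t where "t = (snd z - k \<bullet> x0) / (k \<bullet> k)"
    have "T (x0 + t *\<^sub>R k) = z"
      using k x0 by (simp add: T_def linear_add[OF L(1)] linear_scale[OF L(1)] inner_add_right t_def prod_eq_iff)
    then show "T (SOME x. T x = z) = z" by (rule someI)
  qed
  then obtain G where G: "linear G" "T \<circ> G = id"
    using linear_surjective_right_inverse[OF linT] by auto
  have "inj G" using G(2) by (metis comp_id comp_assoc inj_on_id inj_on_imageI2)
  then have "dim (range G) = dim (UNIV :: ('b \<times> real) set)"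
    by (intro dim_image_eq G(1)) (auto intro: inj_on_subset)
  then have "dim (range G) = DIM('a)" using dim by simp
  then have "range G = UNIV"
    using linear_subspace_image[OF G(1) subspace_UNIV] by (metis dim_eq_full span_eq_iff)
  then obtain u where u: "a = G u" by (metis surjD)
  obtain w where w: "((k \<bullet> a) / (k \<bullet> k)) *\<^sub>R k = G w" using \<open>range G = UNIV\<close> by (metis surjD)
  have "T a = T (((k \<bullet> a) / (k \<bullet> k)) *\<^sub>R k)"
    using k a by (simp add: T_def linear_scale[OF L(1)])
  then have "u = w" using G(2) u w by (metis comp_apply id_apply)
  then show ?thesis using that u w by metis
qed

lemma vertical_line:
  fixes A :: "('e::t2_space, real^3) chart set" and B :: "('m::t2_space, real^2) chart set"
  assumes A: "smooth_atlas A" and B: "smooth_atlas B" and F: "smooth_map A B F"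
    and sub: "differential B F ` tangent_space A p = tangent_space B (F p)"
    and k: "k \<in> vertical A B F p" "k \<noteq> (\<lambda>f. 0)" and v: "v \<in> vertical A B F p"
  obtains c where "v = (\<lambda>f. c * k f)"
proof -
  obtain U \<phi> where U: "(U, \<phi>) \<in> A" "p \<in> U" using atlas_chart[OF A] .
  obtain V \<psi> where V: "(V, \<psi>) \<in> B" "F p \<in> V" using atlas_chart[OF B] .
  let ?D = "frechet_derivative (\<psi> \<circ> F \<circ> inv_into U \<phi>) (at (\<phi> p))"
  note dF = differential_chart_vector[OF A B F U V]
  have D: "linear ?D"
    by (rule has_derivative_linear[OF chart_representation_has_derivative[OF A B F U V]])
  have cv0: "chart_vector A (U, \<phi>) p 0 = (\<lambda>f. 0)" "chart_vector B (V, \<psi>) (F p) 0 = (\<lambda>f. 0)"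
    using chart_vector_lincomb[OF A U, of 0 0 0 0] chart_vector_lincomb[OF B V, of 0 0 0 0] by simp_all
  have "surj ?D" by (rule submersion_chart_surj[OF A B F sub U V])
  obtain x where x: "k = chart_vector A (U, \<phi>) p x"
    using tangent_chart_vector[OF A U] k(1) by (auto simp: vertical_def)
  obtain a where a: "v = chart_vector A (U, \<phi>) p a"
    using tangent_chart_vector[OF A U] v by (auto simp: vertical_def)
  have "chart_vector B (V, \<psi>) (F p) (?D x) = chart_vector B (V, \<psi>) (F p) 0"
    using k(1) dF[of x] x cv0 by (simp add: vertical_def)
  then have Dx: "?D x = 0" by (rule chart_vector_inj[OF B V])
  have "chart_vector B (V, \<psi>) (F p) (?D a) = chart_vector B (V, \<psi>) (F p) 0"
    using v dF[of a] a cv0 by (simp add: vertical_def)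
  then have Da: "?D a = 0" by (rule chart_vector_inj[OF B V])
  have "x \<noteq> 0" using k(2) x cv0 by auto
  obtain c where "a = c *\<^sub>R x"
    by (rule kernel_line[OF D \<open>surj ?D\<close> _ Dx \<open>x \<noteq> 0\<close> Da]) (simp, rule that)
  then have "v = (\<lambda>f. c * k f)"
    using chart_vector_lincomb[OF A U, of c x 0 x] a x by simp
  then show ?thesis by (rule that)
qed

section \<open>Riemannian metrics and isometries\<close>

context
  fixes A :: "('e::topological_space, 'b::euclidean_space) chart set" and g :: "'e metric"
  assumes g: "riemannian_metric A g"
begin

lemma metric_lincomb_left:
  assumes "u \<in> tangent_space A p" "v \<in> tangent_space A p" "w \<in> tangent_space A p"
  shows "g p (\<lambda>f. a * u f + b * v f) w = a * g p u w + b * g p v w"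
proof -
  have "\<forall>p. \<forall>u\<in>tangent_space A p. \<forall>v\<in>tangent_space A p. \<forall>w\<in>tangent_space A p. \<forall>a b.
        g p (\<lambda>f. a * u f + b * v f) w = a * g p u w + b * g p v w"
    using g unfolding riemannian_metric_def by (elim conjE)
  then show ?thesis using assms by simp
qed

lemma metric_sym:
  assumes "u \<in> tangent_space A p" "v \<in> tangent_space A p"
  shows "g p u v = g p v u"
proof -
  have "\<forall>p. \<forall>u\<in>tangent_space A p. \<forall>v\<in>tangent_space A p. g p u v = g p v u"
    using g unfolding riemannian_metric_def by (elim conjE)
  then show ?thesis using assms by blast
qed

lemma metric_pos:
  assumes "u \<in> tangent_space A p" "u \<noteq> (\<lambda>f. 0)"
  shows "0 < g p u u"
proof -
  have "\<forall>p. \<forall>u\<in>tangent_space A p. u \<noteq> (\<lambda>f. 0) \<longrightarrow> 0 < g p u u"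
    using g unfolding riemannian_metric_def by (elim conjE)
  then show ?thesis using assms by blast
qed

lemma metric_smooth:
  assumes "smooth_field A X" "smooth_field A Y"
  shows "smooth_fun A (\<lambda>p. g p (X p) (Y p))"
proof -
  have "\<forall>X Y. smooth_field A X \<longrightarrow> smooth_field A Y \<longrightarrow> smooth_fun A (\<lambda>p. g p (X p) (Y p))"
    using g unfolding riemannian_metric_def by (elim conjE)
  then show ?thesis using assms by blast
qed

lemma metric_lincomb_right:
  assumes "u \<in> tangent_space A p" "v \<in> tangent_space A p" "w \<in> tangent_space A p"
  shows "g p w (\<lambda>f. a * u f + b * v f) = a * g p w u + b * g p w v"
  using metric_lincomb_left[OF assms] metric_sym assms lincomb_tangent[OF assms(1,2)] by metis

lemma metric_scale_left:
  "u \<in> tangent_space A p \<Longrightarrow> w \<in> tangent_space A p \<Longrightarrow> g p (\<lambda>f. a * u f) w = a * g p u w"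
  using metric_lincomb_left[of u p u w a 0] by simp

lemma metric_scale_right:
  "u \<in> tangent_space A p \<Longrightarrow> w \<in> tangent_space A p \<Longrightarrow> g p w (\<lambda>f. a * u f) = a * g p w u"
  using metric_lincomb_right[of u p u w a 0] by simp

text \<open>
  The factors \<open>1\<close> keep the sums in the form of the linear combinations for which bilinearity is stated.
\<close>

lemma metric_polarization:
  assumes "u \<in> tangent_space A p" "v \<in> tangent_space A p"
  shows "g p (\<lambda>f. 1 * u f + 1 * v f) (\<lambda>f. 1 * u f + 1 * v f) = g p u u + 2 * g p u v + g p v v"
  using metric_lincomb_left[OF assms lincomb_tangent[OF assms, of 1 1], of 1 1]
    metric_lincomb_right[OF assms assms(1), of 1 1] metric_lincomb_right[OF assms assms(2), of 1 1]
    metric_sym[OF assms] by simp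

end

lemma riemannian_isometryD:
  assumes "riemannian_isometry A g B h F"
  shows "bij F" "smooth_map A B F" "smooth_map B A (inv F)"
    "u \<in> tangent_space A p \<Longrightarrow> v \<in> tangent_space A p \<Longrightarrow>
      h (F p) (differential B F u) (differential B F v) = g p u v"
  using assms unfolding riemannian_isometry_def by simp_all

lemma differential_inverse:
  assumes A: "smooth_atlas A" and B: "smooth_atlas B" and F: "bij F" "smooth_map A B F" "smooth_map B A (inv F)"
  shows "v \<in> tangent_space A p \<Longrightarrow> differential A (inv F) (differential B F v) = v"
    and "w \<in> tangent_space B q \<Longrightarrow> differential B F (differential A (inv F) w) = w"
  using differential_compose[OF B A F(3), of F v] differential_compose[OF A B F(2), of "inv F" w]
    F(1) differential_id[of v A p] differential_id[of w B q]
  by (simp_all add: bij_is_inj bij_is_surj surj_iff[symmetric] inj_iff[symmetric])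
    (simp_all add: bij_def surj_iff inj_iff)

lemma riemannian_isometry_inverse:
  assumes A: "smooth_atlas A" and B: "smooth_atlas B" and F: "riemannian_isometry A g B h F"
  shows "riemannian_isometry B h A g (inv F)"
  unfolding riemannian_isometry_def
proof (intro conjI allI ballI)
  note F' = riemannian_isometryD[OF F]
  show "bij (inv F)" using F'(1) by (rule bij_imp_bij_inv)
  show "smooth_map B A (inv F)" by (rule F'(3))
  show "smooth_map A B (inv (inv F))" using F'(1,2) by (simp add: inv_inv_eq)
  fix q u v assume u: "u \<in> tangent_space B q" and v: "v \<in> tangent_space B q"
  have q: "F (inv F q) = q" using F'(1) by (simp add: bij_is_surj surj_f_inv_f)
  show "g (inv F q) (differential A (inv F) u) (differential A (inv F) v) = h q u v"
    using F'(4)[OF differential_tangent[OF B A F'(3) u] differential_tangent[OF B A F'(3) v]]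
    by (simp add: differential_inverse(2)[OF A B F'(1-3) u] differential_inverse(2)[OF A B F'(1-3) v] q)
qed

section \<open>Killing isometries and the fibers\<close>

text \<open>
  Encoding the two cases in the definition of a Killing isometry as a real number \<open>\<epsilon>\<close> makes it possible
  to treat them simultaneously.
\<close>

lemma killing_isometry_sign:
  assumes "killing_isometry A g \<xi> F"
  obtains \<epsilon> :: real where "\<epsilon> * \<epsilon> = 1" "\<And>p. differential A F (\<xi> p) = (\<lambda>u. \<epsilon> * \<xi> (F p) u)"
proof -
  consider "\<forall>p. differential A F (\<xi> p) = \<xi> (F p)" | "\<forall>p. differential A F (\<xi> p) = (\<lambda>u. - \<xi> (F p) u)"
    using assms unfolding killing_isometry_def by auto
  then show ?thesis
    by cases (use that[of 1] that[of "-1"] in simp_all)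
qed

lemma killing_isometry_inverse:
  assumes A: "smooth_atlas A" and F: "killing_isometry A g \<xi> F" and \<xi>: "\<And>p. \<xi> p \<in> tangent_space A p"
  shows "killing_isometry A g \<xi> (inv F)"
proof -
  have iso: "riemannian_isometry A g A g F" using F by (simp add: killing_isometry_def)
  note F' = riemannian_isometryD[OF iso]
  have F_inv: "F (inv F q) = q" for q using F'(1) by (simp add: bij_is_surj surj_f_inv_f)
  have dinv: "differential A (inv F) (differential A F (\<xi> (inv F q))) = \<xi> (inv F q)" for q
    by (rule differential_inverse(1)[OF A A F'(1-3) \<xi>])
  consider "\<forall>p. differential A F (\<xi> p) = \<xi> (F p)" | "\<forall>p. differential A F (\<xi> p) = (\<lambda>u. - \<xi> (F p) u)"
    using F unfolding killing_isometry_def by auto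
  then have "(\<forall>p. differential A (inv F) (\<xi> p) = \<xi> (inv F p)) \<or>
      (\<forall>p. differential A (inv F) (\<xi> p) = (\<lambda>f. - \<xi> (inv F p) f))"
  proof cases
    case 1
    then show ?thesis using dinv F_inv by simp
  next
    case 2
    have "differential A (inv F) (\<xi> q) = (\<lambda>f. - \<xi> (inv F q) f)" for q
    proof -
      have "(\<lambda>u. - differential A (inv F) (\<xi> q) u) = \<xi> (inv F q)"
        using dinv[of q] spec[OF 2, of "inv F q"] by (simp add: F_inv differential_minus)
      then show ?thesis by (metis (no_types, lifting) add.inverse_inverse ext)
    qed
    then show ?thesis by blast
  qed
  then show ?thesis
    using riemannian_isometry_inverse[OF A A iso] by (simp add: killing_isometry_def)
qed

lemma smooth_map_real_scale: "smooth_map std_atlas std_atlas (\<lambda>t :: real. c * t)"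
proof (rule smooth_map_localI[OF smooth_atlas_std smooth_atlas_std])
  fix t :: real
  have "inv_into UNIV (id :: real \<Rightarrow> real) = id" by (rule inv_id)
  moreover have "smooth_on UNIV (\<lambda>t :: real. c * t)"
    by (rule smooth_on_linear[OF open_UNIV bounded_linear_mult_right])
  ultimately show "\<exists>U \<phi> V \<psi> W. (U, \<phi>) \<in> std_atlas \<and> (V, \<psi>) \<in> std_atlas \<and> open W \<and> t \<in> W \<and> W \<subseteq> U \<and>
      (*) c ` W \<subseteq> V \<and> smooth_on (\<phi> ` W) (\<psi> \<circ> (*) c \<circ> inv_into U \<phi>)"
    by (intro exI[of _ UNIV] exI[of _ id] exI[of _ UNIV] exI[of _ id] exI[of _ UNIV]) (simp add: std_atlas_def)
qed

text \<open>
  The parameter is multiplied by \<open>\<epsilon>\<close> so that the two signs, one from the reparametrization and one from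
  the differential of \<open>F\<close>, cancel in the velocity.
\<close>

lemma integral_curve_image:
  assumes A: "smooth_atlas A" and F: "smooth_map A A F" and \<epsilon>: "\<epsilon> * \<epsilon> = 1"
    and dF: "\<And>p. differential A F (\<xi> p) = (\<lambda>u. \<epsilon> * \<xi> (F p) u)" and \<gamma>: "integral_curve A \<xi> \<gamma>"
  shows "integral_curve A \<xi> (\<lambda>t. F (\<gamma> (\<epsilon> * t)))"
  unfolding integral_curve_def
proof (intro conjI allI impI)
  have \<gamma>': "smooth_map std_atlas A \<gamma>"
    "\<And>f t. smooth_fun A f \<Longrightarrow> ((\<lambda>s. f (\<gamma> s)) has_real_derivative \<xi> (\<gamma> t) f) (at t)"
    using \<gamma> by (simp_all add: integral_curve_def)
  have "smooth_map std_atlas A (F \<circ> (\<gamma> \<circ> (\<lambda>t. \<epsilon> * t)))"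
    by (intro smooth_map_compose[OF smooth_atlas_std A A _ F]
        smooth_map_compose[OF smooth_atlas_std smooth_atlas_std A smooth_map_real_scale \<gamma>'(1)])
  then show "smooth_map std_atlas A (\<lambda>t. F (\<gamma> (\<epsilon> * t)))" by (simp add: o_def)
  fix f t assume f: "smooth_fun A f"
  have "\<epsilon> * \<xi> (\<gamma> (\<epsilon> * t)) (f \<circ> F) = (\<epsilon> * \<epsilon>) * \<xi> (F (\<gamma> (\<epsilon> * t))) f"
    using fun_cong[OF dF[of "\<gamma> (\<epsilon> * t)"], of f] by (simp add: differential_apply[OF f])
  then have e: "\<epsilon> * \<xi> (\<gamma> (\<epsilon> * t)) (f \<circ> F) = \<xi> (F (\<gamma> (\<epsilon> * t))) f" by (simp add: \<epsilon>)
  have "((\<lambda>s. (f \<circ> F) (\<gamma> (\<epsilon> * s))) has_real_derivative \<xi> (\<gamma> (\<epsilon> * t)) (f \<circ> F) * \<epsilon>) (at t)"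
    by (rule DERIV_chain2[OF \<gamma>'(2)[OF smooth_fun_compose[OF A A F f]]]) (auto intro!: derivative_eq_intros)
  then show "((\<lambda>s. f (F (\<gamma> (\<epsilon> * s)))) has_real_derivative \<xi> (F (\<gamma> (\<epsilon> * t))) f) (at t)"
    using e by (simp add: mult.commute)
qed

lemma killing_submersionD:
  assumes "killing_submersion A g B h \<pi> \<xi>"
  shows "smooth_atlas A" "riemannian_metric A g" "smooth_atlas B" "riemannian_metric B h"
    "smooth_map A B \<pi>" "surj \<pi>" "smooth_field A \<xi>"
    "\<And>p. differential B \<pi> ` tangent_space A p = tangent_space B (\<pi> p)"
    "\<And>p v. v \<in> horizontal A g B \<pi> p \<Longrightarrow> h (\<pi> p) (differential B \<pi> v) (differential B \<pi> v) = g p v v"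
    "\<And>p. \<xi> p \<in> vertical A B \<pi> p" "\<And>p. g p (\<xi> p) (\<xi> p) = 1"
    "range (\<lambda>x. \<pi> -` {x}) = {range \<gamma> |\<gamma>. integral_curve A \<xi> \<gamma>}"
  using assms unfolding killing_submersion_def riemannian_submersion_def killing_field_def by simp_all

text \<open>
  The fiber through \<open>x\<close> is an integral curve, its image under \<open>F\<close> is again an integral curve, and this
  image is contained in a single fiber.
\<close>

lemma killing_isometry_maps_fibers:
  assumes K: "killing_submersion A g B h \<pi> \<xi>" and F: "killing_isometry A g \<xi> F" and xy: "\<pi> x = \<pi> y"
  shows "\<pi> (F x) = \<pi> (F y)"
proof -
  note D = killing_submersionD[OF K]
  obtain \<epsilon> where \<epsilon>: "\<epsilon> * \<epsilon> = 1" "\<And>p. differential A F (\<xi> p) = (\<lambda>u. \<epsilon> * \<xi> (F p) u)"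
    by (rule killing_isometry_sign[OF F]) (rule that)
  have sF: "smooth_map A A F" using F by (simp add: killing_isometry_def riemannian_isometry_def)
  have "\<pi> -` {\<pi> x} \<in> {range \<gamma> |\<gamma>. integral_curve A \<xi> \<gamma>}" unfolding D(12)[symmetric] by simp
  then obtain \<gamma> where \<gamma>: "integral_curve A \<xi> \<gamma>" "\<pi> -` {\<pi> x} = range \<gamma>" by auto
  have "x \<in> range \<gamma>" "y \<in> range \<gamma>" unfolding \<gamma>(2)[symmetric] using xy by simp_all
  then obtain s t where st: "x = \<gamma> s" "y = \<gamma> t" by auto
  let ?\<gamma> = "\<lambda>t. F (\<gamma> (\<epsilon> * t))"
  have "range ?\<gamma> \<in> range (\<lambda>x. \<pi> -` {x})"
    unfolding D(12) using integral_curve_image[OF D(1) sF \<epsilon> \<gamma>(1)] by blast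
  then obtain z where z: "range ?\<gamma> = \<pi> -` {z}" by auto
  have "F x = ?\<gamma> (\<epsilon> * s)" "F y = ?\<gamma> (\<epsilon> * t)" using \<epsilon>(1) by (simp_all add: st mult.assoc[symmetric])
  then have "F x \<in> \<pi> -` {z}" "F y \<in> \<pi> -` {z}" unfolding z[symmetric] by blast+
  then show ?thesis by simp
qed

text \<open>
  Applied to a Killing isometry and to its inverse, this provides the induced isometry of the base
  and its inverse.
\<close>

lemma ex_smooth_projection:
  assumes K: "killing_submersion A g B h \<pi> \<xi>" and F: "killing_isometry A g \<xi> F"
  obtains k where "k \<circ> \<pi> = \<pi> \<circ> F" "smooth_map B B k"
proof -
  note D = killing_submersionD[OF K]
  have sF: "smooth_map A A F" using F by (simp add: killing_isometry_def riemannian_isometry_def)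
  define k where "k x = \<pi> (F (inv \<pi> x))" for x
  have k: "k \<circ> \<pi> = \<pi> \<circ> F"
  proof
    fix p
    show "(k \<circ> \<pi>) p = (\<pi> \<circ> F) p"
      using killing_isometry_maps_fibers[OF K F, of "inv \<pi> (\<pi> p)" p] D(6) by (simp add: k_def surj_f_inv_f)
  qed
  have "smooth_map B B k"
    by (rule smooth_map_descend[OF D(1,3,3,5,6,8)]) (simp add: k smooth_map_compose[OF D(1,1,3) sF D(5)])
  then show ?thesis using k by (rule that[rotated])
qed

section \<open>Horizontal lifts\<close>

lemma horizontal_tangent: "v \<in> horizontal A g B \<pi> p \<Longrightarrow> v \<in> tangent_space A p"
  by (simp add: horizontal_def)

lemma horizontal_add:
  assumes g: "riemannian_metric A g" and "u \<in> horizontal A g B \<pi> p" "v \<in> horizontal A g B \<pi> p"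
  shows "(\<lambda>f. a * u f + b * v f) \<in> horizontal A g B \<pi> p"
  using assms(2,3) metric_lincomb_left[OF g, of u p v]
  by (simp add: horizontal_def vertical_def lincomb_tangent)

lemma riemannian_submersion_inner:
  assumes K: "killing_submersion A g B h \<pi> \<xi>"
    and u: "u \<in> horizontal A g B \<pi> p" and v: "v \<in> horizontal A g B \<pi> p"
  shows "h (\<pi> p) (differential B \<pi> u) (differential B \<pi> v) = g p u v"
proof -
  note D = killing_submersionD[OF K]
  have T: "u \<in> tangent_space A p" "v \<in> tangent_space A p" using u v by (simp_all add: horizontal_tangent)
  have T': "differential B \<pi> u \<in> tangent_space B (\<pi> p)" "differential B \<pi> v \<in> tangent_space B (\<pi> p)"
    using T by (simp_all add: differential_tangent[OF D(1,3,5)])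
  show ?thesis
    using D(9)[OF u] D(9)[OF v] D(9)[OF horizontal_add[OF D(2) u v, of 1 1]]
      metric_polarization[OF D(2) T] metric_polarization[OF D(4) T']
    by (simp only: differential_lincomb)
qed

text \<open>
  For reasons of dimension the vertical space is spanned by the unit vector \<open>\<xi> p\<close>, so any lift becomes
  horizontal after subtracting its \<open>\<xi>\<close>-component.
\<close>

lemma ex_horizontal_lift:
  fixes A :: "('e::{t2_space, second_countable_topology}, real^3) chart set"
    and B :: "('m::{t2_space, second_countable_topology}, real^2) chart set"
  assumes K: "killing_submersion A g B h \<pi> \<xi>" and w: "w \<in> tangent_space B (\<pi> p)"
  obtains v where "v \<in> horizontal A g B \<pi> p" "differential B \<pi> v = w"
proof -
  note D = killing_submersionD[OF K]
  have "w \<in> differential B \<pi> ` tangent_space A p" unfolding D(8) by (rule w)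
  then obtain u where u: "u \<in> tangent_space A p" "w = differential B \<pi> u" by auto
  have \<xi>: "\<xi> p \<in> tangent_space A p" "differential B \<pi> (\<xi> p) = (\<lambda>f. 0)"
    using D(10)[of p] by (simp_all add: vertical_def)
  have "\<xi> p \<noteq> (\<lambda>f. 0)"
    using D(11)[of p] metric_scale_left[OF D(2) \<xi>(1) \<xi>(1), of 0] by auto
  define v where "v = (\<lambda>f. 1 * u f + (- g p u (\<xi> p)) * \<xi> p f)"
  have v: "v \<in> tangent_space A p" unfolding v_def by (rule lincomb_tangent[OF u(1) \<xi>(1)])
  have v\<xi>: "g p v (\<xi> p) = 0"
    unfolding v_def using metric_lincomb_left[OF D(2) u(1) \<xi>(1) \<xi>(1), of 1 "- g p u (\<xi> p)"] D(11)[of p] by simp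
  have "g p v x = 0" if x: "x \<in> vertical A B \<pi> p" for x
  proof -
    obtain c where "x = (\<lambda>f. c * \<xi> p f)"
      by (rule vertical_line[OF D(1,3,5,8,10) \<open>\<xi> p \<noteq> (\<lambda>f. 0)\<close> x]) (rule that)
    then show ?thesis using metric_scale_right[OF D(2) \<xi>(1) v] v\<xi> by simp
  qed
  then have "v \<in> horizontal A g B \<pi> p" using v by (simp add: horizontal_def)
  moreover have "differential B \<pi> v = w"
    unfolding v_def differential_lincomb using u(2) \<xi>(2) by simp
  ultimately show ?thesis by (rule that)
qed

section \<open>The induced isometry of the base\<close>

text \<open>
  Lift tangent vectors of the base horizontally. The projection preserves their inner products before
  and after applying the differential of \<open>F\<close>, because the latter maps horizontal vectors to horizontal
  vectors: a vertical vector at \<open>F p\<close> is the image of a vertical vector at \<open>p\<close>.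
\<close>

theorem ex_induced_isometry:
  fixes A :: "('e::{t2_space, second_countable_topology}, real^3) chart set"
    and B :: "('m::{t2_space, second_countable_topology}, real^2) chart set"
  assumes K: "killing_submersion A g B h \<pi> \<xi>" and F: "killing_isometry A g \<xi> F"
  obtains k where "riemannian_isometry B h B h k" "\<pi> \<circ> F = k \<circ> \<pi>"
proof -
  note D = killing_submersionD[OF K]
  have iso: "riemannian_isometry A g A g F" using F by (simp add: killing_isometry_def)
  note F' = riemannian_isometryD[OF iso]
  have F_inv: "F (inv F q) = q" "inv F (F q) = q" for q
    using F'(1) by (simp_all add: bij_is_surj surj_f_inv_f bij_is_inj)
  have Finv: "killing_isometry A g \<xi> (inv F)"
    by (rule killing_isometry_inverse[OF D(1) F smooth_fieldD(1)[OF D(7)]])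
  obtain k where k: "k \<circ> \<pi> = \<pi> \<circ> F" "smooth_map B B k"
    by (rule ex_smooth_projection[OF K F]) (rule that)
  obtain l where l: "l \<circ> \<pi> = \<pi> \<circ> inv F" "smooth_map B B l"
    by (rule ex_smooth_projection[OF K Finv]) (rule that)
  have kp: "k (\<pi> p) = \<pi> (F p)" and lp: "l (\<pi> p) = \<pi> (inv F p)" for p
    using fun_cong[OF k(1), of p] fun_cong[OF l(1), of p] by simp_all
  have kl: "k (l x) = x" and lk: "l (k x) = x" for x
  proof -
    obtain p where p: "x = \<pi> p" using D(6) by (metis surjD)
    show "k (l x) = x" "l (k x) = x" by (simp_all add: p kp lp F_inv)
  qed
  have "bij k" by (rule bijI') (metis lk, metis kl)
  have "inv k = l" by (rule inv_equality) (simp_all add: kl lk)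
  have d\<pi>F: "differential B \<pi> (differential A F v) = differential B k (differential B \<pi> v)"
    and d\<pi>F': "differential B \<pi> (differential A (inv F) v) = differential B l (differential B \<pi> v)" for v
    by (simp_all add: differential_compose[OF D(1,3,5)] differential_compose[OF D(3,3) k(2)]
        differential_compose[OF D(3,3) l(2)] k(1) l(1))
  have hor: "differential A F v \<in> horizontal A g B \<pi> (F p)" if v: "v \<in> horizontal A g B \<pi> p" for v p
    unfolding horizontal_def mem_Collect_eq
  proof (intro conjI ballI)
    have vT: "v \<in> tangent_space A p" by (rule horizontal_tangent[OF v])
    show "differential A F v \<in> tangent_space A (F p)" by (rule differential_tangent[OF D(1,1) F'(2) vT])
    fix w assume w: "w \<in> vertical A B \<pi> (F p)"
    then have wT: "w \<in> tangent_space A (F p)" and w0: "differential B \<pi> w = (\<lambda>f. 0)" by (simp_all add: vertical_def)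
    define w' where "w' = differential A (inv F) w"
    have w'T: "w' \<in> tangent_space A p"
      using differential_tangent[OF D(1,1) F'(3) wT] by (simp add: w'_def F_inv)
    have "differential B l (\<lambda>f. 0) = (\<lambda>f. 0)" by (auto simp: differential_def)
    then have "w' \<in> vertical A B \<pi> p" using w'T by (simp add: vertical_def w'_def d\<pi>F' w0)
    then have "g p v w' = 0" using v by (simp add: horizontal_def)
    moreover have "differential A F w' = w"
      unfolding w'_def by (rule differential_inverse(2)[OF D(1,1) F'(1-3) wT])
    ultimately show "g (F p) (differential A F v) w = 0" using F'(4)[OF vT w'T] by simp
  qed
  have "riemannian_isometry B h B h k"
    unfolding riemannian_isometry_def
  proof (intro conjI allI ballI)
    show "bij k" "smooth_map B B k" "smooth_map B B (inv k)" by (fact \<open>bij k\<close>, fact k(2), simp add: \<open>inv k = l\<close> l(2))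
    fix x u v assume u: "u \<in> tangent_space B x" and v: "v \<in> tangent_space B x"
    obtain p where p: "x = \<pi> p" using D(6) by (metis surjD)
    obtain u' where u': "u' \<in> horizontal A g B \<pi> p" "differential B \<pi> u' = u"
      by (rule ex_horizontal_lift[OF K u[unfolded p]]) (rule that)
    obtain v' where v': "v' \<in> horizontal A g B \<pi> p" "differential B \<pi> v' = v"
      by (rule ex_horizontal_lift[OF K v[unfolded p]]) (rule that)
    have "h (k x) (differential B k u) (differential B k v) =
        h (\<pi> (F p)) (differential B \<pi> (differential A F u')) (differential B \<pi> (differential A F v'))"
      by (simp add: p kp d\<pi>F u'(2) v'(2))
    also have "\<dots> = g (F p) (differential A F u') (differential A F v')"
      by (rule riemannian_submersion_inner[OF K hor[OF u'(1)] hor[OF v'(1)]])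
    also have "\<dots> = g p u' v'"
      by (rule F'(4)[OF horizontal_tangent[OF u'(1)] horizontal_tangent[OF v'(1)]])
    also have "\<dots> = h x u v"
      using riemannian_submersion_inner[OF K u'(1) v'(1)] by (simp add: p u'(2) v'(2))
    finally show "h (k x) (differential B k u) (differential B k v) = h x u v" .
  qed
  then show ?thesis by (rule that[OF _ k(1)[symmetric]])
qed

section \<open>Orthonormal frames\<close>

lemma sum_times_delta:
  fixes c :: "'i \<Rightarrow> real"
  assumes "finite I"
  shows "(\<Sum>i\<in>I. c i * (if i = j then 1 else 0)) = (if j \<in> I then c j else 0)"
    and "(\<Sum>i\<in>I. c i * (if j = i then 1 else 0)) = (if j \<in> I then c j else 0)"
proof -
  have *: "(\<lambda>i. c i * (if i = j then 1 else 0)) = (\<lambda>i. if i = j then c i else 0)"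
    "(\<lambda>i. c i * (if j = i then 1 else 0)) = (\<lambda>i. if j = i then c i else 0)" by auto
  show "(\<Sum>i\<in>I. c i * (if i = j then 1 else 0)) = (if j \<in> I then c j else 0)"
    and "(\<Sum>i\<in>I. c i * (if j = i then 1 else 0)) = (if j \<in> I then c j else 0)"
    unfolding * using assms by simp_all
qed

text \<open>
  Gram-Schmidt orthonormalization for an arbitrary inner product. Since the rows are indexed by a
  type without order, the vectors are constructed by induction over the finite subsets of the index
  type.
\<close>

lemma ex_orthonormal_matrix:
  fixes b :: "real^'n \<Rightarrow> real^'n \<Rightarrow> real"
  assumes lin: "\<And>y. linear (\<lambda>x. b x y)" and sym: "\<And>x y. b x y = b y x" and pos: "\<And>x. x \<noteq> 0 \<Longrightarrow> 0 < b x x"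
  obtains M :: "real^'n^'n" where "\<And>i j. b (M $ i) (M $ j) = (if i = j then 1 else 0)" "det M \<noteq> 0"
proof -
  have scale: "b (c *\<^sub>R x) y = c * b x y" and add: "b (x + x') y = b x y + b x' y"
    and diff: "b (x - x') y = b x y - b x' y" for c x x' y
    using linear_scale[OF lin[of y]] linear_add[OF lin[of y]] linear_diff[OF lin[of y]] by simp_all
  have sum: "b (\<Sum>i\<in>I. f i) y = (\<Sum>i\<in>I. b (f i) y)" for f :: "'n \<Rightarrow> real^'n" and I y
    using linear_sum[OF lin[of y]] by simp
  have "\<exists>e :: 'n \<Rightarrow> real^'n. \<forall>i\<in>I. \<forall>j\<in>I. b (e i) (e j) = (if i = j then 1 else 0)" for I :: "'n set"
  proof (induction I rule: finite_induct[OF finite])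
    case 1 show ?case by simp
  next
    case (2 k I)
    from 2(3) obtain e :: "'n \<Rightarrow> real^'n" where e0: "\<forall>i\<in>I. \<forall>j\<in>I. b (e i) (e j) = (if i = j then 1 else 0)" ..
    have e: "b (e i) (e j) = (if i = j then 1 else 0)" if "i \<in> I" "j \<in> I" for i j
      using bspec[OF bspec[OF e0 that(1)] that(2)] .
    have kI: "k \<notin> I" using 2(2) .
    have "card I < card (insert k I)" using 2(1,2) by simp
    also have "\<dots> \<le> CARD('n)" by (rule card_mono) auto
    finally have "dim (e ` I) < DIM(real^'n)"
      using dim_le_card'[of "e ` I"] card_image_le[of I e] 2(1) by simp
    then have "span (e ` I) \<noteq> UNIV" using dim_eq_full[of "e ` I"] by (intro notI) simp
    then obtain z where z: "z \<notin> span (e ` I)" by blast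
    define z' where "z' = z - (\<Sum>i\<in>I. b z (e i) *\<^sub>R e i)"
    have "(\<Sum>i\<in>I. b z (e i) *\<^sub>R e i) \<in> span (e ` I)"
      by (intro span_sum span_scale span_base) simp
    then have "z' \<noteq> 0" using z by (auto simp: z'_def)
    have z'e: "b z' (e j) = 0" if j: "j \<in> I" for j
    proof -
      have "b z' (e j) = b z (e j) - (\<Sum>i\<in>I. b z (e i) * b (e i) (e j))"
        unfolding z'_def diff sum scale by (rule refl)
      also have "(\<Sum>i\<in>I. b z (e i) * b (e i) (e j)) = (\<Sum>i\<in>I. b z (e i) * (if i = j then 1 else 0))"
        by (rule Groups_Big.comm_monoid_add_class.sum.cong) (simp_all add: e j)
      also have "\<dots> = b z (e j)" using sum_times_delta(1)[OF 2(1), of "\<lambda>i. b z (e i)" j] j by simp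
      finally show ?thesis by simp
    qed
    \<comment> \<open>The vector \<open>z'\<close> is orthogonal to those already chosen; \<open>s\<close> normalizes it.\<close>
    define s where "s = 1 / sqrt (b z' z')"
    have s: "s * (s * b z' z') = 1"
      using pos[OF \<open>z' \<noteq> 0\<close>] by (simp add: s_def)
    have sc2: "b y (c *\<^sub>R x) = c * b y x" for c x y using scale sym by metis
    define e' where "e' = e(k := s *\<^sub>R z')"
    have "b (e' i) (e' j) = (if i = j then 1 else 0)" if ij: "i \<in> insert k I" "j \<in> insert k I" for i j
    proof -
      have i: "b (e i') z' = 0" if "i' \<in> I" for i' using z'e[OF that] sym[of "e i'" z'] by simp
      consider "i \<in> I" "j \<in> I" | "i = k" "j \<in> I" | "i \<in> I" "j = k" | "i = k" "j = k"
        using ij by blast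
      then show ?thesis
      proof cases
        case 1
        then have "i \<noteq> k" "j \<noteq> k" using kI by auto
        then show ?thesis using e[OF 1] by (simp add: e'_def)
      next
        case 2
        then have "j \<noteq> k" using kI by auto
        then show ?thesis using \<open>i = k\<close> z'e[OF \<open>j \<in> I\<close>] by (simp add: e'_def scale)
      next
        case 3
        then have "i \<noteq> k" using kI by auto
        then show ?thesis using 3 i[OF 3(1)] by (simp add: e'_def sc2)
      next
        case 4
        then show ?thesis using s by (simp add: e'_def scale sc2)
      qed
    qed
    then have "\<forall>i\<in>insert k I. \<forall>j\<in>insert k I. b (e' i) (e' j) = (if i = j then 1 else 0)"
      by (intro ballI)
    then show ?case by (rule exI[of _ e'])
  qed
  from this[of UNIV] obtain e :: "'n \<Rightarrow> real^'n"
    where "\<forall>i\<in>UNIV. \<forall>j\<in>UNIV. b (e i) (e j) = (if i = j then 1 else 0)" ..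
  then have e: "b (e i) (e j) = (if i = j then 1 else 0)" for i j by simp
  define M :: "real^'n^'n" where "M = (\<chi> i. e i)"
  have "inj ((*v) (transpose M))"
  proof (rule linear_injective_0[THEN iffD2, OF matrix_vector_mul_linear], intro allI impI)
    fix x assume "transpose M *v x = 0"
    then have "(\<Sum>i\<in>UNIV. x $ i *\<^sub>R e i) = 0"
      by (simp add: matrix_mult_sum M_def column_transpose row_def scalar_mult_eq_scaleR vec_lambda_eta)
    then have *: "(\<Sum>i\<in>UNIV. x $ i * b (e i) (e j)) = 0" for j
      using sum[of "\<lambda>i. x $ i *\<^sub>R e i" UNIV "e j"] scale[of 0 0 "e j"] by (simp add: scale)
    have "x $ j = 0" for j using *[of j] by (simp only: e sum_times_delta finite UNIV_I if_True)
    then show "x = 0" by (simp add: vec_eq_iff)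
  qed
  then have "det (transpose M) \<noteq> 0" by (rule det_nonzero_if_inj)
  then have "det M \<noteq> 0" by (simp add: det_transpose)
  moreover have "b (M $ i) (M $ j) = (if i = j then 1 else 0)" for i j by (simp add: M_def e)
  ultimately show ?thesis by (intro that)
qed

lemma matrix_rows_solve:
  fixes M :: "real^'n^'n"
  assumes "det M \<noteq> 0"
  obtains c where "a = (\<Sum>i\<in>UNIV. c $ i *\<^sub>R M $ i)"
proof -
  have "invertible (transpose M)" using assms by (simp add: invertible_det_nz det_transpose)
  then obtain B where "transpose M ** B = mat 1" by (auto simp: invertible_def)
  then have "a = transpose M *v (B *v a)"
    by (simp add: matrix_vector_mul_assoc del: transpose_matrix_vector)
  also have "\<dots> = (\<Sum>i\<in>UNIV. (B *v a) $ i *\<^sub>R M $ i)"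
    by (simp only: matrix_mult_sum column_transpose row_def vec_lambda_eta scalar_mult_eq_scaleR)
  finally have "a = (\<Sum>i\<in>UNIV. (B *v a) $ i *\<^sub>R M $ i)" .
  then show ?thesis by (rule that)
qed

abbreviation frame_coords :: "'e metric \<Rightarrow> 'e \<Rightarrow> ('n::finite \<Rightarrow> 'e tangent) \<Rightarrow> 'e tangent \<Rightarrow> real^'n" where
  "frame_coords g p e w \<equiv> (\<chi> i. g p w (e i))"

lemma chart_vector_sum:
  assumes A: "smooth_atlas A" and U: "(U, \<phi>) \<in> A" "p \<in> U"
  shows "chart_vector A (U, \<phi>) p (\<Sum>i\<in>I. c i *\<^sub>R x i) = (\<lambda>f. \<Sum>i\<in>I. c i * chart_vector A (U, \<phi>) p (x i) f)"
proof (induction I rule: infinite_finite_induct)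
  case (insert i I)
  show ?case
    using chart_vector_lincomb[OF A U, of "c i" "x i" 1 "\<Sum>i\<in>I. c i *\<^sub>R x i"] insert by simp
qed (use chart_vector_lincomb[OF A U, of 0 0 0 0] in simp_all)

lemma jacobian_apply:
  fixes f :: "real^'n \<Rightarrow> real^'m"
  assumes "(f has_derivative frechet_derivative f (at x)) (at x)"
  shows "frechet_derivative f (at x) a = jacobian f (at x) *v a"
  using has_derivative_linear[OF assms] by (simp add: jacobian_def)

lemma matrix_transpose_row:
  fixes M J :: "real^'n^'n"
  shows "(M ** transpose J) $ i = J *v (M $ i)"
  by (simp add: vec_eq_iff matrix_matrix_mult_def matrix_vector_mult_def transpose_def mult.commute)

context
  fixes Or :: "('e::t2_space, real^'n) chart set" and g :: "'e metric"
  assumes Or: "smooth_atlas Or" and g: "riemannian_metric Or g"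
begin

lemma metric_chart_linear:
  assumes "(U, \<phi>) \<in> Or" "p \<in> U" "w \<in> tangent_space Or p"
  shows "linear (\<lambda>x. g p w (chart_vector Or (U, \<phi>) p x))"
proof (rule linearI)
  note cv = chart_vector_tangent[OF Or assms(1,2)]
  fix x y :: "real^'n" and c :: real
  show "g p w (chart_vector Or (U, \<phi>) p (x + y)) = g p w (chart_vector Or (U, \<phi>) p x) + g p w (chart_vector Or (U, \<phi>) p y)"
    using chart_vector_lincomb[OF Or assms(1,2), of 1 x 1 y] metric_lincomb_right[OF g cv cv assms(3), of 1 x 1 y] by simp
  show "g p w (chart_vector Or (U, \<phi>) p (c *\<^sub>R x)) = c *\<^sub>R g p w (chart_vector Or (U, \<phi>) p x)"
    using chart_vector_lincomb[OF Or assms(1,2), of c x 0 x] metric_lincomb_right[OF g cv cv assms(3), of c x 0 x] by simp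
qed

lemma metric_sum_right:
  assumes "w \<in> tangent_space Or p" "\<And>i. i \<in> I \<Longrightarrow> v i \<in> tangent_space Or p"
  shows "(\<lambda>f. \<Sum>i\<in>I. c i * v i f) \<in> tangent_space Or p"
    and "g p w (\<lambda>f. \<Sum>i\<in>I. c i * v i f) = (\<Sum>i\<in>I. c i * g p w (v i))"
proof -
  have "(\<lambda>f. \<Sum>i\<in>I. c i * v i f) \<in> tangent_space Or p \<and>
      g p w (\<lambda>f. \<Sum>i\<in>I. c i * v i f) = (\<Sum>i\<in>I. c i * g p w (v i))"
    using assms(2)
  proof (induction I rule: infinite_finite_induct)
    case (insert i I)
    then have *: "v i \<in> tangent_space Or p" "(\<lambda>f. \<Sum>i\<in>I. c i * v i f) \<in> tangent_space Or p" by simp_all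
    show ?case using insert lincomb_tangent[OF *, of "c i" 1] metric_lincomb_right[OF g * assms(1), of "c i" 1] by simp
  next
    case (infinite I)
    then show ?case using zero_tangent metric_scale_right[OF g zero_tangent assms(1), of 0] by simp
  next
    case empty
    then show ?case using zero_tangent metric_scale_right[OF g zero_tangent assms(1), of 0] by simp
  qed
  then show "(\<lambda>f. \<Sum>i\<in>I. c i * v i f) \<in> tangent_space Or p"
    and "g p w (\<lambda>f. \<Sum>i\<in>I. c i * v i f) = (\<Sum>i\<in>I. c i * g p w (v i))" by blast+
qed

lemma positive_basis_tangent:
  "positive_basis Or p e \<Longrightarrow> e i \<in> tangent_space Or p"
  unfolding positive_basis_def using chart_vector_tangent[OF Or] by auto

text \<open>
  The vectors of a positive basis span because the matrix of their components is invertible;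
  orthonormality then identifies the coefficients.
\<close>

lemma frame_expansion:
  assumes e: "positive_orthonormal_basis g Or p e" and w: "w \<in> tangent_space Or p"
  shows "w = (\<lambda>f. \<Sum>i\<in>UNIV. g p w (e i) * e i f)"
proof -
  have pb: "positive_basis Or p e" and on: "\<And>i j. g p (e i) (e j) = (if i = j then 1 else 0)"
    using e by (simp_all add: positive_orthonormal_basis_def)
  obtain U \<phi> and M :: "real^'n^'n" where U: "(U, \<phi>) \<in> Or" "p \<in> U" and M: "0 < det M"
    and eM: "\<And>i. e i = chart_vector Or (U, \<phi>) p (M $ i)"
    using pb unfolding positive_basis_def by auto
  obtain a where a: "w = chart_vector Or (U, \<phi>) p a" using tangent_chart_vector[OF Or U w] .
  have "det M \<noteq> 0" using M by simp
  then obtain c where c: "a = (\<Sum>i\<in>UNIV. c $ i *\<^sub>R M $ i)" by (rule matrix_rows_solve)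
  have wc: "w = (\<lambda>f. \<Sum>i\<in>UNIV. c $ i * e i f)"
    unfolding a c chart_vector_sum[OF Or U] by (simp add: eM)
  have "g p w (e j) = c $ j" for j
  proof -
    have "g p w (e j) = g p (e j) w"
      by (rule metric_sym[OF g w positive_basis_tangent[OF pb]])
    also have "\<dots> = (\<Sum>i\<in>UNIV. c $ i * g p (e j) (e i))"
      unfolding wc by (rule metric_sum_right(2)) (simp_all add: positive_basis_tangent[OF pb])
    also have "\<dots> = c $ j" by (simp add: on sum_times_delta)
    finally show ?thesis .
  qed
  then show ?thesis using wc by simp
qed

lemma frame_inner:
  assumes e: "positive_orthonormal_basis g Or p e" and w: "w \<in> tangent_space Or p" and y: "y \<in> tangent_space Or p"
  shows "g p w y = frame_coords g p e w \<bullet> frame_coords g p e y"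
proof -
  have pb: "positive_basis Or p e" using e by (simp add: positive_orthonormal_basis_def)
  have "g p w y = g p w (\<lambda>f. \<Sum>i\<in>UNIV. g p y (e i) * e i f)"
    using frame_expansion[OF e y] by simp
  also have "\<dots> = (\<Sum>i\<in>UNIV. g p y (e i) * g p w (e i))"
    by (rule metric_sum_right(2)[OF w]) (rule positive_basis_tangent[OF pb])
  finally show ?thesis by (simp add: inner_vec_def mult.commute)
qed

lemma frame_coords_surj:
  assumes e: "positive_orthonormal_basis g Or p e"
  obtains w where "w \<in> tangent_space Or p" "frame_coords g p e w = c"
proof -
  have pb: "positive_basis Or p e" and on: "\<And>i j. g p (e i) (e j) = (if i = j then 1 else 0)"
    using e by (simp_all add: positive_orthonormal_basis_def)
  define w where "w = (\<lambda>f. \<Sum>i\<in>UNIV. c $ i * e i f)"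
  note eT = positive_basis_tangent[OF pb]
  have w: "w \<in> tangent_space Or p" unfolding w_def by (rule metric_sum_right(1)[OF eT eT])
  have "g p w (e j) = c $ j" for j
    using metric_sym[OF g w eT[of j]] metric_sum_right(2)[OF eT[of j], of UNIV e "\<lambda>i. c $ i"] eT
    by (simp add: w_def on sum_times_delta)
  then show ?thesis using that[OF w] by (simp add: vec_eq_iff)
qed

lemma frame_coords_inj:
  assumes e: "positive_orthonormal_basis g Or p e" and "w \<in> tangent_space Or p" "y \<in> tangent_space Or p"
    and eq: "frame_coords g p e w = frame_coords g p e y"
  shows "w = y"
proof -
  have "g p w (e i) = g p y (e i)" for i using eq by (simp add: vec_eq_iff)
  then show ?thesis using frame_expansion[OF e assms(2)] frame_expansion[OF e assms(3)] by simp
qed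

text \<open>
  Positivity is defined by some chart of the oriented atlas; the positive Jacobians of the coordinate
  changes make it independent of the chart.
\<close>

lemma positive_basis_in_chart:
  assumes ori: "\<And>U \<phi> V \<psi> p. (U, \<phi>) \<in> Or \<Longrightarrow> (V, \<psi>) \<in> Or \<Longrightarrow> p \<in> U \<inter> V \<Longrightarrow>
      0 < det (jacobian (\<psi> \<circ> inv_into U \<phi>) (at (\<phi> p)))"
    and pb: "positive_basis Or p e" and V: "(V, \<psi>) \<in> Or" "p \<in> V"
  obtains M :: "real^'n^'n" where "0 < det M" "\<And>i. e i = chart_vector Or (V, \<psi>) p (M $ i)"
proof -
  obtain U \<phi> and M :: "real^'n^'n" where U: "(U, \<phi>) \<in> Or" "p \<in> U" and M: "0 < det M"
    and eM: "\<And>i. e i = chart_vector Or (U, \<phi>) p (M $ i)"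
    using pb unfolding positive_basis_def by auto
  let ?J = "jacobian (\<psi> \<circ> inv_into U \<phi>) (at (\<phi> p))"
  have d: "((\<psi> \<circ> inv_into U \<phi>) has_derivative frechet_derivative (\<psi> \<circ> inv_into U \<phi>) (at (\<phi> p))) (at (\<phi> p))"
    by (rule smooth_on_has_derivative[OF chart_change_smooth[OF Or U(1) V(1)]]) (use U V in auto)
  show ?thesis
  proof
    show "0 < det (M ** transpose ?J)"
      using M ori[OF U(1) V(1), of p] U V by (simp add: det_mul det_transpose)
    show "e i = chart_vector Or (V, \<psi>) p ((M ** transpose ?J) $ i)" for i
      using chart_vector_change[OF Or U V, of "M $ i"] by (simp add: eM matrix_transpose_row jacobian_apply[OF d])
  qed
qed

text \<open>
  The transition matrix is orthogonal because both bases are orthonormal, and has positive determinant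
  because both are positive.
\<close>

lemma positive_orthonormal_change:
  assumes ori: "\<And>U \<phi> V \<psi> p. (U, \<phi>) \<in> Or \<Longrightarrow> (V, \<psi>) \<in> Or \<Longrightarrow> p \<in> U \<inter> V \<Longrightarrow>
      0 < det (jacobian (\<psi> \<circ> inv_into U \<phi>) (at (\<phi> p)))"
    and e: "positive_orthonormal_basis g Or p e" and e': "positive_orthonormal_basis g Or p e'"
  obtains R :: "real^'n^'n" where "rotation_matrix R"
    "\<And>w. w \<in> tangent_space Or p \<Longrightarrow> frame_coords g p e' w = R *v frame_coords g p e w"
proof -
  have pb: "positive_basis Or p e" "positive_basis Or p e'"
    and on: "\<And>i j. g p (e i) (e j) = (if i = j then 1 else 0)" "\<And>i j. g p (e' i) (e' j) = (if i = j then 1 else 0)"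
    using e e' by (simp_all add: positive_orthonormal_basis_def)
  obtain U \<phi> where U: "(U, \<phi>) \<in> Or" "p \<in> U" using atlas_chart[OF Or] .
  obtain M :: "real^'n^'n" where M: "0 < det M" "\<And>i. e i = chart_vector Or (U, \<phi>) p (M $ i)"
    by (rule positive_basis_in_chart[OF ori pb(1) U]) (assumption | rule that)+
  obtain M' :: "real^'n^'n" where M': "0 < det M'" "\<And>i. e' i = chart_vector Or (U, \<phi>) p (M' $ i)"
    by (rule positive_basis_in_chart[OF ori pb(2) U]) (assumption | rule that)+
  have "invertible M" using M(1) by (simp add: invertible_det_nz)
  then obtain N where N: "N ** M = mat 1" by (auto simp: invertible_def)
  define R where "R = M' ** N"
  have RM: "R ** M = M'"
    unfolding R_def by (simp add: matrix_mul_assoc[symmetric] N)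
  have row: "M' $ i = (\<Sum>j\<in>UNIV. R $ i $ j *\<^sub>R M $ j)" for i
    unfolding RM[symmetric] by (simp add: vec_eq_iff matrix_matrix_mult_def)
  have coords: "frame_coords g p e' w = R *v frame_coords g p e w" if w: "w \<in> tangent_space Or p" for w
  proof -
    note lin = metric_chart_linear[OF U w]
    have "g p w (e' i) = (\<Sum>j\<in>UNIV. R $ i $ j * g p w (e j))" for i
      unfolding M'(2) M(2) row
      using linear_sum[OF lin, of "\<lambda>j. R $ i $ j *\<^sub>R M $ j" UNIV] linear_scale[OF lin] by simp
    then show ?thesis by (simp add: vec_eq_iff matrix_vector_mult_def)
  qed
  have "R ** transpose R = mat 1"
  proof -
    have "(R ** transpose R) $ i = mat 1 $ i" for i
    proof -
      have "frame_coords g p e (e' i) = R $ i"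
      proof -
        note lin = metric_chart_linear[OF U positive_basis_tangent[OF pb(1)]]
        have "g p (e' i) (e j) = R $ i $ j" for j
        proof -
          have "g p (e' i) (e j) = g p (e j) (e' i)"
            by (rule metric_sym[OF g positive_basis_tangent[OF pb(2)] positive_basis_tangent[OF pb(1)]])
          also have "\<dots> = (\<Sum>k\<in>UNIV. R $ i $ k * g p (e j) (e k))"
            unfolding M'(2) row
            using linear_sum[OF lin[of j], of "\<lambda>k. R $ i $ k *\<^sub>R M $ k" UNIV]
              linear_scale[OF lin[of j]] M(2) by simp
          also have "\<dots> = R $ i $ j" by (simp add: on sum_times_delta)
          finally show ?thesis .
        qed
        then show ?thesis by (simp add: vec_eq_iff)
      qed
      then have "frame_coords g p e' (e' i) = R *v (R $ i)"
        using coords[OF positive_basis_tangent[OF pb(2)], of i] by simp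
      then show ?thesis by (simp add: matrix_transpose_row on mat_def vec_eq_iff)
    qed
    then show ?thesis by (simp add: vec_eq_iff)
  qed
  then have "orthogonal_matrix R" using matrix_left_right_inverse[of R "transpose R"] by (simp add: orthogonal_matrix_def)
  moreover have "det R * det M = det M'" using det_mul[of R M] by (simp add: RM)
  then have "0 < det R" using M(1) M'(1) zero_less_mult_pos2[of "det R" "det M"] by simp
  ultimately have "rotation_matrix R" using det_orthogonal_matrix[of R] by (auto simp: rotation_matrix_def)
  then show ?thesis using coords by (rule that)
qed

end

section \<open>The cross product of an oriented Riemannian three-manifold\<close>

lemma orientationD:
  assumes "orientation A Or"
  shows "smooth_atlas Or" "smooth_atlas (A \<union> Or)"
    and "(U, \<phi>) \<in> Or \<Longrightarrow> (V, \<psi>) \<in> Or \<Longrightarrow> p \<in> U \<inter> V \<Longrightarrow> 0 < det (jacobian (\<psi> \<circ> inv_into U \<phi>) (at (\<phi> p)))"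
proof -
  show "smooth_atlas Or" using assms unfolding orientation_def by (elim conjE)
  show "smooth_atlas (A \<union> Or)" using assms unfolding orientation_def by (elim conjE)
  have *: "\<forall>(U, \<phi>)\<in>Or. \<forall>(V, \<psi>)\<in>Or. \<forall>p\<in>U \<inter> V. 0 < det (jacobian (\<psi> \<circ> inv_into U \<phi>) (at (\<phi> p)))"
    using assms unfolding orientation_def by (elim conjE)
  assume U: "(U, \<phi>) \<in> Or" and V: "(V, \<psi>) \<in> Or" and p: "p \<in> U \<inter> V"
  from bspec[OF * U] have "\<forall>(V, \<psi>)\<in>Or. \<forall>p\<in>U \<inter> V. 0 < det (jacobian (\<psi> \<circ> inv_into U \<phi>) (at (\<phi> p)))" by simp
  from bspec[OF this V] p show "0 < det (jacobian (\<psi> \<circ> inv_into U \<phi>) (at (\<phi> p)))" by simp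
qed

text \<open>
  In odd dimension, multiplying all vectors of a basis by the sign of its determinant makes the basis
  positive.
\<close>

lemma ex_positive_orthonormal_basis:
  fixes Or :: "('e::t2_space, real^3) chart set"
  assumes Or: "smooth_atlas Or" and g: "riemannian_metric Or g"
  obtains e where "positive_orthonormal_basis g Or p e"
proof -
  obtain U \<phi> where U: "(U, \<phi>) \<in> Or" "p \<in> U" using atlas_chart[OF Or] .
  let ?c = "chart_vector Or (U, \<phi>) p"
  note cv = chart_vector_tangent[OF Or U]
  have c0: "?c 0 = (\<lambda>f. 0)" using chart_vector_lincomb[OF Or U, of 0 0 0 0] by simp
  have sym: "g p (?c x) (?c y) = g p (?c y) (?c x)" for x y by (rule metric_sym[OF g cv cv])
  have lin: "linear (\<lambda>x. g p (?c x) (?c y))" for y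
    using metric_chart_linear[OF Or g U cv[of y]] by (simp only: sym[of _ y])
  have pos: "0 < g p (?c x) (?c x)" if "x \<noteq> 0" for x
  proof (rule metric_pos[OF g cv])
    show "?c x \<noteq> (\<lambda>f. 0)" using chart_vector_inj[OF Or U, of x 0] that c0 by auto
  qed
  obtain M :: "real^3^3" where M: "\<And>i j. g p (?c (M $ i)) (?c (M $ j)) = (if i = j then 1 else 0)" "det M \<noteq> 0"
    by (rule ex_orthonormal_matrix[OF lin sym pos]) (assumption | rule that)+
  define s :: real where "s = sgn (det M)"
  have s: "s * s = 1" "0 < s * det M" using M(2) by (auto simp: s_def sgn_if)
  define N :: "real^3^3" where "N = (\<chi> i. s *\<^sub>R M $ i)"
  have "det N = s * s * s * det M" by (simp add: N_def det_3 algebra_simps)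
  then have dN: "0 < det N" using s by simp
  have cN: "?c (N $ i) = (\<lambda>f. s * ?c (M $ i) f)" for i
    using chart_vector_lincomb[OF Or U, of s "M $ i" 0 0] by (simp add: N_def)
  have "positive_basis Or p (\<lambda>i. ?c (N $ i))"
    unfolding positive_basis_def
    by (rule bexI[OF _ U(1)], simp add: U(2), rule exI[of _ N], simp add: dN)
  moreover have "g p (?c (N $ i)) (?c (N $ j)) = (if i = j then 1 else 0)" for i j
  proof -
    have "g p (?c (N $ i)) (?c (N $ j)) = s * g p (?c (M $ i)) (\<lambda>f. s * ?c (M $ j) f)"
      unfolding cN by (rule metric_scale_left[OF g cv scale_tangent[OF cv]])
    also have "\<dots> = s * s * (if i = j then 1 else 0)"
      by (simp only: metric_scale_right[OF g cv cv] M(1) mult.assoc)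
    finally show ?thesis by (simp only: s(1) mult_1)
  qed
  ultimately have "positive_orthonormal_basis g Or p (\<lambda>i. ?c (N $ i))"
    by (simp add: positive_orthonormal_basis_def)
  then show ?thesis by (rule that)
qed

context
  fixes A Or :: "('e::t2_space, real^3) chart set" and g :: "'e metric"
  assumes ori: "orientation A Or" and g: "riemannian_metric Or g"
begin

text \<open>
  The definite description in the definition of the cross product is meaningful: a vector with the
  required coordinates in one positive orthonormal basis has them in all, because the usual cross
  product commutes with rotations, and coordinates determine the vector.
\<close>

lemma cross_product_characterization:
  assumes u: "u \<in> tangent_space Or p" and v: "v \<in> tangent_space Or p"
  shows "cross_product g Or p u v \<in> tangent_space Or p"
    and "positive_orthonormal_basis g Or p e \<Longrightarrow>
      frame_coords g p e (cross_product g Or p u v) = cross3 (frame_coords g p e u) (frame_coords g p e v)"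
proof -
  note Or = orientationD(1)[OF ori] and pos = orientationD(3)[OF ori]
  let ?P = "\<lambda>w. w \<in> tangent_space Or p \<and> (\<forall>e. positive_orthonormal_basis g Or p e \<longrightarrow>
        frame_coords g p e w = cross3 (frame_coords g p e u) (frame_coords g p e v))"
  obtain e where e: "positive_orthonormal_basis g Or p e"
    by (rule ex_positive_orthonormal_basis[OF Or g]) (rule that)
  obtain w where w: "w \<in> tangent_space Or p"
    "frame_coords g p e w = cross3 (frame_coords g p e u) (frame_coords g p e v)"
    by (rule frame_coords_surj[OF Or g e]) (rule that)
  have "?P w"
  proof (intro conjI allI impI)
    fix e' assume e': "positive_orthonormal_basis g Or p e'"
    obtain R :: "real^3^3" where R: "rotation_matrix R"
      "\<And>w. w \<in> tangent_space Or p \<Longrightarrow> frame_coords g p e' w = R *v frame_coords g p e w"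
      by (rule positive_orthonormal_change[OF Or g pos e e']) (assumption | rule that)+
    show "frame_coords g p e' w = cross3 (frame_coords g p e' u) (frame_coords g p e' v)"
      using cross_rotation_matrix[OF R(1)] by (simp add: R(2) u v w)
  qed (rule w(1))
  moreover have "w' = w" if "?P w'" for w'
    using frame_coords_inj[OF Or g e, of w' w] that w e by simp
  ultimately have "?P (THE w. ?P w)" by (rule theI)
  then have "?P (cross_product g Or p u v)" unfolding cross_product_def .
  then show "cross_product g Or p u v \<in> tangent_space Or p"
    and "positive_orthonormal_basis g Or p e \<Longrightarrow>
      frame_coords g p e (cross_product g Or p u v) = cross3 (frame_coords g p e u) (frame_coords g p e v)" for e
    by simp_all
qed

lemma cross_product_inner:
  assumes "u \<in> tangent_space Or p" "v \<in> tangent_space Or p" "y \<in> tangent_space Or p"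
    and e: "positive_orthonormal_basis g Or p e"
  shows "g p (cross_product g Or p u v) y =
    cross3 (frame_coords g p e u) (frame_coords g p e v) \<bullet> frame_coords g p e y"
  using frame_inner[OF orientationD(1)[OF ori] g e cross_product_characterization(1)[OF assms(1,2)] assms(3)]
    cross_product_characterization(2)[OF assms(1,2) e] by simp

text \<open>
  The triple product $g(u \<and> v, y)$ changes sign when \<open>u\<close> and \<open>y\<close> are exchanged.
\<close>

lemma cross_product_antisym:
  assumes "u \<in> tangent_space Or p" "v \<in> tangent_space Or p" "y \<in> tangent_space Or p"
  shows "g p (cross_product g Or p y v) u = - g p (cross_product g Or p u v) y"
proof -
  obtain e where e: "positive_orthonormal_basis g Or p e"
    by (rule ex_positive_orthonormal_basis[OF orientationD(1)[OF ori] g]) (rule that)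
  show ?thesis
    unfolding cross_product_inner[OF assms e] cross_product_inner[OF assms(3,2,1) e]
    by (simp add: cross3_def inner_vec_def sum_3 algebra_simps)
qed

lemma cross_product_scale_right:
  assumes "u \<in> tangent_space Or p" "v \<in> tangent_space Or p" "y \<in> tangent_space Or p"
  shows "g p (cross_product g Or p u (\<lambda>f. c * v f)) y = c * g p (cross_product g Or p u v) y"
proof -
  obtain e where e: "positive_orthonormal_basis g Or p e"
    by (rule ex_positive_orthonormal_basis[OF orientationD(1)[OF ori] g]) (rule that)
  then have "e i \<in> tangent_space Or p" for i
    by (simp add: positive_orthonormal_basis_def positive_basis_tangent[OF orientationD(1)[OF ori] g])
  then have "frame_coords g p e (\<lambda>f. c * v f) = c *\<^sub>R frame_coords g p e v"
    by (simp add: vec_eq_iff metric_scale_left[OF g assms(2)])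
  then show ?thesis
    unfolding cross_product_inner[OF assms e] cross_product_inner[OF assms(1) scale_tangent[OF assms(2)] assms(3) e]
    by (simp add: cross_mult_right)
qed

text \<open>
  The images of a positive orthonormal basis, multiplied by \<open>\<sigma>\<close>, form a positive orthonormal basis
  again, since the dimension is odd. In these bases the differential of \<open>F\<close> multiplies coordinates by
  \<open>\<sigma>\<close>, so the triple product is multiplied by $\<sigma>^3 = \<sigma>$.
\<close>

lemma cross_product_isometry:
  assumes F: "riemannian_isometry Or g Or g F" and \<sigma>: "\<sigma> * \<sigma> = 1"
    and or: "\<And>U \<phi> V \<psi> p. (U, \<phi>) \<in> Or \<Longrightarrow> (V, \<psi>) \<in> Or \<Longrightarrow> p \<in> U \<inter> F -` V \<Longrightarrow>
      0 < \<sigma> * det (jacobian (\<psi> \<circ> F \<circ> inv_into U \<phi>) (at (\<phi> p)))"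
    and u: "u \<in> tangent_space Or p" and v: "v \<in> tangent_space Or p" and y: "y \<in> tangent_space Or p"
  shows "g (F p) (cross_product g Or (F p) (differential Or F u) (differential Or F v)) (differential Or F y) =
    \<sigma> * g p (cross_product g Or p u v) y"
proof -
  note Or = orientationD(1)[OF ori] and F' = riemannian_isometryD[OF F]
  obtain e where e: "positive_orthonormal_basis g Or p e"
    by (rule ex_positive_orthonormal_basis[OF Or g]) (rule that)
  have pb: "positive_basis Or p e" and on: "\<And>i j. g p (e i) (e j) = (if i = j then 1 else 0)"
    using e by (simp_all add: positive_orthonormal_basis_def)
  note eT = positive_basis_tangent[OF Or g pb]
  note dT = differential_tangent[OF Or Or F'(2)]
  define e' where "e' i = (\<lambda>f. \<sigma> * differential Or F (e i) f)" for i
  have coords: "frame_coords g (F p) e' (differential Or F w) = \<sigma> *\<^sub>R frame_coords g p e w"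
    if w: "w \<in> tangent_space Or p" for w
    unfolding e'_def using metric_scale_right[OF g dT[OF eT] dT[OF w]] F'(4)[OF w eT] by (simp add: vec_eq_iff)
  obtain U \<phi> and M :: "real^3^3" where U: "(U, \<phi>) \<in> Or" "p \<in> U" and M: "0 < det M"
    and eM: "\<And>i. e i = chart_vector Or (U, \<phi>) p (M $ i)"
    using pb unfolding positive_basis_def by auto
  obtain V \<psi> where V: "(V, \<psi>) \<in> Or" "F p \<in> V" using atlas_chart[OF Or] .
  let ?J = "jacobian (\<psi> \<circ> F \<circ> inv_into U \<phi>) (at (\<phi> p))"
  define N :: "real^3^3" where "N = (\<chi> i. \<sigma> *\<^sub>R (M ** transpose ?J) $ i)"
  have "det N = \<sigma> * \<sigma> * \<sigma> * det (M ** transpose ?J)" by (simp add: N_def det_3 algebra_simps)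
  also have "\<dots> = det M * (\<sigma> * det ?J)" by (simp add: \<sigma> det_mul det_transpose)
  finally have "0 < det N" using M or[OF U(1) V(1), of p] U V by simp
  moreover have "e' i = chart_vector Or (V, \<psi>) (F p) (N $ i)" for i
  proof -
    have "differential Or F (e i) = chart_vector Or (V, \<psi>) (F p) (?J *v (M $ i))"
      unfolding eM differential_chart_vector[OF Or Or F'(2) U V]
        jacobian_apply[OF chart_representation_has_derivative[OF Or Or F'(2) U V]] ..
    then show ?thesis
      using chart_vector_lincomb[OF Or V, of \<sigma> "?J *v (M $ i)" 0 0]
      by (simp add: e'_def N_def matrix_transpose_row)
  qed
  ultimately have "positive_basis Or (F p) e'"
    unfolding positive_basis_def
    by (intro bexI[OF _ V(1)]) (simp add: V(2), rule exI[of _ N], simp)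
  moreover have "g (F p) (e' i) (e' j) = (if i = j then 1 else 0)" for i j
  proof -
    have "g (F p) (e' i) (e' j) = \<sigma> * g (F p) (differential Or F (e i)) (e' j)"
      unfolding e'_def by (rule metric_scale_left[OF g dT[OF eT] scale_tangent[OF dT[OF eT]]])
    also have "\<dots> = \<sigma> * (\<sigma> * g p (e i) (e j))"
      unfolding e'_def using metric_scale_right[OF g dT[OF eT] dT[OF eT]] F'(4)[OF eT eT] by simp
    finally show ?thesis by (simp add: on mult.assoc[symmetric] \<sigma>)
  qed
  ultimately have e': "positive_orthonormal_basis g Or (F p) e'" by (simp add: positive_orthonormal_basis_def)
  show ?thesis
    unfolding cross_product_inner[OF u v y e] cross_product_inner[OF dT[OF u] dT[OF v] dT[OF y] e']
      coords[OF u] coords[OF v] coords[OF y]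
    using \<sigma> by (simp add: cross_mult_left cross_mult_right mult.assoc[symmetric])
qed

text \<open>
  Choose \<open>u\<close> not parallel to \<open>k\<close>; the second vector is $u \<and> k$ itself.
\<close>

lemma ex_cross_product_nonzero:
  assumes k: "k \<in> tangent_space Or p" "k \<noteq> (\<lambda>f. 0)"
  obtains u y where "u \<in> tangent_space Or p" "y \<in> tangent_space Or p" "g p (cross_product g Or p u k) y \<noteq> 0"
proof -
  note Or = orientationD(1)[OF ori]
  obtain e where e: "positive_orthonormal_basis g Or p e"
    by (rule ex_positive_orthonormal_basis[OF Or g]) (rule that)
  let ?k = "frame_coords g p e k"
  have "?k \<bullet> ?k > 0" using frame_inner[OF Or g e k(1) k(1)] metric_pos[OF g k] by simp
  then have k0: "?k \<noteq> 0" by (metis inner_zero_left less_irrefl)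
  have "\<exists>x. cross3 x ?k \<noteq> 0"
  proof (rule ccontr)
    assume "\<nexists>x. cross3 x ?k \<noteq> 0"
    then have "cross3 (axis 1 1) ?k = 0" "cross3 (axis 2 1) ?k = 0" by simp_all
    then have "?k = 0" by (simp add: cross3_def vec_eq_iff forall_3 axis_def)
    then show False using k0 by simp
  qed
  then obtain x where x: "cross3 x ?k \<noteq> 0" by blast
  obtain u where u: "u \<in> tangent_space Or p" "frame_coords g p e u = x"
    by (rule frame_coords_surj[OF Or g e]) (rule that)
  obtain y where y: "y \<in> tangent_space Or p" "frame_coords g p e y = cross3 x ?k"
    by (rule frame_coords_surj[OF Or g e]) (rule that)
  have "g p (cross_product g Or p u k) y \<noteq> 0"
    unfolding cross_product_inner[OF u(1) k(1) y(1) e] u(2) y(2) using x by simp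
  then show ?thesis using u(1) y(1) by (rule that[rotated 2])
qed

end

section \<open>Passing to an oriented atlas\<close>

text \<open>
  An orientation is an atlas of its own, and the cross product refers to it rather than to the given
  atlas. Compatible atlases have the same smooth functions, hence all notions derived from these
  coincide.
\<close>

lemma orientation_smooth_fun:
  assumes A: "smooth_atlas A" and ori: "orientation A Or"
  shows "smooth_fun Or = smooth_fun A"
proof
  fix f
  note O = orientationD(1,2)[OF ori]
  show "smooth_fun Or f = smooth_fun A f"
    using smooth_map_atlas_extend[OF A O(2) smooth_atlas_std, of f]
      smooth_map_atlas_extend[OF O(1,2) smooth_atlas_std, of f] by simp
qed

lemma orientation_tangent_space:
  assumes "smooth_atlas A" "orientation A Or"
  shows "tangent_space Or = tangent_space A"
  unfolding tangent_space_def orientation_smooth_fun[OF assms] ..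

lemma orientation_differential:
  assumes "smooth_atlas A" "orientation A Or"
  shows "differential Or = differential A"
  unfolding differential_def orientation_smooth_fun[OF assms] ..

lemma orientation_riemannian_metric:
  assumes "smooth_atlas A" "orientation A Or"
  shows "riemannian_metric Or g = riemannian_metric A g"
  unfolding riemannian_metric_def smooth_field_def orientation_smooth_fun[OF assms]
    orientation_tangent_space[OF assms] ..

lemma orientation_smooth_map:
  assumes A: "smooth_atlas A" and ori: "orientation A Or" and F: "smooth_map A A F"
  shows "smooth_map Or Or F"
proof -
  note O = orientationD(1,2)[OF ori]
  have sub: "A \<subseteq> A \<union> Or" "Or \<subseteq> A \<union> Or" by auto
  have 1: "smooth_map Or A id"
    using smooth_map_id[OF A] smooth_map_atlas_extend[OF A O(2) A sub(1), of id]
      smooth_map_atlas_extend[OF O(1,2) A sub(2), of id] by simp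
  have 2: "smooth_map A Or id"
    using smooth_map_id[OF O(1)] smooth_map_atlas_extend[OF A O(2) O(1) sub(1), of id]
      smooth_map_atlas_extend[OF O(1,2) O(1) sub(2), of id] by simp
  have "smooth_map Or Or (id \<circ> (F \<circ> id))"
    by (rule smooth_map_compose[OF O(1) A O(1) smooth_map_compose[OF O(1) A A 1 F] 2])
  then show ?thesis by simp
qed

lemma orientation_riemannian_isometry:
  assumes A: "smooth_atlas A" and ori: "orientation A Or" and F: "riemannian_isometry A g A g F"
  shows "riemannian_isometry Or g Or g F"
  using F orientation_smooth_map[OF A ori, of F] orientation_smooth_map[OF A ori, of "inv F"]
  unfolding riemannian_isometry_def orientation_tangent_space[OF A ori] orientation_differential[OF A ori]
  by simp

section \<open>The bundle curvature and the dual one-form of the Killing field\<close>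

text \<open>
  The exterior derivative of the one-form $g(\<xi>, \<cdot>)$, evaluated on the fields \<open>X\<close> and \<open>Y\<close>.
\<close>

definition dual_form_derivative ::
  "('e::topological_space, 'b::euclidean_space) chart set \<Rightarrow> 'e metric \<Rightarrow> 'e field \<Rightarrow> 'e field \<Rightarrow> 'e field \<Rightarrow> 'e \<Rightarrow> real" where
  "dual_form_derivative A g \<xi> X Y p = X p (\<lambda>q. g q (\<xi> q) (Y q)) - Y p (\<lambda>q. g q (\<xi> q) (X q))
     - g p (\<xi> p) (lie_bracket A X Y p)"

lemma levi_civitaD:
  assumes "levi_civita A g D"
  shows "smooth_field A X \<Longrightarrow> smooth_field A Y \<Longrightarrow> smooth_field A (D X Y)"
    and "smooth_field A X \<Longrightarrow> smooth_field A Y \<Longrightarrow> smooth_field A Z \<Longrightarrow>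
      X p (\<lambda>q. g q (Y q) (Z q)) = g p (D X Y p) (Z p) + g p (Y p) (D X Z p)"
    and "smooth_field A X \<Longrightarrow> smooth_field A Y \<Longrightarrow> lie_bracket A X Y p = (\<lambda>f. D X Y p f - D Y X p f)"
proof -
  have ac: "affine_connection A D" using assms unfolding levi_civita_def by (elim conjE)
  have smooth: "\<forall>X Y. smooth_field A X \<longrightarrow> smooth_field A Y \<longrightarrow> smooth_field A (D X Y)"
    using ac unfolding affine_connection_def by (elim conjE)
  have metric: "\<forall>X Y Z p. smooth_field A X \<longrightarrow> smooth_field A Y \<longrightarrow> smooth_field A Z \<longrightarrow>
        X p (\<lambda>q. g q (Y q) (Z q)) = g p (D X Y p) (Z p) + g p (Y p) (D X Z p)"
    using assms unfolding levi_civita_def by (elim conjE)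
  have torsion: "\<forall>X Y. smooth_field A X \<longrightarrow> smooth_field A Y \<longrightarrow> (\<lambda>p f. D X Y p f - D Y X p f) = lie_bracket A X Y"
    using assms unfolding levi_civita_def by (elim conjE)
  show "smooth_field A (D X Y)" if "smooth_field A X" "smooth_field A Y"
    using smooth[rule_format, OF that] .
  show "X p (\<lambda>q. g q (Y q) (Z q)) = g p (D X Y p) (Z p) + g p (Y p) (D X Z p)"
    if "smooth_field A X" "smooth_field A Y" "smooth_field A Z"
    using metric[rule_format, OF that] .
  show "lie_bracket A X Y p = (\<lambda>f. D X Y p f - D Y X p f)" if "smooth_field A X" "smooth_field A Y"
    using fun_cong[OF torsion[rule_format, OF that], of p] by (rule sym)
qed

lemma lie_bracket_tangent:
  assumes "levi_civita A g D" "smooth_field A X" "smooth_field A Y"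
  shows "lie_bracket A X Y p \<in> tangent_space A p"
proof -
  have "lie_bracket A X Y p = (\<lambda>f. 1 * D X Y p f + (-1) * D Y X p f)"
    by (simp add: levi_civitaD(3)[OF assms])
  then show ?thesis
    using lincomb_tangent[OF smooth_fieldD(1)[OF levi_civitaD(1)[OF assms]]
        smooth_fieldD(1)[OF levi_civitaD(1)[OF assms(1,3,2)]], of 1 p "-1"] by simp
qed

lemma dual_form_derivative_levi_civita:
  assumes g: "riemannian_metric A g" and D: "levi_civita A g D"
    and \<xi>: "smooth_field A \<xi>" and X: "smooth_field A X" and Y: "smooth_field A Y"
  shows "dual_form_derivative A g \<xi> X Y p = g p (D X \<xi> p) (Y p) - g p (D Y \<xi> p) (X p)"
proof -
  have T: "\<xi> p \<in> tangent_space A p" "D X Y p \<in> tangent_space A p" "D Y X p \<in> tangent_space A p"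
    by (intro smooth_fieldD(1) \<xi> levi_civitaD(1)[OF D] X Y)+
  have "g p (\<xi> p) (lie_bracket A X Y p) = g p (\<xi> p) (D X Y p) - g p (\<xi> p) (D Y X p)"
    using metric_lincomb_right[OF g T(2,3,1), of 1 "-1"] by (simp add: levi_civitaD(3)[OF D X Y])
  then show ?thesis
    by (simp add: dual_form_derivative_def levi_civitaD(2)[OF D X \<xi> Y] levi_civitaD(2)[OF D Y \<xi> X])
qed

text \<open>
  Substituting $\<nabla>_Z \<xi> = \<tau> Z \<and> \<xi>$ into the formula for the exterior derivative gives two triple products,
  which differ by the exchange of \<open>X\<close> and \<open>Y\<close> and therefore add up.
\<close>

lemma dual_form_derivative_bundle_curvature:
  fixes A :: "('e::t2_space, real^3) chart set"
  assumes A: "smooth_atlas A" and ori: "orientation A Or" and g: "riemannian_metric A g" and D: "levi_civita A g D"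
    and bc: "bundle_curvature A g Or D \<xi> t"
    and \<xi>: "smooth_field A \<xi>" and X: "smooth_field A X" and Y: "smooth_field A Y"
  shows "dual_form_derivative A g \<xi> X Y p = 2 * t p * g p (cross_product g Or p (X p) (\<xi> p)) (Y p)"
proof -
  have gO: "riemannian_metric Or g" using g by (simp add: orientation_riemannian_metric[OF A ori])
  note TO = orientation_tangent_space[OF A ori]
  note T = smooth_fieldD(1)[OF \<xi>, of p] smooth_fieldD(1)[OF X, of p] smooth_fieldD(1)[OF Y, of p]
  note T' = T[folded TO]
  have D\<xi>: "D Z \<xi> p = (\<lambda>f. t p * cross_product g Or p (Z p) (\<xi> p) f)" if "smooth_field A Z" for Z
    using bc that by (simp add: bundle_curvature_def)
  have c: "cross_product g Or p (X p) (\<xi> p) \<in> tangent_space A p" "cross_product g Or p (Y p) (\<xi> p) \<in> tangent_space A p"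
    using cross_product_characterization(1)[OF ori gO] T' by (simp_all add: TO)
  show ?thesis
    unfolding dual_form_derivative_levi_civita[OF g D \<xi> X Y] D\<xi>[OF X] D\<xi>[OF Y]
      metric_scale_left[OF g c(1) T(3)] metric_scale_left[OF g c(2) T(2)]
    using cross_product_antisym[OF ori gO T'(2,1,3)] by simp
qed

text \<open>
  As an isometry with $F_* \<xi> = \<epsilon> \<xi>$, the map \<open>F\<close> pulls the one-form $g(\<xi>, \<cdot>)$ back to \<open>\<epsilon>\<close> times itself, and
  the exterior derivative commutes with pullbacks.
\<close>

lemma dual_form_derivative_pushforward:
  assumes A: "smooth_atlas A" and g: "riemannian_metric A g" and D: "levi_civita A g D"
    and F: "riemannian_isometry A g A g F"
    and \<epsilon>: "\<epsilon> * \<epsilon> = 1" "\<And>p. differential A F (\<xi> p) = (\<lambda>u. \<epsilon> * \<xi> (F p) u)"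
    and \<xi>: "smooth_field A \<xi>" and X: "smooth_field A X" and Y: "smooth_field A Y"
  shows "dual_form_derivative A g \<xi> (pushforward A F X) (pushforward A F Y) (F p) =
    \<epsilon> * dual_form_derivative A g \<xi> X Y p"
proof -
  note F' = riemannian_isometryD[OF F]
  note pf = smooth_field_pushforward[OF A A F'(2,1,3)]
  have inner: "g (F q) (\<xi> (F q)) (differential A F w) = \<epsilon> * g q (\<xi> q) w" if w: "w \<in> tangent_space A q" for q w
  proof -
    have "g q (\<xi> q) w = g (F q) (\<lambda>u. \<epsilon> * \<xi> (F q) u) (differential A F w)"
      using F'(4)[OF smooth_fieldD(1)[OF \<xi>] w] by (simp add: \<epsilon>(2))
    also have "\<dots> = \<epsilon> * g (F q) (\<xi> (F q)) (differential A F w)"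
      by (rule metric_scale_left[OF g smooth_fieldD(1)[OF \<xi>] differential_tangent[OF A A F'(2) w]])
    finally show ?thesis by (simp add: mult.assoc[symmetric] \<epsilon>(1))
  qed
  have transported: "pushforward A F X (F p) (\<lambda>q. g q (\<xi> q) (pushforward A F Y q)) = \<epsilon> * X p (\<lambda>q. g q (\<xi> q) (Y q))"
    if X: "smooth_field A X" and Y: "smooth_field A Y" for X Y
  proof -
    have "pushforward A F X (F p) (\<lambda>q. g q (\<xi> q) (pushforward A F Y q)) =
        X p ((\<lambda>q. g q (\<xi> q) (pushforward A F Y q)) \<circ> F)"
      by (rule pushforward_apply[OF F'(1) metric_smooth[OF g \<xi> pf[OF Y]]])
    also have "(\<lambda>q. g q (\<xi> q) (pushforward A F Y q)) \<circ> F = (\<lambda>q. \<epsilon> * g q (\<xi> q) (Y q))"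
      by (simp add: fun_eq_iff pushforward_at[OF F'(1)] inner[OF smooth_fieldD(1)[OF Y]])
    also have "X p \<dots> = \<epsilon> * X p (\<lambda>q. g q (\<xi> q) (Y q))"
      by (rule tangent_scale[OF smooth_fieldD(1)[OF X] metric_smooth[OF g \<xi> Y]])
    finally show ?thesis .
  qed
  show ?thesis
    unfolding dual_form_derivative_def transported[OF X Y] transported[OF Y X]
      lie_bracket_pushforward[OF A A F'(2,1,3) X Y] inner[OF lie_bracket_tangent[OF D X Y]]
    by (simp add: algebra_simps)
qed

text \<open>
  Both \<open>\<epsilon>\<close> and the triple product at \<open>p\<close> cancel when the exterior derivative of $g(\<xi>, \<cdot>)$ at \<open>F p\<close> is
  computed in two ways, directly from the bundle curvature there and by transport from \<open>p\<close>. Only the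
  orientation sign \<open>\<sigma>\<close> remains.
\<close>

theorem bundle_curvature_isometry:
  fixes A :: "('e::t2_space, real^3) chart set"
  assumes A: "smooth_atlas A" and ori: "orientation A Or" and g: "riemannian_metric A g" and D: "levi_civita A g D"
    and bc: "bundle_curvature A g Or D \<xi> t" and F: "killing_isometry A g \<xi> F"
    and \<xi>: "smooth_field A \<xi>" "\<And>p. \<xi> p \<noteq> (\<lambda>f. 0)" and \<sigma>: "\<sigma> * \<sigma> = 1"
    and or: "\<And>U \<phi> V \<psi> p. (U, \<phi>) \<in> Or \<Longrightarrow> (V, \<psi>) \<in> Or \<Longrightarrow> p \<in> U \<inter> F -` V \<Longrightarrow>
      0 < \<sigma> * det (jacobian (\<psi> \<circ> F \<circ> inv_into U \<phi>) (at (\<phi> p)))"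
  shows "t (F p) = \<sigma> * t p"
proof -
  have iso: "riemannian_isometry A g A g F" using F by (simp add: killing_isometry_def)
  note F' = riemannian_isometryD[OF iso]
  note pf = smooth_field_pushforward[OF A A F'(2,1,3)]
  obtain \<epsilon> where \<epsilon>: "\<epsilon> * \<epsilon> = 1" "\<And>p. differential A F (\<xi> p) = (\<lambda>u. \<epsilon> * \<xi> (F p) u)"
    by (rule killing_isometry_sign[OF F]) (rule that)
  note TO = orientation_tangent_space[OF A ori] and dO = orientation_differential[OF A ori]
  have gO: "riemannian_metric Or g" using g by (simp add: orientation_riemannian_metric[OF A ori])
  have isoO: "riemannian_isometry Or g Or g F" by (rule orientation_riemannian_isometry[OF A ori iso])
  have \<xi>T: "\<xi> q \<in> tangent_space Or q" for q unfolding TO by (rule smooth_fieldD(1)[OF \<xi>(1)])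
  obtain u y where u: "u \<in> tangent_space Or p" and y: "y \<in> tangent_space Or p"
    and nz: "g p (cross_product g Or p u (\<xi> p)) y \<noteq> 0"
    by (rule ex_cross_product_nonzero[OF ori gO \<xi>T \<xi>(2)]) (rule that)
  obtain X where X: "smooth_field A X" "X p = u"
    by (rule ex_smooth_field_through[OF A u[unfolded TO]]) (rule that)
  obtain Y where Y: "smooth_field A Y" "Y p = y"
    by (rule ex_smooth_field_through[OF A y[unfolded TO]]) (rule that)
  define c where "c = g p (cross_product g Or p u (\<xi> p)) y"
  have dT: "differential A F w \<in> tangent_space Or (F p)" if "w \<in> tangent_space Or p" for w
    using differential_tangent[OF A A F'(2)] that by (simp add: TO)
  have "\<epsilon> * g (F p) (cross_product g Or (F p) (differential A F u) (\<xi> (F p))) (differential A F y) =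
      g (F p) (cross_product g Or (F p) (differential A F u) (differential A F (\<xi> p))) (differential A F y)"
    unfolding \<epsilon>(2) by (rule cross_product_scale_right[OF ori gO dT[OF u] \<xi>T dT[OF y], symmetric])
  also have "\<dots> = \<sigma> * c"
    using cross_product_isometry[OF ori gO isoO \<sigma> or u \<xi>T y] by (simp add: dO c_def)
  finally have cF: "\<epsilon> * g (F p) (cross_product g Or (F p) (differential A F u) (\<xi> (F p))) (differential A F y) = \<sigma> * c" .
  have "\<epsilon> * (\<epsilon> * (2 * t p * c)) = \<epsilon> * (\<epsilon> * dual_form_derivative A g \<xi> X Y p)"
    by (simp add: dual_form_derivative_bundle_curvature[OF A ori g D bc \<xi>(1) X(1) Y(1)] X(2) Y(2) c_def)
  also have "\<epsilon> * dual_form_derivative A g \<xi> X Y p =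
      dual_form_derivative A g \<xi> (pushforward A F X) (pushforward A F Y) (F p)"
    by (rule dual_form_derivative_pushforward[OF A g D iso \<epsilon> \<xi>(1) X(1) Y(1), symmetric])
  also have "\<epsilon> * \<dots> = 2 * t (F p) *
      (\<epsilon> * g (F p) (cross_product g Or (F p) (differential A F u) (\<xi> (F p))) (differential A F y))"
    by (simp add: dual_form_derivative_bundle_curvature[OF A ori g D bc \<xi>(1) pf[OF X(1)] pf[OF Y(1)]]
        pushforward_at[OF F'(1)] X(2) Y(2))
  also have "\<dots> = 2 * t (F p) * (\<sigma> * c)" unfolding cF ..
  finally have "t p * c = t (F p) * \<sigma> * c" by (simp add: mult.assoc[symmetric] \<epsilon>(1))
  then have "t p = t (F p) * \<sigma>" using nz by (simp add: c_def)
  then show ?thesis using \<sigma> by (simp add: mult.assoc mult.left_commute)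
qed

theorem lemma2p10:
  fixes A :: "('e::{t2_space, second_countable_topology}, real^3) chart set"
    and g :: "'e metric"
    and B :: "('m::{t2_space, second_countable_topology}, real^2) chart set"
    and gM :: "'m metric"
    and \<pi> :: "'e \<Rightarrow> 'm"
    and \<xi> :: "'e field"
    and Or :: "('e, real^3) chart set"
    and D :: "'e field \<Rightarrow> 'e field \<Rightarrow> 'e field"
    and \<tau> :: "'m \<Rightarrow> real"
    and f :: "'e \<Rightarrow> 'e"
  assumes "killing_submersion A g B gM \<pi> \<xi>"
    and "orientation A Or"
    and "levi_civita A g D"
    and "smooth_fun B \<tau>"
    and "bundle_curvature A g Or D \<xi> (\<tau> \<circ> \<pi>)"
    and "killing_isometry A g \<xi> f"
  shows "(\<exists>!h. riemannian_isometry B gM B gM h \<and> \<pi> \<circ> f = h \<circ> \<pi>) \<and>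
    (\<forall>h. riemannian_isometry B gM B gM h \<and> \<pi> \<circ> f = h \<circ> \<pi> \<longrightarrow>
       (orientation_preserving Or f \<longrightarrow> \<tau> \<circ> h = \<tau>) \<and>
       (orientation_reversing Or f \<longrightarrow> \<tau> \<circ> h = (\<lambda>x. - \<tau> x)))"
proof -
  note K = killing_submersionD[OF assms(1)]
  have \<xi>0: "\<xi> p \<noteq> (\<lambda>f. 0)" for p
    using K(11)[of p] metric_scale_left[OF K(2) smooth_fieldD(1)[OF K(7)] smooth_fieldD(1)[OF K(7)], of p 0] by auto
  obtain k where k: "riemannian_isometry B gM B gM k" "\<pi> \<circ> f = k \<circ> \<pi>"
    by (rule ex_induced_isometry[OF assms(1,6)]) (rule that)
  have unique: "h = k" if "\<pi> \<circ> f = h \<circ> \<pi>" for h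
  proof
    fix x
    obtain p where "x = \<pi> p" using K(6) by (metis surjD)
    then show "h x = k x" using fun_cong[OF that, of p] fun_cong[OF k(2), of p] by simp
  qed
  have sign: "\<tau> (h (\<pi> p)) = \<sigma> * \<tau> (\<pi> p)" if h: "\<pi> \<circ> f = h \<circ> \<pi>" and \<sigma>: "\<sigma> * \<sigma> = 1"
    and or: "\<And>U \<phi> V \<psi> p. (U, \<phi>) \<in> Or \<Longrightarrow> (V, \<psi>) \<in> Or \<Longrightarrow> p \<in> U \<inter> f -` V \<Longrightarrow>
      0 < \<sigma> * det (jacobian (\<psi> \<circ> f \<circ> inv_into U \<phi>) (at (\<phi> p)))" for h \<sigma> p
    using bundle_curvature_isometry[where p = p, OF K(1) assms(2) K(2) assms(3,5,6) K(7) \<xi>0 \<sigma> or] fun_cong[OF h, of p]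
    by simp
  show ?thesis
  proof (intro conjI ex1I[of _ k] allI impI)
    show "riemannian_isometry B gM B gM k" "\<pi> \<circ> f = k \<circ> \<pi>" by (fact k)+
    show "h = k" if "riemannian_isometry B gM B gM h \<and> \<pi> \<circ> f = h \<circ> \<pi>" for h
      using unique that by blast
  next
    fix h assume h: "riemannian_isometry B gM B gM h \<and> \<pi> \<circ> f = h \<circ> \<pi>" and or: "orientation_preserving Or f"
    show "\<tau> \<circ> h = \<tau>"
    proof
      fix x
      obtain p where p: "x = \<pi> p" using K(6) by (metis surjD)
      have "\<tau> (h (\<pi> p)) = 1 * \<tau> (\<pi> p)"
      proof (rule sign)
        fix U \<phi> V \<psi> q assume U: "(U, \<phi>) \<in> Or" and V: "(V, \<psi>) \<in> Or" and q: "q \<in> U \<inter> f -` V"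
        from bspec[OF or[unfolded orientation_preserving_def] U]
        have "\<forall>(V, \<psi>)\<in>Or. \<forall>p\<in>U \<inter> f -` V. 0 < det (jacobian (\<psi> \<circ> f \<circ> inv_into U \<phi>) (at (\<phi> p)))" by simp
        from bspec[OF this V] q show "0 < 1 * det (jacobian (\<psi> \<circ> f \<circ> inv_into U \<phi>) (at (\<phi> q)))" by simp
      qed (use h in simp_all)
      then show "(\<tau> \<circ> h) x = \<tau> x" by (simp add: p)
    qed
  next
    fix h assume h: "riemannian_isometry B gM B gM h \<and> \<pi> \<circ> f = h \<circ> \<pi>" and or: "orientation_reversing Or f"
    show "\<tau> \<circ> h = (\<lambda>x. - \<tau> x)"
    proof
      fix x
      obtain p where p: "x = \<pi> p" using K(6) by (metis surjD)
      have "\<tau> (h (\<pi> p)) = (-1) * \<tau> (\<pi> p)"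
      proof (rule sign)
        fix U \<phi> V \<psi> q assume U: "(U, \<phi>) \<in> Or" and V: "(V, \<psi>) \<in> Or" and q: "q \<in> U \<inter> f -` V"
        from bspec[OF or[unfolded orientation_reversing_def] U]
        have "\<forall>(V, \<psi>)\<in>Or. \<forall>p\<in>U \<inter> f -` V. det (jacobian (\<psi> \<circ> f \<circ> inv_into U \<phi>) (at (\<phi> p))) < 0" by simp
        from bspec[OF this V] q show "0 < (-1) * det (jacobian (\<psi> \<circ> f \<circ> inv_into U \<phi>) (at (\<phi> q)))" by simp
      qed (use h in simp_all)
      then show "(\<tau> \<circ> h) x = - \<tau> x" by (simp add: p)
    qed
  qed
qed

end
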